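(* There is a constant $C>0$ such that for all $x,y\in\mathbb{R}^d$, $$\tilde p(1,x,y)\le C(1\wedge|x|^\delta)(1\wedge|y|^\delta)\,p(1,x,y).$$
   Context: Let $d\ge1$ be an integer, $\alpha\in(0,d\wedge2)$, $\delta\in(0,\alpha)$. Let $p(t,x,y)=p(t,x-y)$ be the heat kernel of $\Delta^{\alpha/2}=-(-\Delta)^{\alpha/2}$ on $\mathbb{R}^d$, i.e. the transition density of the rotationally symmetric $\alpha$-stable process $(X_t)$. Let $\kappa_\delta=\frac{2^\alpha\Gamma(\frac{\alpha-\delta}{2})\Gamma(\frac{d+\delta}{2})}{\Gamma(\frac{-\delta}{2})\Gamma(\frac{d+\delta-\alpha}{2})}<0$ with $\Gamma(-\delta/2)=\int_0^\infty r^{-1-\delta/2}(e^{-r}-1)dr$, and $q(x)=\kappa_\delta|x|^{-\alpha}$. $\tilde p(t,x,y)$ is the symmetric kernel (satisfying Chapman–Kolmogorov) of the Feynman–Kac semigroup $\tilde P_tf(x)=\mathbb{E}^x[f(X_t)e^{\int_0^tq(X_s)ds}]$ for $x,y\ne0$, with $\tilde p(t,x,y)=0$ if $x=0$ or $y=0$. *)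

theory Defs
  imports "HOL-Analysis.Analysis" "HOL-Probability.Probability"
begin

text \<open>Heat kernel of the fractional Laplacian on R^d (d = CARD('n)), via Fourier inversion:
  p(t,x) = (2 pi)^(-d) * integral of exp(-t |xi|^alpha) cos(xi . x) d xi.\<close>
definition heat :: "real \<Rightarrow> real \<Rightarrow> real^'n \<Rightarrow> real" where
  "heat \<alpha> t x = (2 * pi) powr (- real CARD('n)) *
     (LINT \<xi>|lborel. exp (- t * norm \<xi> powr \<alpha>) * cos (\<xi> \<bullet> x))"

definition kappa :: "real \<Rightarrow> real \<Rightarrow> real \<Rightarrow> real" where
  "kappa d \<alpha> \<delta> = 2 powr \<alpha> * Gamma ((\<alpha> - \<delta>) / 2) * Gamma ((d + \<delta>) / 2) /
     (Gamma (- \<delta> / 2) * Gamma ((d + \<delta> - \<alpha>) / 2))"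

text \<open>Potential q(x) = kappa_delta |x|^(-alpha) (the value at x = 0 is irrelevant: Lebesgue-null).\<close>
definition pot :: "real \<Rightarrow> real \<Rightarrow> real^'n \<Rightarrow> real" where
  "pot \<alpha> \<delta> x = kappa (real CARD('n)) \<alpha> \<delta> * norm x powr (- \<alpha>)"

text \<open>X is (a jointly measurable version of) the rotationally symmetric alpha-stable process
  started at x on the probability space M: X_0 = x a.s., increments over disjoint
  consecutive intervals are independent and X_t - X_s has density p(t-s,.).\<close>
definition stable_process ::
  "real \<Rightarrow> 'a measure \<Rightarrow> (real \<Rightarrow> 'a \<Rightarrow> real^'n) \<Rightarrow> real^'n \<Rightarrow> bool" where
  "stable_process \<alpha> M X x \<longleftrightarrow>
     prob_space M \<and>
     (\<lambda>(t, \<omega>). X t \<omega>) \<in> borel_measurable (borel \<Otimes>\<^sub>M M) \<and>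
     (AE \<omega> in M. X 0 \<omega> = x) \<and>
     (\<forall>(n::nat) (s::nat \<Rightarrow> real). s 0 = 0 \<and> (\<forall>i<n. s i < s (Suc i)) \<longrightarrow>
        prob_space.indep_vars M (\<lambda>_. borel) (\<lambda>i \<omega>. X (s (Suc i)) \<omega> - X (s i) \<omega>) {..<n} \<and>
        (\<forall>i<n. distributed M lborel (\<lambda>\<omega>. X (s (Suc i)) \<omega> - X (s i) \<omega>)
                 (\<lambda>y. ennreal (heat \<alpha> (s (Suc i) - s i) y))))"

text \<open>Feynman--Kac weight exp(int_0^t q(X_s) ds) (with the convention exp(-infinity) = 0).\<close>
definition fk_weight :: "real \<Rightarrow> real \<Rightarrow> (real \<Rightarrow> 'a \<Rightarrow> real^'n) \<Rightarrow> real \<Rightarrow> 'a \<Rightarrow> real" where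
  "fk_weight \<alpha> \<delta> X t \<omega> =
     (let A = (\<integral>\<^sup>+ s. indicator {0..t} s * ennreal (- pot \<alpha> \<delta> (X s \<omega>)) \<partial>lborel)
      in if A = \<infinity> then 0 else exp (- enn2real A))"

text \<open>pt is the symmetric, Chapman--Kolmogorov kernel of the Feynman--Kac semigroup
  tilde P_t f(x) = E^x[f(X_t) exp(int_0^t q(X_s) ds)], vanishing when x = 0 or y = 0;
  here M x, X x is the stable process started at x.\<close>
definition fk_kernel ::
  "real \<Rightarrow> real \<Rightarrow> (real^'n \<Rightarrow> 'a measure) \<Rightarrow> (real^'n \<Rightarrow> real \<Rightarrow> 'a \<Rightarrow> real^'n)
    \<Rightarrow> (real \<Rightarrow> real^'n \<Rightarrow> real^'n \<Rightarrow> real) \<Rightarrow> bool" where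
  "fk_kernel \<alpha> \<delta> M X pt \<longleftrightarrow>
     (\<forall>t>0. \<forall>x y. pt t x y \<ge> 0 \<and> pt t x y = pt t y x) \<and>
     (\<forall>t>0. \<forall>y. pt t 0 y = 0) \<and>
     (\<forall>t>0. \<forall>x. pt t x \<in> borel_measurable borel) \<and>
     (\<forall>t>0. \<forall>s>0. \<forall>x y. ennreal (pt (t + s) x y) =
         (\<integral>\<^sup>+ z. ennreal (pt t x z) * ennreal (pt s z y) \<partial>lborel)) \<and>
     (\<forall>t>0. \<forall>x. x \<noteq> 0 \<longrightarrow> (\<forall>B \<in> sets borel.
         (\<integral>\<^sup>+ y. ennreal (pt t x y) * indicator B y \<partial>lborel) =
         (\<integral>\<^sup>+ \<omega>. indicator B (X x t \<omega>) * ennreal (fk_weight \<alpha> \<delta> (X x) t \<omega>) \<partial>M x)))"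

end

theory Submission
  imports Defs
begin

text \<open>
  Write \<open>P\<^sub>t\<close> for the stable semigroup, \<open>V = - q\<close> and \<open>u(x) = |x|\<^sup>\<delta>\<close>.

  The constant \<open>\<kappa>\<^sub>\<delta>\<close> is exactly the one for which \<open>P\<^sub>t u = u + \<integral>\<^sub>0\<^sup>t P\<^sub>s (V u) ds\<close>: represent
  \<open>|x|\<^sup>\<delta>\<close> and \<open>|x|\<close> to the power \<open>\<delta> - \<alpha>\<close> as Gamma mixtures of Gaussians and compute on the Fourier
  side. Perturbation by \<open>V\<close> (truncated at a level that tends to infinity) turns this into
  \<open>\<integral> p~(t,x,y) |y|\<^sup>\<delta> dy \<le> |x|\<^sup>\<delta>\<close>.

  The heat kernel is a limit of mixtures of Gaussians, so it is radially decreasing; tail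
  estimates read off from its Fourier transform then give
  \<open>p(t,x) \<le> C t |x|\<close> to the power \<open>- d - \<alpha>\<close> and the matching lower bound at \<open>t = 1\<close>.

  Splitting the mass \<open>m(t,x) = \<integral> p~(t,x,y) dy\<close> at \<open>|y| = \<eta>\<close> times \<open>t\<close> to the power \<open>1/\<alpha>\<close> gives
  \<open>m(t,x) \<le> C t\<^sup>-\<^sup>\<delta>\<^sup>/\<^sup>\<alpha> |x|\<^sup>\<delta> + \<theta> m(t/2,x)\<close> with small \<open>\<theta>\<close>, hence \<open>m(t,x) \<le> C t\<^sup>-\<^sup>\<delta>\<^sup>/\<^sup>\<alpha> |x|\<^sup>\<delta>\<close>. By the
  Chapman-Kolmogorov equation \<open>p~(1,x,y) \<le> C m(1/2,x) m(1/4,y)\<close>, which settles bounded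
  \<open>|x - y|\<close>. For \<open>|x| \<le> 1\<close> and large \<open>|y|\<close> the Chapman-Kolmogorov equation is iterated at the times
  \<open>2\<^sup>-\<^sup>k\<close> over slowly shrinking radii; the errors are summable because \<open>\<delta> < \<alpha>\<close>.
\<close>

section \<open>Gaussian integrals\<close>

text \<open>Nothing is differentiated: no generator, no evolution equation and no regularity of
  paths is used. Identities are arranged so that only sums of nonnegative terms occur, and a term is
  cancelled only once it is known to be finite. The Fourier formula for p oscillates and shows
  neither sign nor size; it is paired with Gaussians, where Fubini is harmless, and powers of |x|
  are reached by integrating over the width of the Gaussian. That p has mass 1 is read off from the
  process, whose increments have density p. The kernel is known only through integrals over sets, so
  its comparison with p holds at first almost everywhere; the Chapman-Kolmogorov equation makes it
  pointwise. In the mass estimate \<theta> has to lie below 2^(-\<delta>/\<alpha>), because halving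
  t multiplies t^(-\<delta>/\<alpha>) by 2^(\<delta>/\<alpha>). For large |y| a single splitting
  leaves a term of the right order in |y| but without the factor |x|^\<delta>. Repeating it at ever
  shorter times sends that term to 0, while the splitting at time 2^-k adds only an error of order
  2^-k m(2^-k, x), that is 2^(-k (1 - \<delta>/\<alpha>)) |x|^\<delta>, up to the loss from the
  radii.\<close>

lemma nn_integral_scaleR:
  fixes f :: "'a::euclidean_space \<Rightarrow> ennreal"
  assumes [measurable]: "f \<in> borel_measurable borel" and c: "c > 0"
  shows "(\<integral>\<^sup>+x. f x \<partial>lborel) = ennreal (c ^ DIM('a)) * (\<integral>\<^sup>+x. f (c *\<^sub>R x) \<partial>lborel)"
proof -
  have "(\<integral>\<^sup>+x. f x \<partial>lborel) =
      (\<integral>\<^sup>+x. f x \<partial>density (distr lborel borel (\<lambda>x. 0 + c *\<^sub>R x)) (\<lambda>_. \<bar>c\<bar> ^ DIM('a)))"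
    using lborel_affine[of c "0::'a"] c by simp
  also have "\<dots> = ennreal (c ^ DIM('a)) * (\<integral>\<^sup>+x. f (c *\<^sub>R x) \<partial>lborel)"
    using c by (simp add: nn_integral_density nn_integral_distr nn_integral_cmult)
  finally show ?thesis .
qed

lemma nn_integral_translation:
  fixes f :: "'a::euclidean_space \<Rightarrow> ennreal"
  assumes [measurable]: "f \<in> borel_measurable borel"
  shows "(\<integral>\<^sup>+x. f (a + x) \<partial>lborel) = (\<integral>\<^sup>+x. f x \<partial>lborel)"
  by (subst (2) lborel_distr_plus[of a, symmetric]) (simp add: nn_integral_distr)

lemma gaussian_fourier_complex_1d:
  fixes a t :: real
  assumes a: "a > 0"
  shows "has_bochner_integral lborel (\<lambda>x. exp (- a * x\<^sup>2) *\<^sub>R iexp (t * x))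
           (complex_of_real (sqrt (pi / a) * exp (- t\<^sup>2 / (4 * a))))"
proof -
  \<comment> \<open>Chosen so that the standard normal density at x / c is a multiple of exp (- a
    x^2); the characteristic function of the normal law then gives the transform.\<close>
  define c where "c = 1 / sqrt (2 * a)"
  have c: "c > 0" using a by (simp add: c_def)
  have c2: "c\<^sup>2 = 1 / (2 * a)" using a by (simp add: c_def power_divide)
  have int: "integrable lborel (\<lambda>x. std_normal_density x *\<^sub>R iexp ((t * c) * x))"
    by (rule Bochner_Integration.integrable_bound[OF integrable_normal_density[of 1 0]]) auto
  have "(LINT x|lborel. std_normal_density x *\<^sub>R iexp ((t * c) * x)) = char std_normal_distribution (t * c)"
    unfolding char_def by (subst integral_density) auto
  also have "\<dots> = exp (- (t * c)\<^sup>2 / 2)"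
    by (simp add: char_std_normal_distribution)
  finally have 1: "has_bochner_integral lborel (\<lambda>x. std_normal_density x *\<^sub>R iexp ((t * c) * x)) (complex_of_real (exp (- (t * c)\<^sup>2 / 2)))"
    using int by (simp add: has_bochner_integral_iff)
  have 2: "has_bochner_integral lborel (\<lambda>x. std_normal_density (0 + (1/c) * x) *\<^sub>R iexp ((t * c) * (0 + (1/c) * x)))
      (complex_of_real (exp (- (t * c)\<^sup>2 / 2)) /\<^sub>R \<bar>1/c\<bar>)"
    using c by (subst lborel_has_bochner_integral_real_affine_iff[symmetric]) (use 1 in auto)
  have e: "std_normal_density (0 + (1/c) * x) = (1 / sqrt (2 * pi)) * exp (- a * x\<^sup>2)" for x
    using c c2 a by (simp add: std_normal_density_def power_mult_distrib power_divide field_simps)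
  have "has_bochner_integral lborel (\<lambda>x. sqrt (2 * pi) *\<^sub>R (std_normal_density (0 + (1/c) * x) *\<^sub>R iexp ((t * c) * (0 + (1/c) * x))))
      (sqrt (2 * pi) *\<^sub>R (complex_of_real (exp (- (t * c)\<^sup>2 / 2)) /\<^sub>R \<bar>1/c\<bar>))"
    by (rule has_bochner_integral_scaleR_right) (use 2 in auto)
  also have "(\<lambda>x. sqrt (2 * pi) *\<^sub>R (std_normal_density (0 + (1/c) * x) *\<^sub>R iexp ((t * c) * (0 + (1/c) * x))))
    = (\<lambda>x. exp (- a * x\<^sup>2) *\<^sub>R iexp (t * x))"
    unfolding e using c by (auto simp: fun_eq_iff)
  also have "(sqrt (2 * pi) *\<^sub>R (complex_of_real (exp (- (t * c)\<^sup>2 / 2)) /\<^sub>R \<bar>1/c\<bar>))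
     = complex_of_real (sqrt (2 * pi) * c * exp (- (t * c)\<^sup>2 / 2))"
    using c by (simp add: scaleR_conv_of_real)
  also have "- (t * c)\<^sup>2 / 2 = - t\<^sup>2 / (4 * a)" using a by (simp add: power_mult_distrib c2)
  also have "sqrt (2 * pi) * c = sqrt (pi / a)"
    using a by (simp add: c_def real_sqrt_mult real_sqrt_divide)
  finally show ?thesis .
qed

text \<open>The integrand factors over the coordinates and Lebesgue measure is the image of a
  product measure, so the one-dimensional transform suffices.\<close>

lemma gaussian_fourier_complex:
  fixes x :: "'a::euclidean_space"
  assumes a: "a > 0"
  shows "has_bochner_integral lborel (\<lambda>\<xi>. exp (- a * (norm \<xi>)\<^sup>2) *\<^sub>R iexp (\<xi> \<bullet> x))
           (complex_of_real ((pi / a) powr (DIM('a) / 2) * exp (- (norm x)\<^sup>2 / (4 * a))))"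
proof -
  interpret product_sigma_finite "\<lambda>_::'a. lborel :: real measure" ..
  define f where "f b s = exp (- a * s\<^sup>2) *\<^sub>R iexp ((x \<bullet> b) * s)" for b :: 'a and s :: real
  have f: "has_bochner_integral lborel (f b) (complex_of_real (sqrt (pi / a) * exp (- (x \<bullet> b)\<^sup>2 / (4 * a))))" for b
    unfolding f_def by (rule gaussian_fourier_complex_1d[OF a])
  have n2: "(norm z)\<^sup>2 = (\<Sum>b\<in>Basis. (z \<bullet> b)\<^sup>2)" for z :: 'a
    unfolding power2_norm_eq_inner by (subst euclidean_inner) (simp add: power2_eq_square)
  have pr: "exp (- a * (norm \<xi>)\<^sup>2) *\<^sub>R iexp (\<xi> \<bullet> x) = (\<Prod>b\<in>Basis. f b (\<xi> \<bullet> b))" for \<xi>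
  proof -
    have "(\<Prod>b\<in>Basis. f b (\<xi> \<bullet> b)) =
       (\<Prod>b\<in>Basis. complex_of_real (exp (- a * (\<xi> \<bullet> b)\<^sup>2))) * (\<Prod>b\<in>Basis. iexp ((x \<bullet> b) * (\<xi> \<bullet> b)))"
      by (simp add: f_def scaleR_conv_of_real prod.distrib)
    also have "(\<Prod>b\<in>Basis. complex_of_real (exp (- a * (\<xi> \<bullet> b)\<^sup>2))) = of_real (\<Prod>b\<in>Basis. exp (- a * (\<xi> \<bullet> b)\<^sup>2))"
      by simp
    also have "(\<Prod>b\<in>Basis. exp (- a * (\<xi> \<bullet> b)\<^sup>2)) = exp (- a * (norm \<xi>)\<^sup>2)"
      by (simp add: exp_sum[symmetric] n2 sum_distrib_left sum_negf)
    also have "(\<Prod>b\<in>Basis. iexp ((x \<bullet> b) * (\<xi> \<bullet> b))) = iexp (\<xi> \<bullet> x)"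
      by (subst exp_sum[symmetric], simp)
         (simp add: euclidean_inner[of \<xi> x] sum_distrib_left mult.commute)
    finally show ?thesis by (simp add: scaleR_conv_of_real)
  qed
  have m: "(\<lambda>\<xi>. exp (- a * (norm \<xi>)\<^sup>2) *\<^sub>R iexp (\<xi> \<bullet> x)) \<in> borel_measurable (borel :: 'a measure)"
    by measurable
  have inn: "(\<Sum>b\<in>Basis. g b *\<^sub>R b) \<bullet> c = g c" if "c \<in> Basis" for g :: "'a \<Rightarrow> real" and c
    using that by simp
  have eq: "exp (- a * (norm (\<Sum>b\<in>Basis. g b *\<^sub>R b))\<^sup>2) *\<^sub>R iexp ((\<Sum>b\<in>Basis. g b *\<^sub>R b) \<bullet> x) = (\<Prod>b\<in>Basis. f b (g b))"
    for g :: "'a \<Rightarrow> real"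
    unfolding pr by (rule prod.cong) (use inn in auto)
  have "has_bochner_integral (Pi\<^sub>M Basis (\<lambda>_. lborel)) (\<lambda>g. \<Prod>b\<in>Basis. f b (g b)) (\<Prod>b\<in>Basis. integral\<^sup>L lborel (f b))"
    using product_integrable_prod[of Basis f] product_integral_prod[of Basis f] f
    unfolding has_bochner_integral_iff by auto
  then have "has_bochner_integral lborel (\<lambda>\<xi>. exp (- a * (norm \<xi>)\<^sup>2) *\<^sub>R iexp (\<xi> \<bullet> x)) (\<Prod>b\<in>Basis. integral\<^sup>L lborel (f b))"
    using m by (subst lborel_eq, intro has_bochner_integral_distr) (simp_all only: eq, measurable)
  also have "(\<Prod>b\<in>Basis. integral\<^sup>L lborel (f b)) =
      (\<Prod>b\<in>Basis. complex_of_real (sqrt (pi / a) * exp (- (x \<bullet> b)\<^sup>2 / (4 * a))))"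
    using f by (intro prod.cong) (auto simp: has_bochner_integral_iff)
  also have "\<dots> = of_real (\<Prod>b\<in>Basis. (sqrt (pi / a) * exp (- (x \<bullet> b)\<^sup>2 / (4 * a))))"
    by simp
  also have "(\<Prod>b\<in>Basis. (sqrt (pi / a) * exp (- (x \<bullet> b)\<^sup>2 / (4 * a)))) =
     sqrt (pi / a) ^ DIM('a) * exp (- (norm x)\<^sup>2 / (4 * a))"
    by (simp add: prod.distrib exp_sum[symmetric] n2 sum_divide_distrib sum_negf)
  also have "sqrt (pi / a) ^ DIM('a) = (pi / a) powr (DIM('a) / 2)"
    using a by (simp add: powr_half_sqrt[symmetric] powr_powr flip: powr_realpow)
  finally show ?thesis .
qed

lemma gaussian_fourier:
  fixes x :: "'a::euclidean_space"
  assumes a: "a > 0"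
  shows "has_bochner_integral lborel (\<lambda>\<xi>. exp (- a * (norm \<xi>)\<^sup>2) * cos (\<xi> \<bullet> x))
           ((pi / a) powr (DIM('a) / 2) * exp (- (norm x)\<^sup>2 / (4 * a)))"
  using has_bochner_integral_Re[OF gaussian_fourier_complex[OF a, of x]] by (simp add: cis_conv_exp[symmetric])

text \<open>Needed for translated Gaussians: in \<open>heat_gaussian\<close> the expansion of the
  cosine at y - x produces a sine term.\<close>

lemma gaussian_fourier_sin:
  fixes x :: "'a::euclidean_space"
  assumes a: "a > 0"
  shows "has_bochner_integral lborel (\<lambda>\<xi>. exp (- a * (norm \<xi>)\<^sup>2) * sin (\<xi> \<bullet> x)) 0"
  using has_bochner_integral_Im[OF gaussian_fourier_complex[OF a, of x]] by (simp add: cis_conv_exp[symmetric])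

lemma integrable_gaussian:
  assumes "a > 0"
  shows "integrable lborel (\<lambda>\<xi>::'a::euclidean_space. exp (- a * (norm \<xi>)\<^sup>2))"
  using gaussian_fourier[OF assms, of "0::'a"] by (simp add: has_bochner_integral_iff)

lemma nn_integral_gaussian:
  assumes "a > 0"
  shows "nn_integral lborel (\<lambda>\<xi>::'a::euclidean_space. ennreal (exp (- a * (norm \<xi>)\<^sup>2))) = ennreal ((pi / a) powr (DIM('a) / 2))"
  using gaussian_fourier[OF assms, of "0::'a"] 
  by (subst nn_integral_eq_integral) (simp_all add: has_bochner_integral_iff)

text \<open>Scaling of the Gamma integral. Read from right to left, with m a squared norm, it
  represents a negative power of the norm as a mixture of Gaussians.\<close>

lemma nn_integral_Gamma_scaled:
  fixes b m :: real
  assumes b: "b > 0" and m: "m > 0"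
  shows "(\<integral>\<^sup>+r. ennreal (indicator {0<..} r * (r powr (b - 1) * exp (- r * m))) \<partial>lborel) = ennreal (Gamma b * m powr (- b))"
proof -
  have "ennreal (Gamma b) = (\<integral>\<^sup>+r. ennreal (indicator {0..} r * r powr (b - 1) / exp r) \<partial>lborel)"
    by (rule Gamma_conv_nn_integral_real[OF b])
  also have "\<dots> = (\<integral>\<^sup>+r. ennreal (indicator {0<..} r * (r powr (b - 1) * exp (- r))) \<partial>lborel)"
    by (intro nn_integral_cong_AE, use AE_lborel_singleton[of "0::real"] in eventually_elim)
       (auto simp: indicator_def exp_minus field_simps)
  also have "\<dots> = ennreal m * (\<integral>\<^sup>+r. ennreal (indicator {0<..} (m * r) * ((m * r) powr (b - 1) * exp (- (m * r)))) \<partial>lborel)"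
    by (subst nn_integral_scaleR[OF _ m]) (simp_all add: )
  also have "\<dots> = ennreal m * (\<integral>\<^sup>+r. ennreal (m powr (b - 1)) * ennreal (indicator {0<..} r * (r powr (b - 1) * exp (- r * m))) \<partial>lborel)"
    using m by (intro arg_cong2[where f="(*)"] nn_integral_cong)
      (auto simp: indicator_def zero_less_mult_iff powr_mult ennreal_mult[symmetric] mult_ac)
  also have "\<dots> = ennreal m * (ennreal (m powr (b - 1)) * (\<integral>\<^sup>+r. ennreal (indicator {0<..} r * (r powr (b - 1) * exp (- r * m))) \<partial>lborel))"
    by (subst nn_integral_cmult) auto
  also have "\<dots> = ennreal (m powr b) * (\<integral>\<^sup>+r. ennreal (indicator {0<..} r * (r powr (b - 1) * exp (- r * m))) \<partial>lborel)" (is "_ = _ * ?I")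
    using m by (subst mult.assoc[symmetric]) (simp add: ennreal_mult[symmetric] powr_diff)
  finally have *: "ennreal (m powr b) * ?I = ennreal (Gamma b)" ..
  have "?I = ennreal (m powr (- b)) * (ennreal (m powr b) * ?I)"
    using m by (subst mult.assoc[symmetric]) (simp add: ennreal_mult[symmetric] powr_add[symmetric])
  also have "\<dots> = ennreal (Gamma b * m powr (-b))"
    unfolding * using Gamma_real_pos[OF b] by (simp add: ennreal_mult[symmetric] mult.commute)
  finally show ?thesis .
qed

text \<open>An integrable majorant without polar coordinates: written as a Gamma mixture of
  Gaussians, its integral over \<xi> leaves the exponent d - 1 - d/2 in r, hence a multiple of Gamma
  (d/2).\<close>

lemma nn_integral_one_plus_norm_sq:
  "nn_integral lborel (\<lambda>\<xi>::'a::euclidean_space. ennreal ((1 + (norm \<xi>)\<^sup>2) powr (- real DIM('a)))) < \<infinity>"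
proof -
  let ?d = "real DIM('a)"
  have d: "?d > 0" by simp
  have "ennreal (Gamma ?d) * nn_integral lborel (\<lambda>\<xi>::'a. ennreal ((1 + (norm \<xi>)\<^sup>2) powr (- ?d))) =
      (\<integral>\<^sup>+\<xi>. (\<integral>\<^sup>+r. ennreal (indicator {0<..} r * (r powr (?d - 1) * exp (- r * (1 + (norm \<xi>)\<^sup>2)))) \<partial>lborel) \<partial>(lborel :: 'a measure))"
    using Gamma_real_pos[OF d]
    by (subst nn_integral_cmult[symmetric], simp)
       (intro nn_integral_cong, subst nn_integral_Gamma_scaled, auto simp: ennreal_mult add_pos_nonneg)
  also have "\<dots> = (\<integral>\<^sup>+r. (\<integral>\<^sup>+\<xi>. ennreal (indicator {0<..} r * (r powr (?d - 1) * exp (- r * (1 + (norm \<xi>)\<^sup>2)))) \<partial>(lborel :: 'a measure)) \<partial>lborel)"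
    by (rule lborel_pair.Fubini') measurable
  also have "\<dots> = (\<integral>\<^sup>+r. ennreal (pi powr (?d / 2)) * ennreal (indicator {0<..} r * (r powr (?d / 2 - 1) * exp (- r * 1))) \<partial>lborel)"
  proof (rule nn_integral_cong)
    fix r :: real
    show "(\<integral>\<^sup>+\<xi>. ennreal (indicator {0<..} r * (r powr (?d - 1) * exp (- r * (1 + (norm \<xi>)\<^sup>2)))) \<partial>(lborel :: 'a measure)) =
      ennreal (pi powr (?d / 2)) * ennreal (indicator {0<..} r * (r powr (?d / 2 - 1) * exp (- r * 1)))"
    proof (cases "r > 0")
      case True
      have "(\<integral>\<^sup>+\<xi>. ennreal (indicator {0<..} r * (r powr (?d - 1) * exp (- r * (1 + (norm \<xi>)\<^sup>2)))) \<partial>(lborel :: 'a measure)) =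
         (\<integral>\<^sup>+\<xi>. ennreal (r powr (?d - 1) * exp (- r)) * ennreal (exp (- r * (norm \<xi>)\<^sup>2)) \<partial>(lborel :: 'a measure))"
        using True by (intro nn_integral_cong) (simp add: ennreal_mult[symmetric] mult.assoc exp_add[symmetric] algebra_simps)
      also have "\<dots> = ennreal (r powr (?d - 1) * exp (- r)) * ennreal ((pi / r) powr (?d / 2))"
        by (subst nn_integral_cmult) (simp_all only: nn_integral_gaussian[OF True], measurable)
      also have "\<dots> = ennreal (pi powr (?d / 2) * (r powr (?d - 1 - ?d / 2) * exp (- r)))"
        unfolding powr_diff[of r "?d - 1"] using True by (simp add: ennreal_mult[symmetric] powr_divide field_simps)
      also have "?d - 1 - ?d / 2 = ?d / 2 - 1" by simp
      finally show ?thesis using True by (simp add: ennreal_mult[symmetric])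
    qed simp
  qed
  also have "\<dots> < \<infinity>"
    using nn_integral_Gamma_scaled[of "?d/2" 1] d
    by (subst nn_integral_cmult) (auto simp: ennreal_mult_less_top)
  finally show ?thesis using Gamma_real_pos[OF d] by (auto simp: ennreal_mult_less_top)
qed

section \<open>Integrability of the stable symbol and its pairing with Gaussians\<close>

lemma power_div_fact_le_exp:
  fixes x :: real
  assumes "x \<ge> 0"
  shows "x ^ k / fact k \<le> exp x"
proof -
  have "(\<Sum>n\<in>{k}. x ^ n /\<^sub>R fact n) \<le> (\<Sum>n. x ^ n /\<^sub>R fact n)"
    using assms exp_converges[of x] by (intro sum_le_suminf) (auto simp: sums_iff)
  then show ?thesis using exp_converges[of x] by (simp add: sums_iff divide_inverse mult.commute)
qed

lemma integrable_lborel_pair_mult: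
  fixes f :: "'a::euclidean_space \<Rightarrow> real" and g :: "'b::euclidean_space \<Rightarrow> real"
  assumes f: "integrable lborel f" and g: "integrable lborel g"
  shows "integrable (lborel \<Otimes>\<^sub>M lborel) (\<lambda>(x, y). f x * g y)"
proof (rule lborel_pair.Fubini_integrable)
  have [measurable]: "f \<in> borel_measurable borel" "g \<in> borel_measurable borel"
    using borel_measurable_integrable[OF f] borel_measurable_integrable[OF g] by auto
  show "(\<lambda>(x, y). f x * g y) \<in> borel_measurable (lborel \<Otimes>\<^sub>M lborel)" by measurable
qed (use f g in \<open>auto simp: abs_mult\<close>)

lemma exp_powr_le_rational:
  fixes t \<alpha> :: real and d :: nat
  assumes t: "t > 0" and \<alpha>: "\<alpha> > 0"
  obtains K where "\<And>m. m \<ge> 0 \<Longrightarrow> exp (- t * m powr \<alpha>) \<le> K * (1 + m\<^sup>2) powr (- real d)"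
proof -
  \<comment> \<open>With \<alpha> k >= 2 d, the k-th term of the exponential series of t m^\<alpha>
    already dominates m^(2 d) for m >= 1.\<close>
  obtain k :: nat where k: "2 * real d / \<alpha> \<le> real k" using real_arch_simple by blast
  have k': "2 * real d \<le> \<alpha> * real k" using k \<alpha> by (simp add: field_simps)
  define K where "K = 2 ^ d * (1 + fact k / t ^ k)"
  have "exp (- t * m powr \<alpha>) \<le> K * (1 + m\<^sup>2) powr (- real d)" if m: "m \<ge> 0" for m
  proof -
    have p: "(1 + m\<^sup>2) > 0" by (simp add: add_pos_nonneg)
    have "(1 + m\<^sup>2) ^ d \<le> K * exp (t * m powr \<alpha>)"
    proof (cases "m \<le> 1")
      case True
      then have "m\<^sup>2 \<le> 1" using m by (simp add: power_le_one)
      then have "(1 + m\<^sup>2) ^ d \<le> 2 ^ d" by (intro power_mono) auto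
      also have "\<dots> \<le> 2 ^ d * (1 + fact k / t ^ k) * 1" using t by simp
      also have "\<dots> \<le> K * exp (t * m powr \<alpha>)"
        unfolding K_def using t by (intro mult_left_mono) auto
      finally show ?thesis .
    next
      case False
      then have m1: "m \<ge> 1" by simp
      have "1 + m\<^sup>2 \<le> 2 * m\<^sup>2" using m1 by simp
      then have "(1 + m\<^sup>2) ^ d \<le> (2 * m\<^sup>2) ^ d" by (intro power_mono) auto
      also have "\<dots> = 2 ^ d * m powr (2 * real d)"
        using m1 by (simp add: power_mult_distrib powr_powr[symmetric] powr_realpow flip: powr_numeral)
      also have "\<dots> \<le> 2 ^ d * m powr (\<alpha> * real k)"
        using k' m1 by (intro mult_left_mono powr_mono) auto
      also have "m powr (\<alpha> * real k) = (t * m powr \<alpha>) ^ k / t ^ k"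
        using t m1 by (simp add: power_mult_distrib powr_powr[symmetric] powr_realpow)
      also have "(t * m powr \<alpha>) ^ k / t ^ k \<le> (fact k * exp (t * m powr \<alpha>)) / t ^ k"
        using power_div_fact_le_exp[of "t * m powr \<alpha>" k] t m1
        by (intro divide_right_mono) (auto simp: field_simps)
      also have "2 ^ d * (fact k * exp (t * m powr \<alpha>) / t ^ k) \<le> K * exp (t * m powr \<alpha>)"
        unfolding K_def by (simp add: field_simps)
      finally show ?thesis by (simp add: mult_left_mono)
    qed
    then show ?thesis using p by (simp add: powr_minus powr_realpow exp_minus field_simps)
  qed
  then show ?thesis using that by blast
qed

lemma integrable_exp_powr:
  fixes t \<alpha> :: real
  assumes t: "t > 0" and \<alpha>: "\<alpha> > 0"
  shows "integrable lborel (\<lambda>\<xi>::'a::euclidean_space. exp (- t * norm \<xi> powr \<alpha>))"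
proof -
  obtain K where K: "\<And>m. m \<ge> 0 \<Longrightarrow> exp (- t * m powr \<alpha>) \<le> K * (1 + m\<^sup>2) powr (- real DIM('a))"
    using exp_powr_le_rational[OF t \<alpha>] by blast
  have "integrable lborel (\<lambda>\<xi>::'a. (1 + (norm \<xi>)\<^sup>2) powr (- real DIM('a)))"
    using nn_integral_one_plus_norm_sq[where 'a='a] by (intro integrableI_bounded) auto
  then have "integrable lborel (\<lambda>\<xi>::'a. K * (1 + (norm \<xi>)\<^sup>2) powr (- real DIM('a)))"
    by simp
  then show ?thesis
    by (rule Bochner_Integration.integrable_bound) (use K in \<open>auto intro!: AE_I2 order_trans[OF _ abs_ge_self]\<close>)
qed

text \<open>The Gaussian density with variance 2 r in every coordinate, normalised so that its
  Fourier transform is exp (- r |x|^2) without further constants.\<close>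

definition gauss :: "real \<Rightarrow> 'a::euclidean_space \<Rightarrow> real" where
  "gauss r \<xi> = (4 * pi * r) powr (- real DIM('a) / 2) * exp (- (norm \<xi>)\<^sup>2 / (4 * r))"

lemma gauss_pos: "r > 0 \<Longrightarrow> gauss r \<xi> > 0"
  by (simp add: gauss_def)

lemma gauss_nonneg: "gauss r \<xi> \<ge> 0"
  by (simp add: gauss_def)

lemma gauss_measurable [measurable]:
  assumes [measurable]: "f \<in> borel_measurable M" "g \<in> borel_measurable M"
  shows "(\<lambda>x. gauss (f x) (g x :: 'a::euclidean_space)) \<in> borel_measurable M"
  unfolding gauss_def by measurable

lemma gauss_fourier:
  fixes x :: "'a::euclidean_space"
  assumes r: "r > 0"
  shows "has_bochner_integral lborel (\<lambda>\<xi>. gauss r \<xi> * cos (\<xi> \<bullet> x)) (exp (- r * (norm x)\<^sup>2))"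
proof -
  have "has_bochner_integral lborel (\<lambda>\<xi>. (4 * pi * r) powr (- real DIM('a) / 2) * (exp (- (1 / (4 * r)) * (norm \<xi>)\<^sup>2) * cos (\<xi> \<bullet> x)))
     ((4 * pi * r) powr (- real DIM('a) / 2) * ((pi / (1 / (4 * r))) powr (DIM('a) / 2) * exp (- (norm x)\<^sup>2 / (4 * (1 / (4 * r))))))"
    by (intro has_bochner_integral_mult_right) (use gaussian_fourier[of "1 / (4 * r)" x] r in auto)
  then show ?thesis using r
    by (simp add: gauss_def mult_ac powr_minus field_simps)
qed

lemma gauss_integral: "r > 0 \<Longrightarrow> has_bochner_integral lborel (gauss r :: 'a::euclidean_space \<Rightarrow> real) 1"
  using gauss_fourier[of r "0::'a"] by simp

text \<open>Parseval's identity for a Gaussian against the heat kernel. The Gaussian and the symbol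
  are both integrable, so Fubini applies. The tail estimates and the moments of the kernel below all
  start from this identity.\<close>

lemma heat_gaussian:
  fixes x :: "real^'n"
  assumes t: "t > 0" and \<alpha>: "\<alpha> > 0" and r: "r > 0"
  shows "integrable lborel (\<lambda>y. exp (- r * (norm (x + y))\<^sup>2) * heat \<alpha> t y)"
    and "(LINT y|lborel. exp (- r * (norm (x + y))\<^sup>2) * heat \<alpha> t y) =
         (LINT \<xi>|lborel. gauss r \<xi> * cos (\<xi> \<bullet> x) * exp (- t * norm \<xi> powr \<alpha>))"
proof -
  let ?d = "real CARD('n)"
  define F where "F = (\<lambda>(y::real^'n, \<xi>::real^'n). exp (- r * (norm (x + y))\<^sup>2) * (exp (- t * norm \<xi> powr \<alpha>) * cos (\<xi> \<bullet> y)))"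
  have trans: "integrable lborel (\<lambda>y::real^'n. exp (- r * (norm (x + y))\<^sup>2))"
  proof -
    have "integrable (distr lborel borel ((+) x)) (\<lambda>y::real^'n. exp (- r * (norm y)\<^sup>2))"
      using integrable_gaussian[OF r] by (simp add: lborel_distr_plus)
    then show ?thesis by (subst (asm) integrable_distr_eq) auto
  qed
  have intB: "integrable (lborel \<Otimes>\<^sub>M lborel) (\<lambda>(y::real^'n, \<xi>::real^'n). exp (- r * (norm (x + y))\<^sup>2) * exp (- t * norm \<xi> powr \<alpha>))"
    using trans integrable_exp_powr[OF t \<alpha>] by (rule integrable_lborel_pair_mult)
  have intF: "integrable (lborel \<Otimes>\<^sub>M lborel) F"
    unfolding F_def by (rule Bochner_Integration.integrable_bound[OF intB]) (auto simp: abs_mult mult_le_cancel_left1)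
  have heat: "exp (- r * (norm (x + y))\<^sup>2) * heat \<alpha> t y = (2 * pi) powr (- ?d) * (LINT \<xi>|lborel. F (y, \<xi>))" for y
    by (simp add: heat_def F_def)
  have "integrable lborel (\<lambda>y. LINT \<xi>|lborel. F (y, \<xi>))"
    using lborel_pair.integrable_fst[of "\<lambda>y \<xi>. F (y, \<xi>)"] intF by simp
  then show "integrable lborel (\<lambda>y. exp (- r * (norm (x + y))\<^sup>2) * heat \<alpha> t y)"
    unfolding heat by simp
  have inner: "(LINT y|lborel. F (y, \<xi>)) = exp (- t * norm \<xi> powr \<alpha>) * (cos (\<xi> \<bullet> x) * ((pi / r) powr (?d / 2) * exp (- (norm \<xi>)\<^sup>2 / (4 * r))))" for \<xi>
  proof -
    have "(LINT y|lborel. F (y, \<xi>)) = (LINT y|lborel. exp (- t * norm \<xi> powr \<alpha>) * (exp (- r * (norm (x + y))\<^sup>2) * cos (\<xi> \<bullet> ((x + y) - x))))"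
      by (rule Bochner_Integration.integral_cong) (auto simp: F_def)
    also have "\<dots> = exp (- t * norm \<xi> powr \<alpha>) * (LINT y|distr lborel borel ((+) x). exp (- r * (norm y)\<^sup>2) * cos (\<xi> \<bullet> (y - x)))"
      by (subst integral_distr) auto
    also have "(LINT y|distr lborel borel ((+) x). exp (- r * (norm y)\<^sup>2) * cos (\<xi> \<bullet> (y - x))) =
       (LINT y|lborel. cos (\<xi> \<bullet> x) * (exp (- r * (norm y)\<^sup>2) * cos (y \<bullet> \<xi>)) + sin (\<xi> \<bullet> x) * (exp (- r * (norm y)\<^sup>2) * sin (y \<bullet> \<xi>)))"
      unfolding lborel_distr_plus
      by (rule Bochner_Integration.integral_cong) (auto simp: inner_diff_right cos_diff algebra_simps inner_commute)
    also have "\<dots> = cos (\<xi> \<bullet> x) * ((pi / r) powr (?d / 2) * exp (- (norm \<xi>)\<^sup>2 / (4 * r)))"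
      using gaussian_fourier[OF r, of \<xi>] gaussian_fourier_sin[OF r, of \<xi>]
      by (subst Bochner_Integration.integral_add) (auto simp: has_bochner_integral_iff)
    finally show ?thesis .
  qed
  have "(LINT y|lborel. exp (- r * (norm (x + y))\<^sup>2) * heat \<alpha> t y) = (2 * pi) powr (- ?d) * (LINT y|lborel. LINT \<xi>|lborel. F (y, \<xi>))"
    unfolding heat by simp
  also have "(LINT y|lborel. LINT \<xi>|lborel. F (y, \<xi>)) = (LINT \<xi>|lborel. LINT y|lborel. F (y, \<xi>))"
    using lborel_pair.Fubini_integral[of "\<lambda>y \<xi>. F (y, \<xi>)"] intF by simp
  also have "(2 * pi) powr (- ?d) * \<dots> = (LINT \<xi>|lborel. (2 * pi) powr (- ?d) * (LINT y|lborel. F (y, \<xi>)))"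
    by simp
  also have "\<dots> = (LINT \<xi>|lborel. gauss r \<xi> * cos (\<xi> \<bullet> x) * exp (- t * norm \<xi> powr \<alpha>))"
  proof (rule Bochner_Integration.integral_cong[OF refl])
    fix \<xi> :: "real^'n"
    have "(2 * pi) powr (- ?d) * (pi / r) powr (?d / 2) = ((2 * pi) powr (- 2)) powr (?d / 2) * (pi / r) powr (?d / 2)"
      by (simp add: powr_powr)
    also have "\<dots> = ((2 * pi) powr (- 2) * (pi / r)) powr (?d / 2)"
      using r by (subst powr_mult) auto
    also have "(2 * pi) powr (- 2) * (pi / r) = inverse (4 * pi * r)"
      using r by (simp add: powr_minus field_simps power2_eq_square)
    also have "inverse (4 * pi * r) powr (?d / 2) = (4 * pi * r) powr (- ?d / 2)"
      using r by (simp add: powr_minus powr_divide inverse_eq_divide)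
    finally show "(2 * pi) powr (- ?d) * (LINT y|lborel. F (y, \<xi>)) = gauss r \<xi> * cos (\<xi> \<bullet> x) * exp (- t * norm \<xi> powr \<alpha>)"
      unfolding inner gauss_def by (simp add: mult_ac)
  qed
  finally show "(LINT y|lborel. exp (- r * (norm (x + y))\<^sup>2) * heat \<alpha> t y) =
         (LINT \<xi>|lborel. gauss r \<xi> * cos (\<xi> \<bullet> x) * exp (- t * norm \<xi> powr \<alpha>))" .
qed

section \<open>Radial monotonicity of the heat kernel\<close>

lemma nn_integral_powr_Icc:
  fixes a c :: real
  assumes "a > -1" "c \<ge> 0"
  shows "(\<integral>\<^sup>+v. ennreal (indicator {0..c} v * v powr a) \<partial>lborel) = ennreal (c powr (a + 1) / (a + 1))"
  using nn_integral_has_integral_lebesgue[OF _ has_integral_powr_from_0[OF assms]] by simp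

lemma one_minus_exp_integral:
  fixes r m :: real
  assumes "r > 0" "m \<ge> 0"
  shows "(\<integral>\<^sup>+v. ennreal (indicator {0..m} v * (r * exp (- r * v))) \<partial>lborel) = ennreal (1 - exp (- r * m))"
proof -
  have "(\<integral>\<^sup>+v. ennreal (r * exp (- r * v)) * indicator {0..m} v \<partial>lborel) = ennreal ((- exp (- r * m)) - (- exp (- r * 0)))"
    by (rule nn_integral_FTC_Icc) (use assms in \<open>auto intro!: derivative_eq_intros\<close>)
  also have "(\<integral>\<^sup>+v. ennreal (r * exp (- r * v)) * indicator {0..m} v \<partial>lborel) = (\<integral>\<^sup>+v. ennreal (indicator {0..m} v * (r * exp (- r * v))) \<partial>lborel)"
    by (intro nn_integral_cong) (auto simp: indicator_def)
  finally show ?thesis by simp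
qed

text \<open>Insert 1 - exp (- r m) as the integral of r exp (- r v) over 0 <= v <= m and exchange;
  the inner integral is Gamma (1 - \<beta>) v^(\<beta> - 1). With m a squared norm this represents
  both the symbol (\<beta> = \<alpha>/2) and |z|^\<delta> (\<beta> = \<delta>/2).\<close>

lemma nn_integral_one_minus_exp_powr:
  fixes \<beta> m :: real
  assumes \<beta>: "0 < \<beta>" "\<beta> < 1" and m: "m \<ge> 0"
  shows "(\<integral>\<^sup>+r. ennreal (indicator {0<..} r * (r powr (- 1 - \<beta>) * (1 - exp (- r * m)))) \<partial>lborel) = ennreal (Gamma (1 - \<beta>) / \<beta> * m powr \<beta>)"
proof -
  have "(\<integral>\<^sup>+r. ennreal (indicator {0<..} r * (r powr (- 1 - \<beta>) * (1 - exp (- r * m)))) \<partial>lborel) =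
      (\<integral>\<^sup>+r. (\<integral>\<^sup>+v. ennreal (indicator {0..m} v * (indicator {0<..} r * (r powr (1 - \<beta> - 1) * exp (- r * v)))) \<partial>lborel) \<partial>lborel)"
  proof (rule nn_integral_cong)
    fix r :: real
    show "ennreal (indicator {0<..} r * (r powr (- 1 - \<beta>) * (1 - exp (- r * m)))) =
      (\<integral>\<^sup>+v. ennreal (indicator {0..m} v * (indicator {0<..} r * (r powr (1 - \<beta> - 1) * exp (- r * v)))) \<partial>lborel)"
    proof (cases "r > 0")
      case True
      then have "ennreal (indicator {0<..} r * (r powr (- 1 - \<beta>) * (1 - exp (- r * m)))) =
          ennreal (r powr (- 1 - \<beta>)) * (\<integral>\<^sup>+v. ennreal (indicator {0..m} v * (r * exp (- r * v))) \<partial>lborel)"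
        using m unfolding one_minus_exp_integral[OF True m] by (simp add: ennreal_mult[symmetric])
      also have "\<dots> = (\<integral>\<^sup>+v. ennreal (r powr (- 1 - \<beta>)) * ennreal (indicator {0..m} v * (r * exp (- r * v))) \<partial>lborel)"
        by (subst nn_integral_cmult) auto
      also have "\<dots> = (\<integral>\<^sup>+v. ennreal (indicator {0..m} v * (indicator {0<..} r * (r powr (1 - \<beta> - 1) * exp (- r * v)))) \<partial>lborel)"
        using True by (intro nn_integral_cong) (simp add: ennreal_mult[symmetric] powr_diff powr_minus field_simps)
      finally show ?thesis .
    qed simp
  qed
  also have "\<dots> = (\<integral>\<^sup>+v. (\<integral>\<^sup>+r. ennreal (indicator {0..m} v * (indicator {0<..} r * (r powr (1 - \<beta> - 1) * exp (- r * v)))) \<partial>lborel) \<partial>lborel)"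
    by (rule lborel_pair.Fubini') measurable
  also have "\<dots> = (\<integral>\<^sup>+v. ennreal (Gamma (1 - \<beta>)) * ennreal (indicator {0..m} v * v powr (\<beta> - 1)) \<partial>lborel)"
  proof (intro nn_integral_cong_AE, use AE_lborel_singleton[of "0::real"] in eventually_elim)
    fix v :: real assume v: "v \<noteq> 0"
    show "(\<integral>\<^sup>+r. ennreal (indicator {0..m} v * (indicator {0<..} r * (r powr (1 - \<beta> - 1) * exp (- r * v)))) \<partial>lborel)
      = ennreal (Gamma (1 - \<beta>)) * ennreal (indicator {0..m} v * v powr (\<beta> - 1))"
    proof (cases "v \<in> {0..m}")
      case True
      then show ?thesis using nn_integral_Gamma_scaled[of "1 - \<beta>" v] \<beta> v Gamma_real_pos[of "1 - \<beta>"]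
        by (simp add: ennreal_mult[symmetric])
    qed simp
  qed
  also have "\<dots> = ennreal (Gamma (1 - \<beta>) / \<beta> * m powr \<beta>)"
    using nn_integral_powr_Icc[of "\<beta> - 1" m] m \<beta> Gamma_real_pos[of "1 - \<beta>"]
    by (subst nn_integral_cmult) (auto simp: ennreal_mult[symmetric])
  finally show ?thesis .
qed

text \<open>Points of equal norm can be compared in both directions, so radial symmetry is
  included.\<close>

definition rad_decr :: "('a::real_normed_vector \<Rightarrow> real) \<Rightarrow> bool" where
  "rad_decr f \<longleftrightarrow> (\<forall>x y. norm x \<le> norm y \<longrightarrow> 0 \<le> f y \<and> f y \<le> f x)"

lemma rad_decrD: "rad_decr f \<Longrightarrow> norm x \<le> norm y \<Longrightarrow> f y \<le> f x"
  by (auto simp: rad_decr_def)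

lemma rad_decr_nonneg: "rad_decr f \<Longrightarrow> 0 \<le> f x"
  by (auto simp: rad_decr_def)

lemma rad_decr_limit:
  assumes "\<And>n::nat. rad_decr (f n)" and "\<And>x. (\<lambda>n. f n x) \<longlonglongrightarrow> g x"
  shows "rad_decr g"
  unfolding rad_decr_def
proof (intro allI impI conjI)
  fix x y :: 'a assume xy: "norm x \<le> norm y"
  show "0 \<le> g y" using assms by (intro LIMSEQ_le_const[OF assms(2)]) (auto simp: rad_decr_def)
  show "g y \<le> g x" using assms xy by (intro LIMSEQ_le[OF assms(2) assms(2)]) (auto simp: rad_decr_def)
qed

text \<open>This class of Fourier symbols contains the constants and is closed under multiplication by
  mixtures of Gaussians and under bounded pointwise limits, hence contains
  \<open>\<xi> \<mapsto> exp (- t |\<xi>|\<^sup>\<alpha>)\<close>.\<close>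
definition decr_symbol :: "('a::euclidean_space \<Rightarrow> real) \<Rightarrow> bool" where
  "decr_symbol F \<longleftrightarrow> F \<in> borel_measurable borel \<and> (\<exists>B. \<forall>\<xi>. \<bar>F \<xi>\<bar> \<le> B) \<and>
     (\<forall>a>0. rad_decr (\<lambda>x. LINT \<xi>|lborel. F \<xi> * (exp (- a * (norm \<xi>)\<^sup>2) * cos (\<xi> \<bullet> x))))"

lemma integrable_bounded_gaussian_cos:
  fixes F :: "'a::euclidean_space \<Rightarrow> real"
  assumes [measurable]: "F \<in> borel_measurable borel" and B: "\<And>\<xi>. \<bar>F \<xi>\<bar> \<le> B" and a: "a > 0"
  shows "integrable lborel (\<lambda>\<xi>. F \<xi> * (exp (- a * (norm \<xi>)\<^sup>2) * cos (\<xi> \<bullet> x)))"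
proof -
  have "integrable lborel (\<lambda>\<xi>::'a. B * exp (- a * (norm \<xi>)\<^sup>2))"
    using integrable_gaussian[OF a] by (intro integrable_mult_right)
  then show ?thesis
  proof (rule Bochner_Integration.integrable_bound)
    show "AE \<xi> in lborel. norm (F \<xi> * (exp (- a * (norm \<xi>)\<^sup>2) * cos (\<xi> \<bullet> x))) \<le> norm (B * exp (- a * (norm \<xi>)\<^sup>2))"
    proof (intro AE_I2)
      fix \<xi> :: 'a
      have "B \<ge> 0" using B[of 0] by simp
      then have "\<bar>F \<xi>\<bar> * (exp (- a * (norm \<xi>)\<^sup>2) * \<bar>cos (\<xi> \<bullet> x)\<bar>) \<le> B * (exp (- a * (norm \<xi>)\<^sup>2) * 1)"
        by (intro mult_mono B mult_left_mono) auto
      then show "norm (F \<xi> * (exp (- a * (norm \<xi>)\<^sup>2) * cos (\<xi> \<bullet> x))) \<le> norm (B * exp (- a * (norm \<xi>)\<^sup>2))"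
        using \<open>B \<ge> 0\<close> by (simp add: abs_mult)
    qed
  qed simp
qed

lemma decr_symbol_const: 
  assumes "c \<ge> 0" shows "decr_symbol (\<lambda>_::'a::euclidean_space. c)"
  unfolding decr_symbol_def rad_decr_def
proof (intro conjI allI impI)
  fix a :: real and x y :: 'a assume a: "a > 0" and xy: "norm x \<le> norm y"
  have *: "(LINT \<xi>|lborel. c * (exp (- a * (norm \<xi>)\<^sup>2) * cos (\<xi> \<bullet> x))) = c * ((pi / a) powr (DIM('a) / 2) * exp (- (norm x)\<^sup>2 / (4 * a)))" for x :: 'a
    using gaussian_fourier[OF a, of x] by (simp add: has_bochner_integral_iff)
  show "0 \<le> (LINT \<xi>|lborel. c * (exp (- a * (norm \<xi>)\<^sup>2) * cos (\<xi> \<bullet> y)))" unfolding * using assms by simp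
  show "(LINT \<xi>|lborel. c * (exp (- a * (norm \<xi>)\<^sup>2) * cos (\<xi> \<bullet> y))) \<le> (LINT \<xi>|lborel. c * (exp (- a * (norm \<xi>)\<^sup>2) * cos (\<xi> \<bullet> x)))"
    unfolding * using assms xy a by (intro mult_left_mono) (auto simp: divide_right_mono power_mono)
qed auto

text \<open>The Gaussian factor inside \<open>decr_symbol\<close> supplies the dominating function,
  so a uniform bound is enough even where the symbols themselves are not integrable.\<close>

lemma decr_symbol_limit:
  fixes G :: "'a::euclidean_space \<Rightarrow> real"
  assumes F: "\<And>n::nat. decr_symbol (F n)" and B: "\<And>n \<xi>. \<bar>F n \<xi>\<bar> \<le> B"
    and lim: "\<And>\<xi>. (\<lambda>n. F n \<xi>) \<longlonglongrightarrow> G \<xi>"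
  shows "decr_symbol G"
  unfolding decr_symbol_def
proof (intro conjI allI impI)
  have [measurable]: "F n \<in> borel_measurable borel" for n using F[of n] by (simp add: decr_symbol_def)
  show m[measurable]: "G \<in> borel_measurable borel"
    by (rule borel_measurable_LIMSEQ_metric[OF _ lim]) simp
  have "\<bar>G \<xi>\<bar> \<le> B" for \<xi>
    by (rule LIMSEQ_le_const2[OF tendsto_rabs[OF lim]]) (use B in auto)
  then show "\<exists>B. \<forall>\<xi>. \<bar>G \<xi>\<bar> \<le> B" by blast
  fix a :: real assume a: "a > 0"
  have B0: "B \<ge> 0" using B[of 0 0] by linarith
  show "rad_decr (\<lambda>x. LINT \<xi>|lborel. G \<xi> * (exp (- a * (norm \<xi>)\<^sup>2) * cos (\<xi> \<bullet> x)))"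
  proof (rule rad_decr_limit)
    show "rad_decr (\<lambda>x. LINT \<xi>|lborel. F n \<xi> * (exp (- a * (norm \<xi>)\<^sup>2) * cos (\<xi> \<bullet> x)))" for n
      using F[of n] a by (auto simp: decr_symbol_def)
    fix x :: 'a
    show "(\<lambda>n. LINT \<xi>|lborel. F n \<xi> * (exp (- a * (norm \<xi>)\<^sup>2) * cos (\<xi> \<bullet> x))) \<longlonglongrightarrow> (LINT \<xi>|lborel. G \<xi> * (exp (- a * (norm \<xi>)\<^sup>2) * cos (\<xi> \<bullet> x)))"
    proof (rule integral_dominated_convergence[where w = "\<lambda>\<xi>. B * exp (- a * (norm \<xi>)\<^sup>2)"])
      show "integrable lborel (\<lambda>\<xi>::'a. B * exp (- a * (norm \<xi>)\<^sup>2))"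
        using integrable_gaussian[OF a] by (intro integrable_mult_right)
      show "AE \<xi> in lborel. (\<lambda>n. F n \<xi> * (exp (- a * (norm \<xi>)\<^sup>2) * cos (\<xi> \<bullet> x))) \<longlonglongrightarrow> G \<xi> * (exp (- a * (norm \<xi>)\<^sup>2) * cos (\<xi> \<bullet> x))"
        by (intro AE_I2 tendsto_mult lim tendsto_const)
      show "AE \<xi> in lborel. norm (F n \<xi> * (exp (- a * (norm \<xi>)\<^sup>2) * cos (\<xi> \<bullet> x))) \<le> B * exp (- a * (norm \<xi>)\<^sup>2)" for n
      proof (intro AE_I2)
        fix \<xi> :: 'a
        have "\<bar>F n \<xi>\<bar> * (exp (- a * (norm \<xi>)\<^sup>2) * \<bar>cos (\<xi> \<bullet> x)\<bar>) \<le> B * (exp (- a * (norm \<xi>)\<^sup>2) * 1)"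
          using B0 by (intro mult_mono B mult_left_mono) auto
        then show "norm (F n \<xi> * (exp (- a * (norm \<xi>)\<^sup>2) * cos (\<xi> \<bullet> x))) \<le> B * exp (- a * (norm \<xi>)\<^sup>2)"
          by (simp add: abs_mult)
      qed
    qed measurable
  qed
qed

lemma decr_symbol_add:
  assumes F: "decr_symbol F" and G: "decr_symbol G"
  shows "decr_symbol (\<lambda>\<xi>. F \<xi> + G \<xi>)"
  unfolding decr_symbol_def
proof (intro conjI allI impI)
  have [measurable]: "F \<in> borel_measurable borel" "G \<in> borel_measurable borel"
    using F G by (auto simp: decr_symbol_def)
  show "(\<lambda>\<xi>. F \<xi> + G \<xi>) \<in> borel_measurable borel" by measurable
  obtain A B where AB: "\<And>\<xi>. \<bar>F \<xi>\<bar> \<le> A" "\<And>\<xi>. \<bar>G \<xi>\<bar> \<le> B" using F G by (auto simp: decr_symbol_def)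
  have "\<bar>F \<xi> + G \<xi>\<bar> \<le> A + B" for \<xi> using AB[of \<xi>] by linarith
  then show "\<exists>B. \<forall>\<xi>. \<bar>F \<xi> + G \<xi>\<bar> \<le> B" by blast
  fix a :: real assume a: "a > 0"
  have "(\<lambda>x. LINT \<xi>|lborel. (F \<xi> + G \<xi>) * (exp (- a * (norm \<xi>)\<^sup>2) * cos (\<xi> \<bullet> x))) =
    (\<lambda>x. (LINT \<xi>|lborel. F \<xi> * (exp (- a * (norm \<xi>)\<^sup>2) * cos (\<xi> \<bullet> x))) + (LINT \<xi>|lborel. G \<xi> * (exp (- a * (norm \<xi>)\<^sup>2) * cos (\<xi> \<bullet> x))))"
    using a AB unfolding distrib_right
    by (intro ext Bochner_Integration.integral_add integrable_bounded_gaussian_cos) auto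
  then show "rad_decr (\<lambda>x. LINT \<xi>|lborel. (F \<xi> + G \<xi>) * (exp (- a * (norm \<xi>)\<^sup>2) * cos (\<xi> \<bullet> x)))"
    using F G a by (auto simp: decr_symbol_def rad_decr_def intro!: add_mono)
qed

lemma decr_symbol_cmult:
  assumes F: "decr_symbol F" and c: "c \<ge> 0"
  shows "decr_symbol (\<lambda>\<xi>. c * F \<xi>)"
  unfolding decr_symbol_def
proof (intro conjI allI impI)
  have [measurable]: "F \<in> borel_measurable borel"
    using F by (auto simp: decr_symbol_def)
  show "(\<lambda>\<xi>. c * F \<xi>) \<in> borel_measurable borel" by measurable
  obtain A where AB: "\<And>\<xi>. \<bar>F \<xi>\<bar> \<le> A" using F by (auto simp: decr_symbol_def)
  have "\<bar>c * F \<xi>\<bar> \<le> c * A" for \<xi> using AB[of \<xi>] c by (simp add: abs_mult mult_left_mono)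
  then show "\<exists>B. \<forall>\<xi>. \<bar>c * F \<xi>\<bar> \<le> B" by blast
  fix a :: real assume a: "a > 0"
  then show "rad_decr (\<lambda>x. LINT \<xi>|lborel. (c * F \<xi>) * (exp (- a * (norm \<xi>)\<^sup>2) * cos (\<xi> \<bullet> x)))"
    using F c by (auto simp: decr_symbol_def rad_decr_def mult.assoc intro!: mult_left_mono)
qed

definition gauss_mixture :: "(real \<Rightarrow> real) \<Rightarrow> 'a::euclidean_space \<Rightarrow> real" where
  "gauss_mixture w \<xi> = (LINT s|lborel. w s * exp (- s * (norm \<xi>)\<^sup>2))"

lemma integrable_mixture:
  fixes w :: "real \<Rightarrow> real"
  assumes w: "integrable lborel w" and w0: "\<And>s. w s \<ge> 0" "\<And>s. s \<le> 0 \<Longrightarrow> w s = 0" and m: "m \<ge> 0"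
  shows "integrable lborel (\<lambda>s. w s * exp (- s * m))"
proof (rule Bochner_Integration.integrable_bound[OF w])
  show "AE s in lborel. norm (w s * exp (- s * m)) \<le> norm (w s)"
  proof (intro AE_I2)
    fix s show "norm (w s * exp (- s * m)) \<le> norm (w s)"
      using w0(1)[of s] w0(2)[of s] m by (cases "s \<le> 0") (auto simp: abs_mult intro!: mult_left_le)
  qed
qed (use borel_measurable_integrable[OF w] in measurable)

lemma gauss_mixture_bounds:
  assumes w: "integrable lborel w" and w0: "\<And>s. w s \<ge> 0" "\<And>s. s \<le> 0 \<Longrightarrow> w s = 0"
  shows "0 \<le> gauss_mixture w \<xi>" "gauss_mixture w \<xi> \<le> (LINT s|lborel. w s)"
proof -
  show "0 \<le> gauss_mixture w \<xi>" unfolding gauss_mixture_def using w0 by (intro integral_nonneg_AE) auto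
  show "gauss_mixture w \<xi> \<le> (LINT s|lborel. w s)"
    unfolding gauss_mixture_def
  proof (rule integral_mono[OF integrable_mixture[OF w w0] w])
    fix s show "w s * exp (- s * (norm \<xi>)\<^sup>2) \<le> w s"
      using w0[of s] by (cases "s \<le> 0") (auto intro!: mult_left_le)
  qed auto
qed

text \<open>Multiplying a symbol by exp (- s |\<xi>|^2) only changes the damping a into a + s. The
  new transform is therefore an average over w of transforms that are already radially
  decreasing.\<close>

lemma decr_symbol_mixture_mult:
  fixes F :: "'a::euclidean_space \<Rightarrow> real"
  assumes w: "integrable lborel w" and w0: "\<And>s. w s \<ge> 0" "\<And>s. s \<le> 0 \<Longrightarrow> w s = 0"
    and F: "decr_symbol F"
  shows "decr_symbol (\<lambda>\<xi>. gauss_mixture w \<xi> * F \<xi>)"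
  unfolding decr_symbol_def
proof (intro conjI allI impI)
  have [measurable]: "w \<in> borel_measurable borel" "F \<in> borel_measurable borel"
    using borel_measurable_integrable[OF w] F by (auto simp: decr_symbol_def)
  show "(\<lambda>\<xi>. gauss_mixture w \<xi> * F \<xi>) \<in> borel_measurable borel"
    unfolding gauss_mixture_def by measurable
  obtain B where B: "\<And>\<xi>. \<bar>F \<xi>\<bar> \<le> B" using F by (auto simp: decr_symbol_def)
  have B0: "B \<ge> 0" using B[of 0] by linarith
  have "\<bar>gauss_mixture w \<xi> * F \<xi>\<bar> \<le> (LINT s|lborel. w s) * B" for \<xi>
    unfolding abs_mult using gauss_mixture_bounds[OF w w0, of \<xi>] B by (intro mult_mono) auto
  then show "\<exists>B. \<forall>\<xi>. \<bar>gauss_mixture w \<xi> * F \<xi>\<bar> \<le> B" by blast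
  fix a :: real assume a: "a > 0"
  define J where "J b x = (LINT \<xi>|lborel. F \<xi> * (exp (- b * (norm \<xi>)\<^sup>2) * cos (\<xi> \<bullet> x)))" for b and x :: 'a
  have J: "rad_decr (J b)" if "b > 0" for b
    using F that unfolding decr_symbol_def J_def by blast
  define H where "H x s \<xi> = w s * (F \<xi> * (exp (- (a + s) * (norm \<xi>)\<^sup>2) * cos (\<xi> \<bullet> x)))" for x :: 'a and s :: real and \<xi> :: 'a
  have "integrable (lborel \<Otimes>\<^sub>M lborel) (\<lambda>(s, \<xi>). w s * (B * exp (- a * (norm (\<xi>::'a))\<^sup>2)))"
    using w integrable_gaussian[OF a] by (intro integrable_lborel_pair_mult) auto
  then have Hint: "integrable (lborel \<Otimes>\<^sub>M lborel) (\<lambda>(s, \<xi>). H x s \<xi>)" for x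
  proof (rule Bochner_Integration.integrable_bound)
    show "(\<lambda>(s, \<xi>). H x s \<xi>) \<in> borel_measurable (lborel \<Otimes>\<^sub>M lborel)" unfolding H_def by measurable
    have "\<bar>H x s \<xi>\<bar> \<le> w s * (B * exp (- a * (norm \<xi>)\<^sup>2))" for s \<xi>
    proof (cases "s \<le> 0")
      case False
      have "0 \<le> s * (norm \<xi>)\<^sup>2" using False by simp
      then have "- (a + s) * (norm \<xi>)\<^sup>2 \<le> - a * (norm \<xi>)\<^sup>2" unfolding distrib_right minus_add_distrib by linarith
      then have "\<bar>F \<xi>\<bar> * (exp (- (a + s) * (norm \<xi>)\<^sup>2) * \<bar>cos (\<xi> \<bullet> x)\<bar>) \<le> B * (exp (- a * (norm \<xi>)\<^sup>2) * 1)"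
        using B0 by (intro mult_mono B) auto
      then show ?thesis using w0(1)[of s] by (simp add: H_def abs_mult mult_left_mono)
    qed (simp add: H_def w0)
    then show "AE p in lborel \<Otimes>\<^sub>M lborel. norm (case p of (s, \<xi>) \<Rightarrow> H x s \<xi>) \<le> norm (case p of (s, \<xi>) \<Rightarrow> w s * (B * exp (- a * (norm \<xi>)\<^sup>2)))"
      by (intro AE_I2) (auto intro!: order_trans[OF _ abs_ge_self])
  qed
  have inner: "(LINT \<xi>|lborel. H x s \<xi>) = w s * J (a + s) x" for x s
    by (simp add: H_def J_def)
  have int: "integrable lborel (\<lambda>s. w s * J (a + s) x)" for x
    using lborel_pair.integrable_fst[OF Hint[of x]] unfolding inner .
  have eq: "(LINT \<xi>|lborel. gauss_mixture w \<xi> * F \<xi> * (exp (- a * (norm \<xi>)\<^sup>2) * cos (\<xi> \<bullet> x))) = (LINT s|lborel. w s * J (a + s) x)" for x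
  proof -
    have "(LINT \<xi>|lborel. gauss_mixture w \<xi> * F \<xi> * (exp (- a * (norm \<xi>)\<^sup>2) * cos (\<xi> \<bullet> x))) = (LINT \<xi>|lborel. LINT s|lborel. H x s \<xi>)"
    proof (rule Bochner_Integration.integral_cong[OF refl])
      fix \<xi> :: 'a
      have "(LINT s|lborel. H x s \<xi>) = (LINT s|lborel. (w s * exp (- s * (norm \<xi>)\<^sup>2)) * (F \<xi> * (exp (- a * (norm \<xi>)\<^sup>2) * cos (\<xi> \<bullet> x))))"
        by (rule Bochner_Integration.integral_cong) (auto simp: H_def exp_add algebra_simps exp_diff exp_minus divide_inverse)
      then show "gauss_mixture w \<xi> * F \<xi> * (exp (- a * (norm \<xi>)\<^sup>2) * cos (\<xi> \<bullet> x)) = (LINT s|lborel. H x s \<xi>)"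
        by (subst (asm) integral_mult_left_zero) (simp add: gauss_mixture_def mult.assoc)
    qed
    also have "\<dots> = (LINT s|lborel. LINT \<xi>|lborel. H x s \<xi>)"
      by (rule lborel_pair.Fubini_integral[OF Hint])
    finally show ?thesis unfolding inner .
  qed
  show "rad_decr (\<lambda>x. LINT \<xi>|lborel. gauss_mixture w \<xi> * F \<xi> * (exp (- a * (norm \<xi>)\<^sup>2) * cos (\<xi> \<bullet> x)))"
    unfolding eq rad_decr_def
  proof (intro allI impI conjI)
    fix x y :: 'a assume xy: "norm x \<le> norm y"
    have wJ: "0 \<le> w s * J (a + s) y \<and> w s * J (a + s) y \<le> w s * J (a + s) x" for s
    proof (cases "s \<le> 0")
      case False
      then have "rad_decr (J (a + s))" using a by (intro J) auto
      then have "0 \<le> J (a + s) y" "J (a + s) y \<le> J (a + s) x"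
        using xy by (blast intro: rad_decrD rad_decr_nonneg)+
      then show ?thesis using w0(1)[of s] by (simp add: mult_left_mono)
    qed (simp add: w0)
    show "0 \<le> (LINT s|lborel. w s * J (a + s) y)" using wJ by (intro integral_nonneg_AE) auto
    show "(LINT s|lborel. w s * J (a + s) y) \<le> (LINT s|lborel. w s * J (a + s) x)"
      using wJ by (intro integral_mono int) auto
  qed
qed

text \<open>Powers of the mixture come by induction, and the exponential series has nonnegative
  coefficients since t >= 0.\<close>

lemma decr_symbol_exp_mixture:
  assumes w: "integrable lborel w" and w0: "\<And>s. w s \<ge> 0" "\<And>s. s \<le> 0 \<Longrightarrow> w s = 0" and t: "t \<ge> 0"
  shows "decr_symbol (\<lambda>\<xi>::'a::euclidean_space. exp (t * gauss_mixture w \<xi>))"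
proof -
  let ?g = "gauss_mixture w :: 'a \<Rightarrow> real"
  have pw: "decr_symbol (\<lambda>\<xi>. ?g \<xi> ^ k)" for k
  proof (induction k)
    case (Suc k)
    then show ?case using decr_symbol_mixture_mult[OF w w0 Suc] by simp
  qed (simp add: decr_symbol_const)
  have sum: "decr_symbol (\<lambda>\<xi>. \<Sum>k<n. (t * ?g \<xi>) ^ k /\<^sub>R fact k)" for n
  proof (induction n)
    case (Suc n)
    have "decr_symbol (\<lambda>\<xi>. (\<Sum>k<n. (t * ?g \<xi>) ^ k /\<^sub>R fact k) + (t ^ n / fact n) * ?g \<xi> ^ n)"
      by (intro decr_symbol_add Suc decr_symbol_cmult pw) (use t in auto)
    then show ?case by (simp add: power_mult_distrib field_simps)
  qed (simp add: decr_symbol_const)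
  show ?thesis
  proof (rule decr_symbol_limit[OF sum, where B = "exp (t * (LINT s|lborel. w s))"])
    fix n and \<xi> :: 'a
    have g: "0 \<le> ?g \<xi>" "?g \<xi> \<le> (LINT s|lborel. w s)" using gauss_mixture_bounds[OF w w0, of \<xi>] by auto
    have "(\<Sum>k<n. (t * ?g \<xi>) ^ k /\<^sub>R fact k) \<le> exp (t * ?g \<xi>)"
      unfolding exp_def using t g by (intro sum_le_suminf summable_exp_generic) auto
    also have "\<dots> \<le> exp (t * (LINT s|lborel. w s))" using t g by (simp add: mult_left_mono)
    finally show "\<bar>\<Sum>k<n. (t * ?g \<xi>) ^ k /\<^sub>R fact k\<bar> \<le> exp (t * (LINT s|lborel. w s))"
      using t g by (subst abs_of_nonneg) (auto intro!: sum_nonneg)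
    show "(\<lambda>n. \<Sum>k<n. (t * ?g \<xi>) ^ k /\<^sub>R fact k) \<longlonglongrightarrow> exp (t * ?g \<xi>)"
      using exp_converges[of "t * ?g \<xi>"] by (simp add: sums_def)
  qed
qed

text \<open>The integral of s^(-1-\<beta>) (1 - exp (- s |\<xi>|^2)) over s > 0 is c
  |\<xi>|^\<alpha>. Cutting it off near s = 0 makes the weight integrable, and the exponent becomes
  a constant minus a Gaussian mixture: the approximation of a stable law by compound Poisson
  laws.\<close>

lemma decr_symbol_exp_powr:
  assumes \<alpha>: "0 < \<alpha>" "\<alpha> < 2" and t: "t \<ge> 0"
  shows "decr_symbol (\<lambda>\<xi>::'a::euclidean_space. exp (- t * norm \<xi> powr \<alpha>))"
proof -
  define \<beta> where "\<beta> = \<alpha> / 2"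
  have \<beta>: "0 < \<beta>" "\<beta> < 1" using \<alpha> by (auto simp: \<beta>_def)
  define c where "c = Gamma (1 - \<beta>) / \<beta>"
  have c: "c > 0" using \<beta> by (simp add: c_def Gamma_real_pos)
  define h where "h m s = indicator {0<..} s * (s powr (- 1 - \<beta>) * (1 - exp (- s * m)))" for m s :: real
  have h0: "0 \<le> h m s" if "m \<ge> 0" for m s
    using that by (auto simp: h_def indicator_def)
  have hm[measurable]: "h m \<in> borel_measurable borel" for m unfolding h_def by measurable
  have h: "has_bochner_integral lborel (h m) (c * m powr \<beta>)" if "m \<ge> 0" for m
    using nn_integral_one_minus_exp_powr[OF \<beta> that] h0[OF that] c
    by (intro has_bochner_integral_nn_integral) (auto simp: h_def c_def[symmetric] less_imp_le)
  define w where "w n s = indicator {1 / real (Suc n)..} s * s powr (- 1 - \<beta>)" for n and s :: real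
  have w0: "w n s \<ge> 0" for n s by (simp add: w_def)
  have w00: "w n s = 0" if "s \<le> 0" for n s
  proof -
    have "1 / real (Suc n) > 0" by simp
    then have "\<not> 1 / real (Suc n) \<le> s" using that by linarith
    then show ?thesis by (simp add: w_def)
  qed
  have wi: "integrable lborel (w n)" for n
  proof -
    define e where "e = 1 / real (Suc n)"
    have e: "e > 0" by (simp add: e_def)
    have "integrable lborel (\<lambda>s. h 1 s / (1 - exp (- e)))"
      using h[of 1] by (simp add: has_bochner_integral_iff)
    then show ?thesis
    proof (rule Bochner_Integration.integrable_bound)
      show "w n \<in> borel_measurable lborel" unfolding w_def by measurable
      have "w n s \<le> h 1 s / (1 - exp (- e))" for s
      proof (cases "s \<ge> e")
        case True
        then have "s > 0" using e by simp
        have "(1 - exp (- e)) \<le> 1 - exp (- s)" using True by simp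
        then have "s powr (- 1 - \<beta>) * (1 - exp (- e)) \<le> s powr (- 1 - \<beta>) * (1 - exp (- s))"
          by (intro mult_left_mono) auto
        then have "s powr (- 1 - \<beta>) \<le> h 1 s / (1 - exp (- e))"
          using \<open>s > 0\<close> e by (subst pos_le_divide_eq) (simp_all add: h_def)
        then show ?thesis using True by (simp add: w_def e_def)
      next
        case False
        then have "w n s = 0" by (simp add: w_def e_def)
        then show ?thesis using e h0[of 1 s] by simp
      qed
      then have "norm (w n s) \<le> norm (h 1 s / (1 - exp (- e)))" for s
        using w0[of n s] by (smt (verit) real_norm_def)
      then show "AE s in lborel. norm (w n s) \<le> norm (h 1 s / (1 - exp (- e)))" by simp
    qed
  qed
  have wmi: "integrable lborel (\<lambda>s. w n s * exp (- s * m))" if "m \<ge> 0" for n m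
    by (rule integrable_mixture[of "w n"]) (use wi w0 w00 that in auto)
  have conv: "(\<lambda>n. ((LINT s|lborel. w n s) - gauss_mixture (w n) \<xi>)) \<longlonglongrightarrow> c * norm \<xi> powr \<alpha>" for \<xi> :: 'a
  proof -
    have "(LINT s|lborel. w n s) - gauss_mixture (w n) \<xi> = (LINT s|lborel. indicator {1 / real (Suc n)..} s * h ((norm \<xi>)\<^sup>2) s)" for n
    proof -
      have "(LINT s|lborel. w n s) - gauss_mixture (w n) \<xi> = (LINT s|lborel. w n s - w n s * exp (- s * (norm \<xi>)\<^sup>2))"
        unfolding gauss_mixture_def
        by (rule Bochner_Integration.integral_diff[symmetric, OF wi wmi]) simp
      also have "\<dots> = (LINT s|lborel. indicator {1 / real (Suc n)..} s * h ((norm \<xi>)\<^sup>2) s)"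
      proof (rule Bochner_Integration.integral_cong[OF refl])
        fix s
        show "w n s - w n s * exp (- s * (norm \<xi>)\<^sup>2) = indicator {1 / real (Suc n)..} s * h ((norm \<xi>)\<^sup>2) s"
        proof (cases "s \<le> 0")
          case True
          then show ?thesis using w00[of s n] by (simp add: h_def)
        next
          case False
          then show ?thesis by (simp add: h_def w_def right_diff_distrib mult.assoc)
        qed
      qed
      finally show ?thesis .
    qed
    moreover have "(\<lambda>n. LINT s|lborel. indicator {1 / real (Suc n)..} s * h ((norm \<xi>)\<^sup>2) s) \<longlonglongrightarrow> (LINT s|lborel. h ((norm \<xi>)\<^sup>2) s)"
    proof (rule integral_dominated_convergence[where w = "h ((norm \<xi>)\<^sup>2)"])
      show "integrable lborel (h ((norm \<xi>)\<^sup>2))" using h[of "(norm \<xi>)\<^sup>2"] by (simp add: has_bochner_integral_iff)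
      show "AE s in lborel. norm (indicator {1 / real (Suc n)..} s * h ((norm \<xi>)\<^sup>2) s) \<le> h ((norm \<xi>)\<^sup>2) s" for n
        using h0[of "(norm \<xi>)\<^sup>2"] by (intro AE_I2) (auto simp: indicator_def)
      show "AE s in lborel. (\<lambda>n. indicator {1 / real (Suc n)..} s * h ((norm \<xi>)\<^sup>2) s) \<longlonglongrightarrow> h ((norm \<xi>)\<^sup>2) s"
      proof (intro AE_I2)
        fix s :: real
        show "(\<lambda>n. indicator {1 / real (Suc n)..} s * h ((norm \<xi>)\<^sup>2) s) \<longlonglongrightarrow> h ((norm \<xi>)\<^sup>2) s"
        proof (cases "s > 0")
          case True
          have "(\<lambda>n. 1 / real (Suc n)) \<longlonglongrightarrow> 0" using LIMSEQ_inverse_real_of_nat by (simp add: divide_inverse)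
          then have "eventually (\<lambda>n. 1 / real (Suc n) < s) sequentially" using True by (rule order_tendstoD)
          then have "eventually (\<lambda>n. indicator {1 / real (Suc n)..} s * h ((norm \<xi>)\<^sup>2) s = h ((norm \<xi>)\<^sup>2) s) sequentially"
            by eventually_elim auto
          then show ?thesis by (rule tendsto_eventually)
        qed (simp add: h_def)
      qed
    qed (use hm in measurable)
    moreover have "(LINT s|lborel. h ((norm \<xi>)\<^sup>2) s) = c * norm \<xi> powr \<alpha>"
      using h[of "(norm \<xi>)\<^sup>2"] by (cases "\<xi> = 0") (auto simp: has_bochner_integral_iff \<beta>_def powr_powr simp flip: powr_numeral)
    ultimately show ?thesis by simp
  qed
  have ds: "decr_symbol (\<lambda>\<xi>::'a. exp (- (t / c) * ((LINT s|lborel. w n s) - gauss_mixture (w n) \<xi>)))" for n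
  proof -
    have "decr_symbol (\<lambda>\<xi>::'a. exp (- (t / c) * (LINT s|lborel. w n s)) * exp ((t / c) * gauss_mixture (w n) \<xi>))"
      using t c by (intro decr_symbol_cmult decr_symbol_exp_mixture[of "w n"] wi w0 w00) auto
    then show ?thesis by (simp add: exp_add[symmetric] algebra_simps)
  qed
  show ?thesis
  proof (rule decr_symbol_limit[OF ds, where B = 1])
    fix n and \<xi> :: 'a
    have "gauss_mixture (w n) \<xi> \<le> (LINT s|lborel. w n s)"
      by (rule gauss_mixture_bounds(2)) (use wi w0 w00 in auto)
    then show "\<bar>exp (- (t / c) * ((LINT s|lborel. w n s) - gauss_mixture (w n) \<xi>))\<bar> \<le> 1"
      using t c by (auto intro!: divide_nonneg_pos mult_nonneg_nonneg)
    have "(\<lambda>n. exp (- (t / c) * ((LINT s|lborel. w n s) - gauss_mixture (w n) \<xi>))) \<longlonglongrightarrow> exp (- (t / c) * (c * norm \<xi> powr \<alpha>))"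
      by (intro tendsto_intros conv)
    then show "(\<lambda>n. exp (- (t / c) * ((LINT s|lborel. w n s) - gauss_mixture (w n) \<xi>))) \<longlonglongrightarrow> exp (- t * norm \<xi> powr \<alpha>)"
      using c by simp
  qed
qed

text \<open>Removes the Gaussian damping by letting a = 1 / (n + 1) tend to 0; now the symbol itself
  is integrable and dominates.\<close>

lemma heat_rad_decr:
  assumes \<alpha>: "0 < \<alpha>" "\<alpha> < 2" and t: "t > 0"
  shows "rad_decr (heat \<alpha> t :: real^'n \<Rightarrow> real)"
proof -
  have "rad_decr (\<lambda>x::real^'n. LINT \<xi>|lborel. exp (- t * norm \<xi> powr \<alpha>) * cos (\<xi> \<bullet> x))"
  proof (rule rad_decr_limit)
    show "rad_decr (\<lambda>x::real^'n. LINT \<xi>|lborel. exp (- t * norm \<xi> powr \<alpha>) * (exp (- (1 / real (Suc n)) * (norm \<xi>)\<^sup>2) * cos (\<xi> \<bullet> x)))" for n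
      using decr_symbol_exp_powr[OF \<alpha>, of t, where 'a="real^'n"] t
    proof -
      assume "0 \<le> t \<Longrightarrow> decr_symbol (\<lambda>\<xi>::real^'n. exp (- t * norm \<xi> powr \<alpha>))"
      then have "decr_symbol (\<lambda>\<xi>::real^'n. exp (- t * norm \<xi> powr \<alpha>))" using t by simp
      moreover have "1 / real (Suc n) > 0" by simp
      ultimately show ?thesis unfolding decr_symbol_def by blast
    qed
    fix x :: "real^'n"
    show "(\<lambda>n. LINT \<xi>|lborel. exp (- t * norm \<xi> powr \<alpha>) * (exp (- (1 / real (Suc n)) * (norm \<xi>)\<^sup>2) * cos (\<xi> \<bullet> x))) \<longlonglongrightarrow>
      (LINT \<xi>|lborel. exp (- t * norm \<xi> powr \<alpha>) * cos (\<xi> \<bullet> x))"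
    proof (rule integral_dominated_convergence[where w = "\<lambda>\<xi>. exp (- t * norm \<xi> powr \<alpha>)"])
      show "integrable lborel (\<lambda>\<xi>::real^'n. exp (- t * norm \<xi> powr \<alpha>))" using integrable_exp_powr[OF t \<alpha>(1)] .
      show "AE \<xi> in lborel. norm (exp (- t * norm \<xi> powr \<alpha>) * (exp (- (1 / real (Suc n)) * (norm \<xi>)\<^sup>2) * cos (\<xi> \<bullet> x))) \<le> exp (- t * norm \<xi> powr \<alpha>)" for n
      proof (intro AE_I2)
        fix \<xi> :: "real^'n"
        have "exp (- (1 / real (Suc n)) * (norm \<xi>)\<^sup>2) * \<bar>cos (\<xi> \<bullet> x)\<bar> \<le> 1 * 1"
          by (intro mult_mono) auto
        then show "norm (exp (- t * norm \<xi> powr \<alpha>) * (exp (- (1 / real (Suc n)) * (norm \<xi>)\<^sup>2) * cos (\<xi> \<bullet> x))) \<le> exp (- t * norm \<xi> powr \<alpha>)"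
          by (simp add: abs_mult mult_le_cancel_left1)
      qed
      have 0: "(\<lambda>n. 1 / real (Suc n)) \<longlonglongrightarrow> 0" using LIMSEQ_inverse_real_of_nat by (simp add: divide_inverse)
      show "AE \<xi> in lborel. (\<lambda>n. exp (- t * norm \<xi> powr \<alpha>) * (exp (- (1 / real (Suc n)) * (norm \<xi>)\<^sup>2) * cos (\<xi> \<bullet> x))) \<longlonglongrightarrow> exp (- t * norm \<xi> powr \<alpha>) * cos (\<xi> \<bullet> x)"
      proof (intro AE_I2)
        fix \<xi> :: "real^'n"
        have "(\<lambda>n. exp (- t * norm \<xi> powr \<alpha>) * (exp (- (1 / real (Suc n)) * (norm \<xi>)\<^sup>2) * cos (\<xi> \<bullet> x))) \<longlonglongrightarrow> exp (- t * norm \<xi> powr \<alpha>) * (exp (- 0 * (norm \<xi>)\<^sup>2) * cos (\<xi> \<bullet> x))"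
          by (intro tendsto_mult tendsto_const tendsto_exp tendsto_minus 0)
        then show "(\<lambda>n. exp (- t * norm \<xi> powr \<alpha>) * (exp (- (1 / real (Suc n)) * (norm \<xi>)\<^sup>2) * cos (\<xi> \<bullet> x))) \<longlonglongrightarrow> exp (- t * norm \<xi> powr \<alpha>) * cos (\<xi> \<bullet> x)"
          by simp
      qed
    qed measurable
  qed
  then show ?thesis
    unfolding heat_def rad_decr_def by (auto intro!: mult_left_mono)
qed

section \<open>Two-sided heat kernel bounds\<close>

lemma one_minus_exp_bounds:
  fixes v :: real
  assumes "v \<ge> 0"
  shows "1 - exp (- v) \<le> v" "v * exp (- v) \<le> 1 - exp (- v)" "v \<le> 1 \<Longrightarrow> v \<le> 2 * (1 - exp (- v))"
proof -
  show "1 - exp (- v) \<le> v" using exp_ge_add_one_self[of "- v"] by linarith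
  have "(1 + v) * exp (- v) \<le> exp v * exp (- v)"
    using exp_ge_add_one_self[of v] by (intro mult_right_mono) auto
  then show 1: "v * exp (- v) \<le> 1 - exp (- v)" by (simp add: exp_add[symmetric] algebra_simps)
  assume v: "v \<le> 1"
  have "(1 + v) * exp (- v) \<le> 1" using 1 by (simp add: algebra_simps)
  then have "exp (- v) \<le> 1 / (1 + v)" using assms by (simp add: field_simps)
  then have "2 * (1 - exp (- v)) \<ge> 2 * v / (1 + v)" using assms by (simp add: field_simps)
  moreover have "2 * v / (1 + v) \<ge> v" using assms v mult_left_mono[of v 1 v] by (simp add: field_simps)
  ultimately show "v \<le> 2 * (1 - exp (- v))" by linarith
qed

lemma nn_integral_gauss_scale:
  fixes f :: "'a::euclidean_space \<Rightarrow> ennreal"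
  assumes [measurable]: "f \<in> borel_measurable borel" and r: "r > 0"
  shows "(\<integral>\<^sup>+\<xi>. ennreal (gauss r \<xi>) * f \<xi> \<partial>lborel) = (\<integral>\<^sup>+\<xi>. ennreal (gauss 1 \<xi>) * f (sqrt r *\<^sub>R \<xi>) \<partial>lborel)"
proof -
  have g: "sqrt r ^ DIM('a) * gauss r (sqrt r *\<^sub>R \<xi>) = gauss 1 \<xi>" for \<xi> :: 'a
  proof -
    have "sqrt r ^ DIM('a) = r powr (DIM('a) / 2)"
      using r by (simp add: powr_half_sqrt[symmetric] powr_powr flip: powr_realpow)
    then show ?thesis using r
      by (simp add: gauss_def power_mult_distrib powr_mult powr_minus)
  qed
  have "(\<integral>\<^sup>+\<xi>. ennreal (gauss r \<xi>) * f \<xi> \<partial>lborel) =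
     ennreal (sqrt r ^ DIM('a)) * (\<integral>\<^sup>+\<xi>. ennreal (gauss r (sqrt r *\<^sub>R \<xi>)) * f (sqrt r *\<^sub>R \<xi>) \<partial>lborel)"
    using r by (subst nn_integral_scaleR[of _ "sqrt r"]) auto
  also have "\<dots> = (\<integral>\<^sup>+\<xi>. ennreal (sqrt r ^ DIM('a)) * (ennreal (gauss r (sqrt r *\<^sub>R \<xi>)) * f (sqrt r *\<^sub>R \<xi>)) \<partial>lborel)"
    by (subst nn_integral_cmult) auto
  also have "\<dots> = (\<integral>\<^sup>+\<xi>. ennreal (gauss 1 \<xi>) * f (sqrt r *\<^sub>R \<xi>) \<partial>lborel)"
    using r by (intro nn_integral_cong, subst mult.assoc[symmetric], subst ennreal_mult[symmetric])
       (auto simp: gauss_nonneg g)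
  finally show ?thesis .
qed

lemma integrable_gauss_moment:
  assumes "0 < \<alpha>" "\<alpha> < 2"
  shows "integrable lborel (\<lambda>\<xi>::'a::euclidean_space. gauss 1 \<xi> * norm \<xi> powr \<alpha>)"
proof -
  have "integrable lborel (\<lambda>\<xi>::'a. (4 * pi) powr (- real DIM('a) / 2) * 8 * exp (- (1 / 8) * (norm \<xi>)\<^sup>2))"
    by (intro integrable_mult_right integrable_gaussian) auto
  then show ?thesis
  proof (rule Bochner_Integration.integrable_bound)
    have "gauss 1 \<xi> * norm \<xi> powr \<alpha> \<le> (4 * pi) powr (- real DIM('a) / 2) * 8 * exp (- (1 / 8) * (norm \<xi>)\<^sup>2)" for \<xi> :: 'a
    proof -
      have "norm \<xi> powr \<alpha> \<le> 1 + (norm \<xi>)\<^sup>2"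
      proof (cases "norm \<xi> \<le> 1")
        case True
        then have "norm \<xi> powr \<alpha> \<le> 1" using assms by (simp add: powr_le1)
        then show ?thesis by (simp add: add_increasing2)
      next
        case False
        then have "norm \<xi> powr \<alpha> \<le> norm \<xi> powr 2" using assms by (intro powr_mono) auto
        then show ?thesis by simp
      qed
      also have "\<dots> \<le> 8 * (1 + (norm \<xi>)\<^sup>2 / 8)" by simp
      also have "\<dots> \<le> 8 * exp ((norm \<xi>)\<^sup>2 / 8)" by (intro mult_left_mono exp_ge_add_one_self) auto
      finally have "gauss 1 \<xi> * norm \<xi> powr \<alpha> \<le> gauss 1 \<xi> * (8 * exp ((norm \<xi>)\<^sup>2 / 8))"
        by (intro mult_left_mono gauss_nonneg)
      also have "\<dots> = (4 * pi) powr (- real DIM('a) / 2) * 8 * (exp (- (norm \<xi>)\<^sup>2 / 4) * exp ((norm \<xi>)\<^sup>2 / 8))"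
        by (simp add: gauss_def)
      also have "exp (- (norm \<xi>)\<^sup>2 / 4) * exp ((norm \<xi>)\<^sup>2 / 8) = exp (- (1 / 8) * (norm \<xi>)\<^sup>2)"
        unfolding exp_add[symmetric] by (rule arg_cong[where f=exp]) simp
      finally show ?thesis .
    qed
    then show "AE \<xi> in lborel. norm (gauss 1 \<xi> * norm \<xi> powr \<alpha>) \<le> norm ((4 * pi) powr (- real DIM('a) / 2) * 8 * exp (- (1 / 8) * (norm (\<xi>::'a))\<^sup>2))"
      by (intro AE_I2) (simp add: gauss_nonneg)
  qed simp
qed

lemma heat_measurable_pair [measurable (raw)]:
  assumes [measurable]: "f \<in> borel_measurable M" "g \<in> borel_measurable M"
  shows "(\<lambda>x. heat \<alpha> (f x) (g x :: real^'n)) \<in> borel_measurable M"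
proof -
  have "(\<lambda>(t, y). heat \<alpha> t (y::real^'n)) \<in> borel_measurable (borel \<Otimes>\<^sub>M borel)"
    unfolding heat_def by measurable
  from measurable_compose[OF _ this, of "\<lambda>x. (f x, g x)" M] show ?thesis by simp
qed

text \<open>\<open>mass\<close> is discharged by \<open>stable_process_mass\<close>, the heat kernel
  being the density of an increment. The argument \<open>N\<close> only carries the
  dimension.\<close>

locale stable_heat =
  fixes \<alpha> :: real and N :: "'n::finite itself"
  assumes \<alpha>: "0 < \<alpha>" "\<alpha> < 2"
    and mass: "\<And>t. t > 0 \<Longrightarrow> nn_integral lborel (\<lambda>y::real^'n. ennreal (heat \<alpha> t y)) = 1"
begin

lemma heat_nonneg: "t > 0 \<Longrightarrow> 0 \<le> heat \<alpha> t (x::real^'n)"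
  using heat_rad_decr[OF \<alpha>, of t] by (rule rad_decr_nonneg)

lemma heat_decr: "t > 0 \<Longrightarrow> norm x \<le> norm y \<Longrightarrow> heat \<alpha> t (y::real^'n) \<le> heat \<alpha> t (x::real^'n)"
  by (rule rad_decrD[OF heat_rad_decr[OF \<alpha>]])

lemma heat_integral: "t > 0 \<Longrightarrow> has_bochner_integral lborel (heat \<alpha> t :: real^'n \<Rightarrow> real) 1"
  using mass[of t] heat_nonneg[of t] by (intro has_bochner_integral_nn_integral) auto

text \<open>\<open>heat_gaussian\<close> at x = 0 subtracted from total mass 1 on both sides. The
  weight 1 - exp (- r |y|^2) acts as a smooth indicator of |y| >= r^(-1/2), so tails of the kernel
  are measured by the symbol.\<close>

lemma heat_gauss_deficit:
  assumes t: "t > 0" and r: "r > 0"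
  shows "(\<integral>\<^sup>+y. ennreal ((1 - exp (- r * (norm y)\<^sup>2)) * heat \<alpha> t (y::real^'n)) \<partial>lborel) =
         (\<integral>\<^sup>+\<xi>. ennreal (gauss r (\<xi>::real^'n)) * ennreal (1 - exp (- t * norm \<xi> powr \<alpha>)) \<partial>lborel)"
proof -
  note hg = heat_gaussian[OF t \<alpha>(1) r, of "0::real^'n"]
  have hi: "integrable lborel (heat \<alpha> t :: real^'n \<Rightarrow> real)" "(LINT y|lborel. heat \<alpha> t (y::real^'n)) = 1"
    using heat_integral[OF t] by (auto simp: has_bochner_integral_iff)
  have gi: "integrable lborel (gauss r :: real^'n \<Rightarrow> real)" "(LINT y|lborel. gauss r (y::real^'n)) = 1"
    using gauss_integral[OF r, where 'a="real^'n"] by (auto simp: has_bochner_integral_iff)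
  have gi2: "integrable lborel (\<lambda>\<xi>::real^'n. gauss r \<xi> * exp (- t * norm \<xi> powr \<alpha>))"
    by (rule Bochner_Integration.integrable_bound[OF gi(1)])
       (use t in \<open>auto simp: gauss_nonneg abs_mult intro!: mult_left_le\<close>)
  have 1: "integrable lborel (\<lambda>y::real^'n. (1 - exp (- r * (norm y)\<^sup>2)) * heat \<alpha> t y)"
    using Bochner_Integration.integrable_diff[OF hi(1) hg(1)] by (simp add: left_diff_distrib)
  have 2: "integrable lborel (\<lambda>\<xi>::real^'n. gauss r \<xi> * (1 - exp (- t * norm \<xi> powr \<alpha>)))"
    using Bochner_Integration.integrable_diff[OF gi(1) gi2] by (simp add: right_diff_distrib)
  have "(LINT y|lborel. (1 - exp (- r * (norm y)\<^sup>2)) * heat \<alpha> t (y::real^'n)) = 1 - (LINT y|lborel. exp (- r * (norm y)\<^sup>2) * heat \<alpha> t (y::real^'n))"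
    using Bochner_Integration.integral_diff[OF hi(1) hg(1)] hi(2) by (simp add: left_diff_distrib)
  also have "\<dots> = 1 - (LINT \<xi>|lborel. gauss r (\<xi>::real^'n) * exp (- t * norm \<xi> powr \<alpha>))"
    using hg(2) by simp
  also have "\<dots> = (LINT \<xi>|lborel. gauss r (\<xi>::real^'n) * (1 - exp (- t * norm \<xi> powr \<alpha>)))"
    using Bochner_Integration.integral_diff[OF gi(1) gi2] gi(2) by (simp add: right_diff_distrib)
  finally have eq: "(LINT y|lborel. (1 - exp (- r * (norm y)\<^sup>2)) * heat \<alpha> t (y::real^'n)) = (LINT \<xi>|lborel. gauss r (\<xi>::real^'n) * (1 - exp (- t * norm \<xi> powr \<alpha>)))" .
  have "(\<integral>\<^sup>+y. ennreal ((1 - exp (- r * (norm y)\<^sup>2)) * heat \<alpha> t (y::real^'n)) \<partial>lborel) = (LINT y|lborel. (1 - exp (- r * (norm y)\<^sup>2)) * heat \<alpha> t (y::real^'n))"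
    using r heat_nonneg[OF t] by (intro nn_integral_eq_integral 1) auto
  also have "\<dots> = (\<integral>\<^sup>+\<xi>. ennreal (gauss r (\<xi>::real^'n) * (1 - exp (- t * norm \<xi> powr \<alpha>))) \<partial>lborel)"
    unfolding eq using t by (intro nn_integral_eq_integral[symmetric] 2) (auto simp: gauss_nonneg)
  also have "\<dots> = (\<integral>\<^sup>+\<xi>. ennreal (gauss r (\<xi>::real^'n)) * ennreal (1 - exp (- t * norm \<xi> powr \<alpha>)) \<partial>lborel)"
    using t by (intro nn_integral_cong ennreal_mult) (auto simp: gauss_nonneg)
  finally show ?thesis .
qed

text \<open>Constants for v exp (- v) <= 1 - exp (- v) <= v once the Gaussian is rescaled to r = 1:
  \<open>gmom\<close> serves the upper bound, \<open>gmom0\<close> the lower one.\<close>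

definition gmom :: real where
  "gmom = (LINT \<xi>|lborel. gauss 1 (\<xi>::real^'n) * norm \<xi> powr \<alpha>)"

definition gmom0 :: real where
  "gmom0 = (LINT \<xi>|lborel. gauss 1 (\<xi>::real^'n) * (norm \<xi> powr \<alpha> * exp (- (norm \<xi> powr \<alpha>))))"

lemma nn_gmom: "(\<integral>\<^sup>+\<xi>. ennreal (gauss 1 (\<xi>::real^'n) * norm \<xi> powr \<alpha>) \<partial>lborel) = ennreal gmom"
  unfolding gmom_def by (rule nn_integral_eq_integral[OF integrable_gauss_moment[OF \<alpha>]]) (auto simp: gauss_nonneg)

lemma integrable_gmom0: "integrable lborel (\<lambda>\<xi>::real^'n. gauss 1 \<xi> * (norm \<xi> powr \<alpha> * exp (- (norm \<xi> powr \<alpha>))))"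
  by (rule Bochner_Integration.integrable_bound[OF integrable_gauss_moment[OF \<alpha>, where 'a="real^'n"]])
     (auto simp: gauss_nonneg abs_mult intro!: mult_left_le mult_left_mono)

lemma nn_gmom0: "(\<integral>\<^sup>+\<xi>. ennreal (gauss 1 (\<xi>::real^'n) * (norm \<xi> powr \<alpha> * exp (- (norm \<xi> powr \<alpha>)))) \<partial>lborel) = ennreal gmom0"
  unfolding gmom0_def by (rule nn_integral_eq_integral[OF integrable_gmom0]) (auto simp: gauss_nonneg)

lemma gmom0_pos: "gmom0 > 0"
proof -
  have "0 \<le> gmom0" unfolding gmom0_def by (intro integral_nonneg_AE) (auto simp: gauss_nonneg)
  moreover have "gmom0 \<noteq> 0"
  proof
    assume "gmom0 = 0"
    then have "AE \<xi>::real^'n in lborel. gauss 1 \<xi> * (norm \<xi> powr \<alpha> * exp (- (norm \<xi> powr \<alpha>))) = 0"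
      unfolding gmom0_def by (subst (asm) integral_nonneg_eq_0_iff_AE[OF integrable_gmom0]) (auto simp: gauss_nonneg)
    then have "AE \<xi>::real^'n in lborel. False"
      using AE_lborel_singleton[of "0::real^'n"]
    proof eventually_elim
      case (elim \<xi>)
      then show ?case using gauss_pos[of 1 \<xi>] by simp
    qed
    then have "nn_integral lborel (\<lambda>\<xi>::real^'n. 1) = nn_integral lborel (\<lambda>\<xi>::real^'n. 0)"
      by (intro nn_integral_cong_AE) auto
    then show False by (simp add: emeasure_lborel_UNIV)
  qed
  ultimately show ?thesis by simp
qed

lemma gmom_pos: "gmom > 0"
proof -
  have "gmom0 \<le> gmom" unfolding gmom0_def gmom_def
    by (intro integral_mono integrable_gmom0 integrable_gauss_moment[OF \<alpha>])
       (auto simp: gauss_nonneg intro!: mult_left_mono mult_left_le)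
  then show ?thesis using gmom0_pos by simp
qed

lemma deficit_upper:
  assumes t: "t > 0" and r: "r > 0"
  shows "(\<integral>\<^sup>+\<xi>. ennreal (gauss r (\<xi>::real^'n)) * ennreal (1 - exp (- t * norm \<xi> powr \<alpha>)) \<partial>lborel) \<le> ennreal (gmom * t * r powr (\<alpha> / 2))"
proof -
  have s: "sqrt r powr \<alpha> = r powr (\<alpha> / 2)" using r by (simp add: powr_half_sqrt[symmetric] powr_powr)
  have "(\<integral>\<^sup>+\<xi>. ennreal (gauss r (\<xi>::real^'n)) * ennreal (1 - exp (- t * norm \<xi> powr \<alpha>)) \<partial>lborel) =
     (\<integral>\<^sup>+\<xi>. ennreal (gauss 1 (\<xi>::real^'n)) * ennreal (1 - exp (- t * norm (sqrt r *\<^sub>R \<xi>) powr \<alpha>)) \<partial>lborel)"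
    by (rule nn_integral_gauss_scale[OF _ r]) measurable
  also have "\<dots> \<le> (\<integral>\<^sup>+\<xi>. ennreal (t * r powr (\<alpha> / 2)) * ennreal (gauss 1 (\<xi>::real^'n) * norm \<xi> powr \<alpha>) \<partial>lborel)"
  proof (intro nn_integral_mono)
    fix \<xi> :: "real^'n"
    have "1 - exp (- t * norm (sqrt r *\<^sub>R \<xi>) powr \<alpha>) \<le> t * norm (sqrt r *\<^sub>R \<xi>) powr \<alpha>"
      using one_minus_exp_bounds(1)[of "t * norm (sqrt r *\<^sub>R \<xi>) powr \<alpha>"] t by simp
    also have "\<dots> = t * r powr (\<alpha> / 2) * norm \<xi> powr \<alpha>"
      using r by (simp add: powr_mult s)
    finally have "ennreal (gauss 1 \<xi>) * ennreal (1 - exp (- t * norm (sqrt r *\<^sub>R \<xi>) powr \<alpha>)) \<le> ennreal (gauss 1 \<xi>) * ennreal (t * r powr (\<alpha> / 2) * norm \<xi> powr \<alpha>)"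
      by (intro mult_left_mono ennreal_leI) auto
    also have "\<dots> = ennreal (t * r powr (\<alpha> / 2)) * ennreal (gauss 1 \<xi> * norm \<xi> powr \<alpha>)"
      using t by (simp add: ennreal_mult[symmetric] gauss_nonneg mult_ac)
    finally show "ennreal (gauss 1 \<xi>) * ennreal (1 - exp (- t * norm (sqrt r *\<^sub>R \<xi>) powr \<alpha>)) \<le> ennreal (t * r powr (\<alpha> / 2)) * ennreal (gauss 1 \<xi> * norm \<xi> powr \<alpha>)" .
  qed
  also have "\<dots> = ennreal (gmom * t * r powr (\<alpha> / 2))"
    using t gmom_pos by (subst nn_integral_cmult) (auto simp: nn_gmom ennreal_mult[symmetric] mult_ac)
  finally show ?thesis .
qed

text \<open>For r <= 1 the damping exp (- r^(\<alpha>/2) |\<xi>|^\<alpha>) is at least exp (-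
  |\<xi>|^\<alpha>), which makes the constant independent of r.\<close>

lemma deficit_lower:
  assumes r: "r > 0" "r \<le> 1"
  shows "ennreal (gmom0 * r powr (\<alpha> / 2)) \<le> (\<integral>\<^sup>+\<xi>. ennreal (gauss r (\<xi>::real^'n)) * ennreal (1 - exp (- 1 * norm \<xi> powr \<alpha>)) \<partial>lborel)"
proof -
  have s: "sqrt r powr \<alpha> = r powr (\<alpha> / 2)" using r by (simp add: powr_half_sqrt[symmetric] powr_powr)
  have s1: "r powr (\<alpha> / 2) \<le> 1" using r \<alpha> by (simp add: powr_le1)
  have "ennreal (gmom0 * r powr (\<alpha> / 2)) = (\<integral>\<^sup>+\<xi>. ennreal (r powr (\<alpha> / 2)) * ennreal (gauss 1 (\<xi>::real^'n) * (norm \<xi> powr \<alpha> * exp (- (norm \<xi> powr \<alpha>)))) \<partial>lborel)"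
    using gmom0_pos by (subst nn_integral_cmult) (auto simp: nn_gmom0 ennreal_mult[symmetric] mult_ac)
  also have "\<dots> \<le> (\<integral>\<^sup>+\<xi>. ennreal (gauss 1 (\<xi>::real^'n)) * ennreal (1 - exp (- 1 * norm (sqrt r *\<^sub>R \<xi>) powr \<alpha>)) \<partial>lborel)"
  proof (intro nn_integral_mono)
    fix \<xi> :: "real^'n"
    have e: "norm (sqrt r *\<^sub>R \<xi>) powr \<alpha> = r powr (\<alpha> / 2) * norm \<xi> powr \<alpha>"
      using r by (simp add: powr_mult s)
    have "r powr (\<alpha> / 2) * norm \<xi> powr \<alpha> * exp (- (norm \<xi> powr \<alpha>)) \<le> r powr (\<alpha> / 2) * norm \<xi> powr \<alpha> * exp (- (r powr (\<alpha> / 2) * norm \<xi> powr \<alpha>))"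
      using s1 by (intro mult_left_mono) (auto intro!: mult_left_le_one_le)
    also have "\<dots> \<le> 1 - exp (- 1 * norm (sqrt r *\<^sub>R \<xi>) powr \<alpha>)"
      unfolding e using one_minus_exp_bounds(2)[of "r powr (\<alpha> / 2) * norm \<xi> powr \<alpha>"] by simp
    finally have "gauss 1 \<xi> * (r powr (\<alpha> / 2) * norm \<xi> powr \<alpha> * exp (- (norm \<xi> powr \<alpha>))) \<le> gauss 1 \<xi> * (1 - exp (- 1 * norm (sqrt r *\<^sub>R \<xi>) powr \<alpha>))"
      by (intro mult_left_mono gauss_nonneg)
    then show "ennreal (r powr (\<alpha> / 2)) * ennreal (gauss 1 \<xi> * (norm \<xi> powr \<alpha> * exp (- (norm \<xi> powr \<alpha>)))) \<le> ennreal (gauss 1 \<xi>) * ennreal (1 - exp (- 1 * norm (sqrt r *\<^sub>R \<xi>) powr \<alpha>))"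
      by (simp add: ennreal_mult[symmetric] gauss_nonneg mult_ac ennreal_leI)
  qed
  also have "\<dots> = (\<integral>\<^sup>+\<xi>. ennreal (gauss r (\<xi>::real^'n)) * ennreal (1 - exp (- 1 * norm \<xi> powr \<alpha>)) \<partial>lborel)"
    by (rule nn_integral_gauss_scale[symmetric, OF _ r(1)]) measurable
  finally show ?thesis .
qed

text \<open>Chebyshev's inequality with r = \<rho>^(-2): on |y| >= \<rho> the weight 1 - exp (- r
  |y|^2) is at least 1/2.\<close>

lemma heat_tail:
  assumes t: "t > 0" and \<rho>: "\<rho> > 0"
  shows "(\<integral>\<^sup>+y. ennreal (heat \<alpha> t (y::real^'n)) * indicator {y. norm y \<ge> \<rho>} y \<partial>lborel) \<le> ennreal (2 * gmom * t * \<rho> powr (- \<alpha>))"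
proof -
  define r where "r = 1 / \<rho>\<^sup>2"
  have r: "r > 0" using \<rho> by (simp add: r_def)
  have rp: "r powr (\<alpha> / 2) = \<rho> powr (- \<alpha>)"
  proof -
    have "r = \<rho> powr (- 2)" using \<rho> by (simp add: r_def powr_minus divide_inverse)
    then show ?thesis by (simp add: powr_powr)
  qed
  have "(\<integral>\<^sup>+y. ennreal (heat \<alpha> t (y::real^'n)) * indicator {y. norm y \<ge> \<rho>} y \<partial>lborel) \<le>
      (\<integral>\<^sup>+y. ennreal 2 * ennreal ((1 - exp (- r * (norm y)\<^sup>2)) * heat \<alpha> t (y::real^'n)) \<partial>lborel)"
  proof (intro nn_integral_mono)
    fix y :: "real^'n"
    show "ennreal (heat \<alpha> t y) * indicator {y. norm y \<ge> \<rho>} y \<le> ennreal 2 * ennreal ((1 - exp (- r * (norm y)\<^sup>2)) * heat \<alpha> t y)"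
    proof (cases "norm y \<ge> \<rho>")
      case True
      have "\<rho>\<^sup>2 \<le> (norm y)\<^sup>2" using True \<rho> by (intro power_mono) auto
      then have "1 \<le> r * (norm y)\<^sup>2" using \<rho> by (simp add: r_def field_simps)
      then have "exp (- r * (norm y)\<^sup>2) \<le> exp (- 1)" by simp
      moreover have "1 \<le> 2 * (1 - exp (- 1::real))" using one_minus_exp_bounds(3)[of 1] by simp
      ultimately have "1 \<le> 2 * (1 - exp (- r * (norm y)\<^sup>2))" by (smt (verit))
      then have "1 * heat \<alpha> t y \<le> 2 * (1 - exp (- r * (norm y)\<^sup>2)) * heat \<alpha> t y"
        by (intro mult_right_mono heat_nonneg t)
      then have "heat \<alpha> t y \<le> 2 * ((1 - exp (- r * (norm y)\<^sup>2)) * heat \<alpha> t y)"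
        by (simp only: mult.assoc mult_1)
      then show ?thesis using True r heat_nonneg[OF t, of y]
        by (simp add: ennreal_mult[symmetric] mult.assoc ennreal_leI del: ennreal_numeral)
    qed simp
  qed
  also have "\<dots> = ennreal 2 * (\<integral>\<^sup>+y. ennreal ((1 - exp (- r * (norm y)\<^sup>2)) * heat \<alpha> t (y::real^'n)) \<partial>lborel)"
    by (subst nn_integral_cmult) auto
  also have "\<dots> \<le> ennreal 2 * ennreal (gmom * t * r powr (\<alpha> / 2))"
    unfolding heat_gauss_deficit[OF t r] by (intro mult_left_mono deficit_upper t r) auto
  also have "\<dots> = ennreal (2 * gmom * t * \<rho> powr (- \<alpha>))"
    using t gmom_pos unfolding rp by (subst ennreal_mult[symmetric]) (auto simp: mult_ac)
  finally show ?thesis .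
qed

text \<open>The ball of radius |x|/4 about (3/4) x lies in the shell |x|/2 <= |y| <= |x|. By
  monotonicity the value at x times the volume of this ball is at most the tail mass beyond
  |x|/2.\<close>

lemma heat_upper:
  obtains C where "C > 0" "\<And>t x. t > 0 \<Longrightarrow> x \<noteq> 0 \<Longrightarrow> heat \<alpha> t (x::real^'n) \<le> C * t * norm x powr (- real CARD('n) - \<alpha>)"
proof -
  define V where "V = unit_ball_vol (real CARD('n))"
  have V: "V > 0" by (simp add: V_def)
  define C where "C = 2 * gmom * 2 powr \<alpha> * 4 ^ CARD('n) / V"
  have "heat \<alpha> t x \<le> C * t * norm x powr (- real CARD('n) - \<alpha>)" if t: "t > 0" and x: "x \<noteq> 0" for t and x :: "real^'n"
  proof -
    have "ennreal (heat \<alpha> t x * (V * (norm x / 4) ^ CARD('n))) = ennreal (heat \<alpha> t x) * emeasure lborel (cball ((3/4) *\<^sub>R x) (norm x / 4))"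
      using V heat_nonneg[OF t, of x] by (subst emeasure_cball) (auto simp: V_def ennreal_mult)
    also have "\<dots> = (\<integral>\<^sup>+y. ennreal (heat \<alpha> t x) * indicator (cball ((3/4) *\<^sub>R x) (norm x / 4)) y \<partial>lborel)"
      by (subst nn_integral_cmult_indicator) auto
    also have "\<dots> \<le> (\<integral>\<^sup>+y. ennreal (heat \<alpha> t (y::real^'n)) * indicator {y. norm y \<ge> norm x / 2} y \<partial>lborel)"
    proof (intro nn_integral_mono)
      fix y :: "real^'n"
      show "ennreal (heat \<alpha> t x) * indicator (cball ((3/4) *\<^sub>R x) (norm x / 4)) y \<le> ennreal (heat \<alpha> t y) * indicator {y. norm y \<ge> norm x / 2} y"
      proof (cases "y \<in> cball ((3/4) *\<^sub>R x) (norm x / 4)")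
        case True
        then have d: "norm ((3/4) *\<^sub>R x - y) \<le> norm x / 4" by (simp add: dist_norm)
        have "norm ((3/4) *\<^sub>R x) \<le> norm ((3/4) *\<^sub>R x - y) + norm y" by norm
        then have 1: "norm y \<ge> norm x / 2" using d by simp
        have "norm y \<le> norm ((3/4) *\<^sub>R x - y) + norm ((3/4) *\<^sub>R x)" by norm
        then have "norm y \<le> norm x" using d by simp
        then show ?thesis using 1 True by (simp add: ennreal_leI heat_decr t)
      qed simp
    qed
    also have "\<dots> \<le> ennreal (2 * gmom * t * (norm x / 2) powr (- \<alpha>))"
      using x by (intro heat_tail t) auto
    finally have "heat \<alpha> t x * (V * (norm x / 4) ^ CARD('n)) \<le> 2 * gmom * t * (norm x / 2) powr (- \<alpha>)"
      using gmom_pos t by (subst (asm) ennreal_le_iff) auto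
    then have "heat \<alpha> t x \<le> 2 * gmom * t * (norm x / 2) powr (- \<alpha>) / (V * (norm x / 4) ^ CARD('n))"
      using V x by (simp add: field_simps)
    also have "\<dots> = C * t * norm x powr (- real CARD('n) - \<alpha>)"
      using V x by (simp add: C_def powr_divide powr_minus powr_diff powr_realpow power_divide field_simps)
    finally show ?thesis .
  qed
  moreover have "C > 0" using gmom_pos V by (simp add: C_def)
  ultimately show ?thesis using that by blast
qed

text \<open>The deficit at r = (l / \<rho>)^2, with \<rho> = |x|, is at least \<open>gmom0\<close>
  l^\<alpha> \<rho>^(-\<alpha>). The parts |y| <= \<rho> and |y| >= R \<rho> take at most a quarter
  of it each, so half sits in the shell between, where the kernel is at most its value at x.\<close>

lemma heat_lower:
  obtains c where "c > 0" "\<And>x::real^'n. c * min 1 (norm x powr (- real CARD('n) - \<alpha>)) \<le> heat \<alpha> 1 x"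
proof -
  define V where "V = unit_ball_vol (real CARD('n))"
  have V: "V > 0" by (simp add: V_def)
  \<comment> \<open>The inner part costs a multiple of l^2 while the total is of order l^\<alpha>;
    since \<alpha> < 2, a small l makes the inner part at most a quarter.\<close>
  define l where "l = min 1 ((gmom0 / (8 * gmom)) powr (1 / (2 - \<alpha>)))"
  have l: "0 < l" "l \<le> 1" using gmom_pos gmom0_pos by (auto simp: l_def)
  have "l powr (2 - \<alpha>) \<le> ((gmom0 / (8 * gmom)) powr (1 / (2 - \<alpha>))) powr (2 - \<alpha>)"
    using l \<alpha> by (intro powr_mono2) (auto simp: l_def)
  also have "\<dots> = gmom0 / (8 * gmom)" using \<alpha> gmom_pos gmom0_pos by (simp add: powr_powr)
  finally have l2: "2 * l\<^sup>2 * gmom \<le> gmom0 * l powr \<alpha> / 4"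
    using l gmom_pos by (simp add: powr_diff field_simps)
  \<comment> \<open>Makes the tail bound beyond R \<rho> exactly a quarter of the total.\<close>
  define R where "R = (gmom0 * l powr \<alpha> / (8 * gmom)) powr (- 1 / \<alpha>)"
  have R: "R > 0" using gmom_pos gmom0_pos l by (simp add: R_def)
  have "R powr (- \<alpha>) = gmom0 * l powr \<alpha> / (8 * gmom)"
    using \<alpha> gmom_pos gmom0_pos l by (simp add: R_def powr_powr)
  then have R2: "2 * gmom * R powr (- \<alpha>) = gmom0 * l powr \<alpha> / 4" using gmom_pos by simp
  define c where "c = gmom0 * l powr \<alpha> / 2 / (V * R ^ CARD('n))"
  have c: "c > 0" using gmom0_pos l V R by (simp add: c_def)
  \<comment> \<open>The condition norm x >= l is what gives r <= 1, as \<open>deficit_lower\<close>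
    demands.\<close>
  have far: "c * norm x powr (- real CARD('n) - \<alpha>) \<le> heat \<alpha> 1 x" if x: "norm x \<ge> l" for x :: "real^'n"
  proof -
    define \<rho> where "\<rho> = norm x"
    have \<rho>: "\<rho> > 0" "\<rho> \<ge> l" using x l by (auto simp: \<rho>_def)
    define r where "r = (l / \<rho>)\<^sup>2"
    define r' where "r' = (1 / \<rho>)\<^sup>2"
    have r: "r > 0" "r \<le> 1" using \<rho> l by (auto simp: r_def power_le_one)
    have r': "r' > 0" using \<rho> by (simp add: r'_def)
    have rr': "r / r' = l\<^sup>2" using \<rho> by (simp add: r_def r'_def power_divide)
    have pr: "r powr (\<alpha> / 2) = l powr \<alpha> * \<rho> powr (- \<alpha>)" 
    proof -
      have "r = (l / \<rho>) powr 2" using \<rho> l by (simp add: r_def)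
      then have "r powr (\<alpha> / 2) = (l / \<rho>) powr (2 * (\<alpha> / 2))" by (simp only: powr_powr)
      then show ?thesis using \<rho> l by (simp add: powr_divide powr_minus_divide)
    qed
    have pr': "r' powr (\<alpha> / 2) = \<rho> powr (- \<alpha>)"
    proof -
      have "r' = (1 / \<rho>) powr 2" using \<rho> by (simp add: r'_def)
      then have "r' powr (\<alpha> / 2) = (1 / \<rho>) powr (2 * (\<alpha> / 2))" by (simp only: powr_powr)
      then show ?thesis using \<rho> by (simp add: powr_divide powr_minus_divide)
    qed
    let ?h = "\<lambda>y. heat \<alpha> 1 (y::real^'n)"
    have hn: "0 \<le> ?h y" for y by (rule heat_nonneg) simp
    have "ennreal (gmom0 * r powr (\<alpha> / 2)) \<le> (\<integral>\<^sup>+\<xi>. ennreal (gauss r (\<xi>::real^'n)) * ennreal (1 - exp (- 1 * norm \<xi> powr \<alpha>)) \<partial>lborel)"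
      by (rule deficit_lower[OF r])
    also have "\<dots> = (\<integral>\<^sup>+y. ennreal ((1 - exp (- r * (norm y)\<^sup>2)) * ?h y) \<partial>lborel)"
      by (rule heat_gauss_deficit[symmetric]) (use r in auto)
    also have "\<dots> \<le> (\<integral>\<^sup>+y. ennreal (2 * l\<^sup>2) * ennreal ((1 - exp (- r' * (norm y)\<^sup>2)) * ?h y) + 
        (ennreal (?h x) * indicator (cball 0 (R * \<rho>)) y + ennreal (?h y) * indicator {y. norm y \<ge> R * \<rho>} y) \<partial>lborel)"
    proof (intro nn_integral_mono)
      fix y :: "real^'n"
      have e: "1 - exp (- r * (norm y)\<^sup>2) \<le> 1" by simp
      show "ennreal ((1 - exp (- r * (norm y)\<^sup>2)) * ?h y) \<le> ennreal (2 * l\<^sup>2) * ennreal ((1 - exp (- r' * (norm y)\<^sup>2)) * ?h y) + 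
        (ennreal (?h x) * indicator (cball 0 (R * \<rho>)) y + ennreal (?h y) * indicator {y. norm y \<ge> R * \<rho>} y)"
      proof (cases "norm y \<le> \<rho>")
        case True
        then have "(norm y)\<^sup>2 \<le> \<rho>\<^sup>2" using \<rho> by (intro power_mono) auto
        then have v1: "r' * (norm y)\<^sup>2 \<le> 1" using \<rho> by (simp add: r'_def power_divide field_simps)
        have "1 - exp (- r * (norm y)\<^sup>2) \<le> r * (norm y)\<^sup>2"
          using one_minus_exp_bounds(1)[of "r * (norm y)\<^sup>2"] r by simp
        also have "\<dots> = l\<^sup>2 * (r' * (norm y)\<^sup>2)" using rr' r' by (simp add: field_simps)
        also have "\<dots> \<le> l\<^sup>2 * (2 * (1 - exp (- r' * (norm y)\<^sup>2)))"
          using one_minus_exp_bounds(3)[of "r' * (norm y)\<^sup>2"] v1 r' by (intro mult_left_mono) auto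
        finally have "(1 - exp (- r * (norm y)\<^sup>2)) * ?h y \<le> l\<^sup>2 * (2 * (1 - exp (- r' * (norm y)\<^sup>2))) * ?h y"
          by (intro mult_right_mono hn)
        then have "ennreal ((1 - exp (- r * (norm y)\<^sup>2)) * ?h y) \<le> ennreal (2 * l\<^sup>2) * ennreal ((1 - exp (- r' * (norm y)\<^sup>2)) * ?h y)"
        proof (subst ennreal_mult[symmetric])
          show "0 \<le> (1 - exp (- r' * (norm y)\<^sup>2)) * ?h y" using r' hn[of y] by simp
          show "ennreal ((1 - exp (- r * (norm y)\<^sup>2)) * ?h y) \<le> ennreal (2 * l\<^sup>2 * ((1 - exp (- r' * (norm y)\<^sup>2)) * ?h y))"
            using \<open>(1 - exp (- r * (norm y)\<^sup>2)) * ?h y \<le> _\<close> by (intro ennreal_leI) (simp only: mult_ac)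
        qed simp
        then show ?thesis by (rule order_trans) simp
      next
        case False
        then have "?h y \<le> ?h x" using \<rho> by (intro heat_decr) (auto simp: \<rho>_def)
        moreover have "(1 - exp (- r * (norm y)\<^sup>2)) * ?h y \<le> ?h y"
          using e hn[of y] by (metis mult_le_cancel_right1 mult_right_mono mult_1 not_le)
        ultimately have "ennreal ((1 - exp (- r * (norm y)\<^sup>2)) * ?h y) \<le> (ennreal (?h x) * indicator (cball 0 (R * \<rho>)) y + ennreal (?h y) * indicator {y. norm y \<ge> R * \<rho>} y)"
          by (cases "norm y \<le> R * \<rho>") (auto intro!: ennreal_leI add_increasing2 simp: )
        then show ?thesis by (rule order_trans) simp
      qed
    qed
    also have "\<dots> = ennreal (2 * l\<^sup>2) * (\<integral>\<^sup>+y. ennreal ((1 - exp (- r' * (norm y)\<^sup>2)) * ?h y) \<partial>lborel) +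
        (ennreal (?h x) * emeasure lborel (cball (0::real^'n) (R * \<rho>)) + (\<integral>\<^sup>+y. ennreal (?h y) * indicator {y. norm y \<ge> R * \<rho>} y \<partial>lborel))"
    proof -
      have m1: "(\<lambda>y. ennreal ((1 - exp (- r' * (norm y)\<^sup>2)) * ?h y)) \<in> borel_measurable lborel" by measurable
      have m2: "(\<lambda>y::real^'n. ennreal (?h x) * indicator (cball 0 (R * \<rho>)) y) \<in> borel_measurable lborel"
      proof -
        have [measurable]: "cball (0::real^'n) (R * \<rho>) \<in> sets borel" by simp
        show ?thesis by measurable
      qed
      have m3: "(\<lambda>y. ennreal (?h y) * indicator {y. norm y \<ge> R * \<rho>} y) \<in> borel_measurable lborel" by measurable
      show ?thesis
        using m1 m2 m3 by (simp add: nn_integral_add nn_integral_cmult nn_integral_cmult_indicator)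
    qed
    also have "\<dots> \<le> ennreal (2 * l\<^sup>2) * ennreal (gmom * 1 * r' powr (\<alpha> / 2)) +
        (ennreal (?h x) * ennreal (V * (R * \<rho>) ^ CARD('n)) + ennreal (2 * gmom * 1 * (R * \<rho>) powr (- \<alpha>)))"
    proof (intro add_mono mult_left_mono)
      show "(\<integral>\<^sup>+y. ennreal ((1 - exp (- r' * (norm y)\<^sup>2)) * ?h y) \<partial>lborel) \<le> ennreal (gmom * 1 * r' powr (\<alpha> / 2))"
        by (subst heat_gauss_deficit) (use r' deficit_upper[of 1 r'] in auto)
      show "emeasure lborel (cball (0::real^'n) (R * \<rho>)) \<le> ennreal (V * (R * \<rho>) ^ CARD('n))"
        using R \<rho> by (subst emeasure_cball) (auto simp: V_def)
      show "(\<integral>\<^sup>+y. ennreal (?h y) * indicator {y. norm y \<ge> R * \<rho>} y \<partial>lborel) \<le> ennreal (2 * gmom * 1 * (R * \<rho>) powr (- \<alpha>))"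
        using R \<rho> by (intro heat_tail) auto
    qed auto
    also have "\<dots> = ennreal (2 * l\<^sup>2 * gmom * \<rho> powr (- \<alpha>) + (?h x * (V * (R * \<rho>) ^ CARD('n)) + 2 * gmom * (R powr (- \<alpha>) * \<rho> powr (- \<alpha>))))"
      using gmom_pos V R \<rho> hn[of x] l unfolding pr'
      by (simp add: ennreal_mult[symmetric] ennreal_plus[symmetric] powr_mult mult_ac del: ennreal_plus)
    finally have "gmom0 * (l powr \<alpha> * \<rho> powr (- \<alpha>)) \<le> 2 * l\<^sup>2 * gmom * \<rho> powr (- \<alpha>) + (?h x * (V * (R * \<rho>) ^ CARD('n)) + 2 * gmom * (R powr (- \<alpha>) * \<rho> powr (- \<alpha>)))"
      unfolding pr using gmom_pos V R \<rho> hn[of x] l by (subst (asm) ennreal_le_iff) auto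
    also have "\<dots> \<le> gmom0 * l powr \<alpha> / 4 * \<rho> powr (- \<alpha>) + (?h x * (V * (R * \<rho>) ^ CARD('n)) + gmom0 * l powr \<alpha> / 4 * \<rho> powr (- \<alpha>))"
    proof -
      have "2 * l\<^sup>2 * gmom * \<rho> powr (- \<alpha>) \<le> gmom0 * l powr \<alpha> / 4 * \<rho> powr (- \<alpha>)"
        by (rule mult_right_mono[OF l2]) simp
      moreover have "2 * gmom * (R powr (- \<alpha>) * \<rho> powr (- \<alpha>)) = gmom0 * l powr \<alpha> / 4 * \<rho> powr (- \<alpha>)"
        unfolding R2[symmetric] by simp
      ultimately show ?thesis by linarith
    qed
    finally have "gmom0 * l powr \<alpha> / 2 * \<rho> powr (- \<alpha>) \<le> ?h x * (V * (R * \<rho>) ^ CARD('n))"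
      by (simp add: field_simps)
    then have "gmom0 * l powr \<alpha> / 2 * \<rho> powr (- \<alpha>) / (V * (R * \<rho>) ^ CARD('n)) \<le> ?h x"
      using V R \<rho> by (subst pos_divide_le_eq) auto
    moreover have "gmom0 * l powr \<alpha> / 2 * \<rho> powr (- \<alpha>) / (V * (R * \<rho>) ^ CARD('n)) = c * \<rho> powr (- real CARD('n) - \<alpha>)"
      using V R \<rho> by (simp add: c_def powr_diff powr_minus powr_realpow power_mult_distrib field_simps)
    ultimately show ?thesis by (simp add: \<rho>_def)
  qed
  have "c * min 1 (norm x powr (- real CARD('n) - \<alpha>)) \<le> heat \<alpha> 1 x" for x :: "real^'n"
  proof (cases "norm x \<ge> 1")
    case True
    then have "c * norm x powr (- real CARD('n) - \<alpha>) \<le> heat \<alpha> 1 x" using l by (intro far) auto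
    then show ?thesis using c by (intro order_trans[OF mult_left_mono[OF min.cobounded2]]) auto
  next
    case False
    obtain e :: "real^'n" where e: "norm e = 1" using vector_choose_size[of 1] by auto
    have "c * 1 \<le> heat \<alpha> 1 e" using far[of e] e l by simp
    also have "\<dots> \<le> heat \<alpha> 1 x" using False e by (intro heat_decr) auto
    finally show ?thesis using c by (intro order_trans[OF mult_left_mono[OF min.cobounded1]]) auto
  qed
  then show ?thesis using c that by blast
qed

text \<open>By monotonicity the maximum is at the origin, where the Fourier integral scales exactly
  under \<xi> -> t^(-1/\<alpha>) \<xi>.\<close>

lemma heat_sup:
  assumes t: "t > 0"
  shows "heat \<alpha> t (x::real^'n) \<le> heat \<alpha> 1 (0::real^'n) * t powr (- real CARD('n) / \<alpha>)"
proof -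
  define c where "c = t powr (- 1 / \<alpha>)"
  have c: "c > 0" using t by (simp add: c_def)
  have "c powr \<alpha> = t powr (- 1)" using t \<alpha> by (simp add: c_def powr_powr)
  then have ca: "t * c powr \<alpha> = 1" using t by (simp add: powr_minus)
  have "ennreal (LINT \<xi>|lborel. exp (- t * norm (\<xi>::real^'n) powr \<alpha>)) = (\<integral>\<^sup>+\<xi>. ennreal (exp (- t * norm (\<xi>::real^'n) powr \<alpha>)) \<partial>lborel)"
    by (intro nn_integral_eq_integral[symmetric] integrable_exp_powr t \<alpha>) auto
  also have "\<dots> = ennreal (c ^ CARD('n)) * (\<integral>\<^sup>+\<xi>. ennreal (exp (- t * norm (c *\<^sub>R \<xi>::real^'n) powr \<alpha>)) \<partial>lborel)"
    by (subst nn_integral_scaleR[OF _ c]) auto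
  also have "(\<integral>\<^sup>+\<xi>. ennreal (exp (- t * norm (c *\<^sub>R \<xi>::real^'n) powr \<alpha>)) \<partial>lborel) = (\<integral>\<^sup>+\<xi>. ennreal (exp (- 1 * norm (\<xi>::real^'n) powr \<alpha>)) \<partial>lborel)"
    using c ca by (intro nn_integral_cong) (simp add: powr_mult mult.assoc[symmetric])
  also have "\<dots> = ennreal (LINT \<xi>|lborel. exp (- 1 * norm (\<xi>::real^'n) powr \<alpha>))"
    by (intro nn_integral_eq_integral integrable_exp_powr \<alpha>) auto
  also have "ennreal (c ^ CARD('n)) * \<dots> = ennreal (c ^ CARD('n) * (LINT \<xi>|lborel. exp (- 1 * norm (\<xi>::real^'n) powr \<alpha>)))"
    using c by (subst ennreal_mult) (auto intro!: integral_nonneg_AE)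
  finally have *: "(LINT \<xi>|lborel. exp (- t * norm (\<xi>::real^'n) powr \<alpha>)) = c ^ CARD('n) * (LINT \<xi>|lborel. exp (- 1 * norm (\<xi>::real^'n) powr \<alpha>))"
    using c by (subst (asm) ennreal_inj) (auto intro!: integral_nonneg_AE mult_nonneg_nonneg)
  have "heat \<alpha> t x \<le> heat \<alpha> t (0::real^'n)" using t by (intro heat_decr) auto
  also have "\<dots> = heat \<alpha> 1 (0::real^'n) * c ^ CARD('n)"
    using * unfolding heat_def by simp
  also have "c ^ CARD('n) = t powr (- real CARD('n) / \<alpha>)"
    using c t by (simp add: c_def powr_realpow[symmetric] powr_powr)
  finally show ?thesis .
qed

end

section \<open>The fractional moments of the stable process\<close>

lemma has_bochner_integral_nonneg:
  fixes f :: "'a \<Rightarrow> real"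
  assumes "has_bochner_integral M f I" "\<And>x. 0 \<le> f x"
  shows "0 \<le> I"
  using assms by (auto simp: has_bochner_integral_iff intro!: integral_nonneg_AE)

text \<open>The substitution t = 1 / r in the Gamma integral; the passage through absolutely
  integrable functions is for the change of variables.\<close>

lemma nn_integral_inverse_Gamma:
  fixes p m :: real
  assumes p: "p > 0" and m: "m > 0"
  shows "(\<integral>\<^sup>+r. ennreal (indicator {0<..} r * (r powr (- 1 - p) * exp (- m / r))) \<partial>lborel) = ennreal (Gamma p * m powr (- p))"
proof -
  define f where "f t = t powr (p - 1) * exp (- t * m)" for t :: real
  have [measurable]: "f \<in> borel_measurable borel" unfolding f_def by measurable
  have G0: "0 \<le> Gamma p * m powr (- p)" using Gamma_real_pos[OF p] by simp
  have "((\<lambda>t. indicator {0<..} t * f t) has_integral (Gamma p * m powr (- p))) UNIV"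
    using nn_integral_Gamma_scaled[OF p m] G0
    by (intro nn_integral_has_integral) (auto simp: f_def)
  also have "(\<lambda>t. indicator {0<..} t * f t) = (\<lambda>t. if t \<in> {0<..} then f t else 0)"
    by (auto simp: fun_eq_iff)
  finally have hi: "(f has_integral (Gamma p * m powr (- p))) {0<..}"
    by (simp only: has_integral_restrict_UNIV)
  have img: "(\<lambda>r::real. 1 / r) ` {0<..} = {0<..}"
  proof (intro equalityI subsetI)
    fix z :: real assume "z \<in> {0<..}"
    then have "z = 1 / (1 / z)" "1 / z \<in> {0<..}" by auto
    then show "z \<in> (\<lambda>r. 1 / r) ` {0<..}" by blast
  qed auto
  have "f absolutely_integrable_on {0<..} \<and> integral {0<..} f = Gamma p * m powr (- p)"
    using hi by (auto intro!: nonnegative_absolutely_integrable_1 simp: has_integral_iff f_def)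
  then have "f absolutely_integrable_on ((\<lambda>r::real. 1 / r) ` {0<..}) \<and> integral ((\<lambda>r::real. 1 / r) ` {0<..}) f = Gamma p * m powr (- p)"
    unfolding img .
  then have "(\<lambda>r. \<bar>- 1 / r\<^sup>2\<bar> * f (1 / r)) absolutely_integrable_on {0<..} \<and> integral {0<..} (\<lambda>r. \<bar>- 1 / r\<^sup>2\<bar> * f (1 / r)) = Gamma p * m powr (- p)"
    by (subst has_absolute_integral_change_of_variables_1')
       (auto intro!: derivative_eq_intros inj_onI simp: power2_eq_square)
  then have hi2: "((\<lambda>r. \<bar>- 1 / r\<^sup>2\<bar> * f (1 / r)) has_integral (Gamma p * m powr (- p))) {0<..}"
    by (auto simp: has_integral_iff absolutely_integrable_on_def)
  have "(\<integral>\<^sup>+r. ennreal (indicator {0<..} r * (\<bar>- 1 / r\<^sup>2\<bar> * f (1 / r))) \<partial>lborel) = ennreal (Gamma p * m powr (- p))"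
    by (rule nn_integral_has_integral_lebesgue[OF _ hi2]) (simp add: f_def)
  also have "(\<lambda>r. ennreal (indicator {0<..} r * (\<bar>- 1 / r\<^sup>2\<bar> * f (1 / r)))) = (\<lambda>r. ennreal (indicator {0<..} r * (r powr (- 1 - p) * exp (- m / r))))"
  proof
    fix r :: real
    show "ennreal (indicator {0<..} r * (\<bar>- 1 / r\<^sup>2\<bar> * f (1 / r))) = ennreal (indicator {0<..} r * (r powr (- 1 - p) * exp (- m / r)))"
    proof (cases "r > 0")
      case True
      have "\<bar>- 1 / r\<^sup>2\<bar> = r powr (- 2)" using True by (simp add: powr_minus divide_inverse)
      moreover have "(1 / r) powr (p - 1) = r powr (1 - p)" using True by (simp add: powr_divide powr_diff)
      ultimately have "\<bar>- 1 / r\<^sup>2\<bar> * (1 / r) powr (p - 1) = r powr (- 1 - p)"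
        by (simp add: powr_add[symmetric])
      then show ?thesis using True by (simp add: f_def mult.assoc[symmetric])
    qed simp
  qed
  finally show ?thesis .
qed

text \<open>Superposing Gaussian kernels with a power weight in r yields a Riesz kernel;
  \<open>k1\<close> and \<open>k2\<close> below are instances of the constant.\<close>

lemma nn_integral_gauss_powr:
  fixes \<xi> :: "'a::euclidean_space"
  assumes p: "p > 0" and \<xi>: "\<xi> \<noteq> 0"
  shows "(\<integral>\<^sup>+r. ennreal (indicator {0<..} r * (r powr (real DIM('a) / 2 - 1 - p) * gauss r \<xi>)) \<partial>lborel) =
     ennreal ((4 * pi) powr (- real DIM('a) / 2) * Gamma p * 4 powr p * norm \<xi> powr (- 2 * p))"
proof -
  let ?c = "(4 * pi) powr (- real DIM('a) / 2)"
  have "(\<integral>\<^sup>+r. ennreal (indicator {0<..} r * (r powr (real DIM('a) / 2 - 1 - p) * gauss r \<xi>)) \<partial>lborel) =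
      (\<integral>\<^sup>+r. ennreal ?c * ennreal (indicator {0<..} r * (r powr (- 1 - p) * exp (- ((norm \<xi>)\<^sup>2 / 4) / r))) \<partial>lborel)"
  proof (rule nn_integral_cong)
    fix r :: real
    show "ennreal (indicator {0<..} r * (r powr (real DIM('a) / 2 - 1 - p) * gauss r \<xi>)) =
      ennreal ?c * ennreal (indicator {0<..} r * (r powr (- 1 - p) * exp (- ((norm \<xi>)\<^sup>2 / 4) / r)))"
    proof (cases "r > 0")
      case True
      have "r powr (real DIM('a) / 2 - 1 - p) * (4 * pi * r) powr (- real DIM('a) / 2) = ?c * (r powr (real DIM('a) / 2 - 1 - p) * r powr (- real DIM('a) / 2))"
        using True by (simp add: powr_mult)
      also have "r powr (real DIM('a) / 2 - 1 - p) * r powr (- real DIM('a) / 2) = r powr (- 1 - p)"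
        by (simp add: powr_add[symmetric])
      finally show ?thesis using True
        by (simp add: gauss_def ennreal_mult[symmetric] mult.assoc[symmetric])
    qed simp
  qed
  also have "\<dots> = ennreal ?c * ennreal (Gamma p * ((norm \<xi>)\<^sup>2 / 4) powr (- p))"
    using \<xi> by (subst nn_integral_cmult, simp, subst nn_integral_inverse_Gamma[OF p]) auto
  also have "((norm \<xi>)\<^sup>2 / 4) powr (- p) = 4 powr p * norm \<xi> powr (- 2 * p)"
  proof -
    have "(norm \<xi>)\<^sup>2 = norm \<xi> powr 2" using \<xi> by simp
    then have "((norm \<xi>)\<^sup>2) powr (- p) = norm \<xi> powr (- 2 * p)" by (simp only: powr_powr) simp
    then show ?thesis using \<xi> by (simp add: powr_divide powr_minus_divide)
  qed
  finally show ?thesis using Gamma_real_pos[OF p] by (simp add: ennreal_mult[symmetric] mult_ac)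
qed

text \<open>Near 0 the minimum leaves r^(a - 1), near infinity r^(-1 - b). On r > 1 the estimate 1
  <= 2 (1 - exp (- r)) reduces the second part to a known integral.\<close>

lemma nn_integral_powr_min:
  fixes a b C :: real
  assumes a: "a > 0" and b: "0 < b" "b < 1" and C: "C \<ge> 0"
  shows "(\<integral>\<^sup>+r. ennreal (indicator {0<..} r * (r powr (- 1 - b) * min 1 (C * r powr (a + b)))) \<partial>lborel) < \<infinity>"
proof -
  have "(\<integral>\<^sup>+r. ennreal (indicator {0<..} r * (r powr (- 1 - b) * min 1 (C * r powr (a + b)))) \<partial>lborel) \<le>
    (\<integral>\<^sup>+r. ennreal C * ennreal (indicator {0..1} r * r powr (a - 1)) + ennreal 2 * ennreal (indicator {0<..} r * (r powr (- 1 - b) * (1 - exp (- r * 1)))) \<partial>lborel)"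
  proof (intro nn_integral_mono)
    fix r :: real
    show "ennreal (indicator {0<..} r * (r powr (- 1 - b) * min 1 (C * r powr (a + b)))) \<le>
      ennreal C * ennreal (indicator {0..1} r * r powr (a - 1)) + ennreal 2 * ennreal (indicator {0<..} r * (r powr (- 1 - b) * (1 - exp (- r * 1))))"
    proof (cases "r > 0")
      case True
      show ?thesis
      proof (cases "r \<le> 1")
        case r1: True
        have "r powr (- 1 - b) * min 1 (C * r powr (a + b)) \<le> r powr (- 1 - b) * (C * r powr (a + b))"
          by (intro mult_left_mono) auto
        also have "\<dots> = C * r powr (a - 1)" using True by (simp add: powr_add[symmetric])
        finally have "ennreal (r powr (- 1 - b) * min 1 (C * r powr (a + b))) \<le> ennreal C * ennreal (r powr (a - 1))"
          using C by (simp add: ennreal_mult[symmetric] ennreal_leI)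
        then show ?thesis using True r1 by (simp add: add_increasing2)
      next
        case False
        have "1 \<le> 2 * (1 - exp (- 1::real))" using one_minus_exp_bounds(3)[of 1] by simp
        moreover have "exp (- r) \<le> exp (- 1)" using False by simp
        ultimately have "1 \<le> 2 * (1 - exp (- r))" by argo
        then have "r powr (- 1 - b) * min 1 (C * r powr (a + b)) \<le> r powr (- 1 - b) * (2 * (1 - exp (- r)))"
          by (intro mult_left_mono) auto
        then have "ennreal (r powr (- 1 - b) * min 1 (C * r powr (a + b))) \<le> ennreal (2 * (r powr (- 1 - b) * (1 - exp (- r))))"
          by (intro ennreal_leI) (simp only: mult_ac)
        also have "\<dots> = ennreal 2 * ennreal (r powr (- 1 - b) * (1 - exp (- r)))"
          using True by (subst ennreal_mult) auto
        finally show ?thesis using True by (simp add: add_increasing)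
      qed
    qed simp
  qed
  also have "\<dots> = ennreal C * ennreal (1 powr (a - 1 + 1) / (a - 1 + 1)) + ennreal 2 * ennreal (Gamma (1 - b) / b * 1 powr b)"
    using nn_integral_powr_Icc[of "a - 1" 1] nn_integral_one_minus_exp_powr[OF b, of 1] a
    by (subst nn_integral_add, measurable, subst nn_integral_cmult, measurable, subst nn_integral_cmult, auto)
  also have "\<dots> < \<infinity>" by (auto simp: ennreal_mult_eq_top_iff less_top[symmetric])
  finally show ?thesis .
qed

lemma integrable_pair_cos:
  fixes \<Phi> :: "'b::euclidean_space \<Rightarrow> 'a::euclidean_space \<Rightarrow> real"
  assumes [measurable]: "(\<lambda>(r, \<xi>). \<Phi> r \<xi>) \<in> borel_measurable (borel \<Otimes>\<^sub>M borel)"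
    and nn: "\<And>r \<xi>. \<Phi> r \<xi> \<ge> 0" and fin: "(\<integral>\<^sup>+r. \<integral>\<^sup>+\<xi>. ennreal (\<Phi> r \<xi>) \<partial>lborel \<partial>lborel) < \<infinity>"
  shows "integrable (lborel \<Otimes>\<^sub>M lborel) (\<lambda>(r, \<xi>). \<Phi> r \<xi> * cos (\<xi> \<bullet> x))"
proof (rule Bochner_Integration.integrable_bound)
  show "integrable (lborel \<Otimes>\<^sub>M lborel) (\<lambda>(r, \<xi>). \<Phi> r \<xi>)"
  proof (rule integrableI_bounded)
    show "(\<lambda>(r, \<xi>). \<Phi> r \<xi>) \<in> borel_measurable (lborel \<Otimes>\<^sub>M lborel)" by measurable
    have "(\<integral>\<^sup>+p. ennreal (norm (case p of (r, \<xi>) \<Rightarrow> \<Phi> r \<xi>)) \<partial>(lborel \<Otimes>\<^sub>M lborel)) = (\<integral>\<^sup>+r. \<integral>\<^sup>+\<xi>. ennreal (\<Phi> r \<xi>) \<partial>lborel \<partial>lborel)"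
      by (subst lborel.nn_integral_fst[symmetric]) (auto simp: nn abs_of_nonneg)
    then show "(\<integral>\<^sup>+p. ennreal (norm (case p of (r, \<xi>) \<Rightarrow> \<Phi> r \<xi>)) \<partial>(lborel \<Otimes>\<^sub>M lborel)) < \<infinity>" using fin by simp
  qed
qed (auto simp: abs_mult intro!: mult_left_le AE_I2)

locale hardy = stable_heat \<alpha> N for \<alpha> :: real and N :: "'n::finite itself" +
  fixes \<delta> :: real
  assumes dim: "\<alpha> < real CARD('n)" and \<delta>: "0 < \<delta>" "\<delta> < \<alpha>"
begin

text \<open>Integrating \<open>Phi\<close> in both orders evaluates the moment of order \<open>\<delta>\<close>, integrating \<open>Psi\<close> below in both
  orders the time integral of the moments of order \<open>\<delta> - \<alpha>\<close>. Both are multiples of the same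
  integral \<open>J\<close>, and the ratio of the two factors is \<open>- \<kappa>\<^sub>\<delta>\<close>.\<close>
definition Phi :: "real \<Rightarrow> real \<Rightarrow> real^'n \<Rightarrow> real" where
  "Phi t r \<xi> = indicator {0<..} r * (r powr (- 1 - \<delta> / 2) * gauss r \<xi>) * (1 - exp (- t * norm \<xi> powr \<alpha>))"

definition jj :: "real \<Rightarrow> real^'n \<Rightarrow> real" where
  "jj t \<xi> = norm \<xi> powr (- real CARD('n) - \<delta>) * (1 - exp (- t * norm \<xi> powr \<alpha>))"

definition J :: "real \<Rightarrow> real^'n \<Rightarrow> real" where
  "J t x = (LINT \<xi>|lborel. jj t \<xi> * cos (\<xi> \<bullet> x))"

text \<open>\<open>k1\<close> and \<open>k2\<close> are the constants of
  \<open>nn_integral_gauss_powr\<close> at p = (d + \<delta>)/2 and p = (d + \<delta> - \<alpha>)/2;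
  the exponents match the powers |x|^\<delta> and |x|^(\<delta> - \<alpha>).\<close>

definition k1 :: real where
  "k1 = (4 * pi) powr (- real CARD('n) / 2) * Gamma ((real CARD('n) + \<delta>) / 2) * 4 powr ((real CARD('n) + \<delta>) / 2)"

definition k2 :: real where
  "k2 = (4 * pi) powr (- real CARD('n) / 2) * Gamma ((real CARD('n) + \<delta> - \<alpha>) / 2) * 4 powr ((real CARD('n) + \<delta> - \<alpha>) / 2)"

text \<open>Fourier form of the mean of exp (- r |x + Y|^2) for Y with density
  \<open>heat \<alpha> t\<close>; see \<open>EE_heat\<close>.\<close>

definition EE :: "real \<Rightarrow> real \<Rightarrow> real^'n \<Rightarrow> real" where
  "EE r t x = (LINT \<xi>|lborel. gauss r \<xi> * cos (\<xi> \<bullet> x) * exp (- t * norm \<xi> powr \<alpha>))"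

text \<open>Fourier form of the integral of \<open>EE r s x\<close> over 0 < s < t; see
  \<open>time_integral_EE\<close>.\<close>

definition BB :: "real \<Rightarrow> real \<Rightarrow> real^'n \<Rightarrow> real" where
  "BB r t x = (LINT \<xi>|lborel. gauss r \<xi> * cos (\<xi> \<bullet> x) * ((1 - exp (- t * norm \<xi> powr \<alpha>)) * norm \<xi> powr (- \<alpha>)))"

lemma k1_pos: "k1 > 0" and k2_pos: "k2 > 0"
  using dim \<delta> \<alpha> by (auto simp: k1_def k2_def Gamma_real_pos)

lemma Phi_nonneg: "t > 0 \<Longrightarrow> 0 \<le> Phi t r \<xi>"
  by (auto simp: Phi_def gauss_nonneg indicator_def)

lemma jj_nonneg: "t > 0 \<Longrightarrow> 0 \<le> jj t \<xi>"
  by (auto simp: jj_def)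

lemma Phi_measurable [measurable (raw)]:
  assumes [measurable]: "f \<in> borel_measurable M" "g \<in> borel_measurable M"
  shows "(\<lambda>w. Phi t (f w) (g w)) \<in> borel_measurable M"
  unfolding Phi_def by measurable

lemma jj_measurable [measurable]: "jj t \<in> borel_measurable borel"
  unfolding jj_def by measurable

text \<open>The \<xi>-integral is bounded both by r^(-1-\<delta>/2) and by that times C
  r^(\<alpha>/2). The first bound controls large r, the second small r because \<delta> <
  \<alpha>.\<close>

lemma Phi_finite:
  assumes t: "t > 0"
  shows "(\<integral>\<^sup>+r. \<integral>\<^sup>+\<xi>. ennreal (Phi t r \<xi>) \<partial>lborel \<partial>lborel) < \<infinity>"
proof -
  define C where "C = gmom * t"
  have C: "C \<ge> 0" using gmom_pos t by (simp add: C_def)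
  have "(\<integral>\<^sup>+r. \<integral>\<^sup>+\<xi>. ennreal (Phi t r \<xi>) \<partial>lborel \<partial>lborel) \<le>
     (\<integral>\<^sup>+r. ennreal (indicator {0<..} r * (r powr (- 1 - \<delta> / 2) * min 1 (C * r powr ((\<alpha> - \<delta>) / 2 + \<delta> / 2)))) \<partial>lborel)"
  proof (intro nn_integral_mono)
    fix r :: real
    show "(\<integral>\<^sup>+\<xi>. ennreal (Phi t r \<xi>) \<partial>lborel) \<le> ennreal (indicator {0<..} r * (r powr (- 1 - \<delta> / 2) * min 1 (C * r powr ((\<alpha> - \<delta>) / 2 + \<delta> / 2))))"
    proof (cases "r > 0")
      case r: True
      let ?D = "(\<integral>\<^sup>+\<xi>. ennreal (gauss r (\<xi>::real^'n)) * ennreal (1 - exp (- t * norm \<xi> powr \<alpha>)) \<partial>lborel)"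
      have "(\<integral>\<^sup>+\<xi>. ennreal (Phi t r \<xi>) \<partial>lborel) = (\<integral>\<^sup>+\<xi>. ennreal (r powr (- 1 - \<delta> / 2)) * (ennreal (gauss r (\<xi>::real^'n)) * ennreal (1 - exp (- t * norm \<xi> powr \<alpha>))) \<partial>lborel)"
        using r t by (intro nn_integral_cong) (simp add: Phi_def ennreal_mult[symmetric] gauss_nonneg mult.assoc)
      also have "\<dots> = ennreal (r powr (- 1 - \<delta> / 2)) * ?D"
        by (rule nn_integral_cmult) measurable
      also have "\<dots> \<le> ennreal (r powr (- 1 - \<delta> / 2)) * ennreal (min 1 (C * r powr (\<alpha> / 2)))"
      proof (rule mult_left_mono)
        have "?D \<le> (\<integral>\<^sup>+\<xi>. ennreal (gauss r (\<xi>::real^'n)) \<partial>lborel)"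
          using t by (intro nn_integral_mono) (auto simp: gauss_nonneg ennreal_mult[symmetric] intro!: ennreal_leI mult_left_le)
        also have "\<dots> = 1"
          using gauss_integral[OF r, where 'a="real^'n"]
          by (subst nn_integral_eq_integral) (auto simp: has_bochner_integral_iff gauss_nonneg)
        finally have "?D \<le> ennreal 1" by simp
        moreover have "?D \<le> ennreal (C * r powr (\<alpha> / 2))" unfolding C_def by (rule deficit_upper[OF t r])
        ultimately show "?D \<le> ennreal (min 1 (C * r powr (\<alpha> / 2)))" by (auto simp: min_def)
      qed simp
      also have "\<dots> = ennreal (r powr (- 1 - \<delta> / 2) * min 1 (C * r powr (\<alpha> / 2)))"
        using C by (subst ennreal_mult) auto
      also have "\<alpha> / 2 = (\<alpha> - \<delta>) / 2 + \<delta> / 2" by (simp add: field_simps)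
      finally show ?thesis using r by simp
    qed (simp add: Phi_def)
  qed
  also have "\<dots> < \<infinity>"
    by (rule nn_integral_powr_min) (use \<delta> \<alpha> C in auto)
  finally show ?thesis .
qed

lemma Phi_integral_r:
  assumes t: "t > 0" and \<xi>: "\<xi> \<noteq> 0"
  shows "(\<integral>\<^sup>+r. ennreal (Phi t r \<xi>) \<partial>lborel) = ennreal (k1 * jj t \<xi>)"
proof -
  have p: "(real CARD('n) + \<delta>) / 2 > 0" using dim \<alpha> \<delta> by simp
  have e1: "real CARD('n) / 2 - 1 - (real CARD('n) + \<delta>) / 2 = - 1 - \<delta> / 2" by (simp add: field_simps)
  have e2: "- 2 * ((real CARD('n) + \<delta>) / 2) = - real CARD('n) - \<delta>" by simp
  have "(\<integral>\<^sup>+r. ennreal (Phi t r \<xi>) \<partial>lborel) = (\<integral>\<^sup>+r. ennreal (indicator {0<..} r * (r powr (- 1 - \<delta> / 2) * gauss r \<xi>)) * ennreal (1 - exp (- t * norm \<xi> powr \<alpha>)) \<partial>lborel)"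
    unfolding Phi_def using t by (intro nn_integral_cong ennreal_mult) (auto simp: gauss_nonneg)
  also have "\<dots> = ennreal (k1 * norm \<xi> powr (- real CARD('n) - \<delta>)) * ennreal (1 - exp (- t * norm \<xi> powr \<alpha>))"
    using nn_integral_gauss_powr[OF p \<xi>] unfolding DIM_cart DIM_real mult_1_right e1 e2
    by (subst nn_integral_multc) (auto simp: k1_def mult_ac)
  also have "\<dots> = ennreal (k1 * jj t \<xi>)"
    using k1_pos t by (subst ennreal_mult[symmetric]) (auto simp: jj_def mult_ac)
  finally show ?thesis .
qed

lemma jj_integrable:
  assumes t: "t > 0"
  shows "integrable lborel (jj t)"
proof -
  have "(\<integral>\<^sup>+\<xi>. ennreal (k1 * jj t \<xi>) \<partial>lborel) = (\<integral>\<^sup>+\<xi>. \<integral>\<^sup>+r. ennreal (Phi t r \<xi>) \<partial>lborel \<partial>lborel)"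
    by (intro nn_integral_cong_AE, use AE_lborel_singleton[of "0::real^'n"] in eventually_elim) (simp add: Phi_integral_r[OF t])
  also have "\<dots> = (\<integral>\<^sup>+r. \<integral>\<^sup>+\<xi>. ennreal (Phi t r \<xi>) \<partial>lborel \<partial>lborel)"
    by (rule lborel_pair.Fubini'[symmetric]) measurable
  also have "\<dots> < \<infinity>" by (rule Phi_finite[OF t])
  finally have "integrable lborel (\<lambda>\<xi>. k1 * jj t \<xi>)"
    using jj_nonneg[OF t] k1_pos by (intro integrableI_bounded) (auto simp: abs_mult)
  then show ?thesis using k1_pos by simp
qed

lemma gauss_exp_cos_integrable:
  fixes x :: "real^'n"
  assumes r: "r > 0" and t: "t \<ge> 0"
  shows "integrable lborel (\<lambda>\<xi>. gauss r \<xi> * cos (\<xi> \<bullet> x) * exp (- t * norm \<xi> powr \<alpha>))"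
proof (rule Bochner_Integration.integrable_bound)
  show "integrable lborel (gauss r :: real^'n \<Rightarrow> real)"
    using gauss_integral[OF r, where 'a="real^'n"] by (simp add: has_bochner_integral_iff)
  show "AE \<xi> in lborel. norm (gauss r \<xi> * cos (\<xi> \<bullet> x) * exp (- t * norm \<xi> powr \<alpha>)) \<le> norm (gauss r \<xi>)"
  proof (intro AE_I2)
    fix \<xi> :: "real^'n"
    have "\<bar>cos (\<xi> \<bullet> x)\<bar> * exp (- t * norm \<xi> powr \<alpha>) \<le> 1 * 1"
      using t by (intro mult_mono) auto
    then show "norm (gauss r \<xi> * cos (\<xi> \<bullet> x) * exp (- t * norm \<xi> powr \<alpha>)) \<le> norm (gauss r \<xi>)"
      by (simp add: abs_mult gauss_nonneg mult.assoc mult_left_le)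
  qed
qed measurable

text \<open>The two orders of integration of \<open>Phi\<close> times a cosine. The difference exp
  (- r |x|^2) - EE is kept together since the r-integral of each term alone diverges at 0.\<close>

lemma delta_transform:
  assumes t: "t > 0"
  shows "has_bochner_integral lborel (\<lambda>r. indicator {0<..} r * (r powr (- 1 - \<delta> / 2) * (exp (- r * (norm x)\<^sup>2) - EE r t x))) (k1 * J t x)"
proof -
  have int: "integrable (lborel \<Otimes>\<^sub>M lborel) (\<lambda>(r, \<xi>). Phi t r \<xi> * cos (\<xi> \<bullet> x))"
    by (rule integrable_pair_cos) (use Phi_finite[OF t] Phi_nonneg[OF t] in auto)
  have inner: "(LINT \<xi>|lborel. Phi t r \<xi> * cos (\<xi> \<bullet> x)) = indicator {0<..} r * (r powr (- 1 - \<delta> / 2) * (exp (- r * (norm x)\<^sup>2) - EE r t x))" for r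
  proof (cases "r > 0")
    case r: True
    have "(LINT \<xi>|lborel. Phi t r \<xi> * cos (\<xi> \<bullet> x)) = (LINT \<xi>|lborel. r powr (- 1 - \<delta> / 2) * (gauss r \<xi> * cos (\<xi> \<bullet> x) - gauss r \<xi> * cos (\<xi> \<bullet> x) * exp (- t * norm \<xi> powr \<alpha>)))"
      using r by (intro Bochner_Integration.integral_cong) (auto simp: Phi_def algebra_simps)
    also have "\<dots> = r powr (- 1 - \<delta> / 2) * (exp (- r * (norm x)\<^sup>2) - EE r t x)"
      using gauss_fourier[OF r, of x] gauss_exp_cos_integrable[OF r, of t x] t
      by (subst integral_mult_right_zero, subst Bochner_Integration.integral_diff) (auto simp: has_bochner_integral_iff EE_def)
    finally show ?thesis using r by simp
  qed (simp add: Phi_def)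
  have outer: "(LINT r|lborel. Phi t r \<xi> * cos (\<xi> \<bullet> x)) = k1 * (jj t \<xi> * cos (\<xi> \<bullet> x))" if "\<xi> \<noteq> 0" for \<xi>
  proof -
    have "has_bochner_integral lborel (\<lambda>r. Phi t r \<xi>) (k1 * jj t \<xi>)"
      using Phi_integral_r[OF t that] Phi_nonneg[OF t] k1_pos jj_nonneg[OF t]
      by (intro has_bochner_integral_nn_integral) auto
    then show ?thesis by (simp add: has_bochner_integral_iff)
  qed
  have "(LINT r|lborel. LINT \<xi>|lborel. Phi t r \<xi> * cos (\<xi> \<bullet> x)) = (LINT \<xi>|lborel. LINT r|lborel. Phi t r \<xi> * cos (\<xi> \<bullet> x))"
    by (rule lborel_pair.Fubini_integral[OF int, symmetric])
  also have "\<dots> = (LINT \<xi>|lborel. k1 * (jj t \<xi> * cos (\<xi> \<bullet> x)))"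
  proof (rule integral_cong_AE)
    show "(\<lambda>\<xi>. LINT r|lborel. Phi t r \<xi> * cos (\<xi> \<bullet> x)) \<in> borel_measurable lborel" by measurable
    show "AE \<xi> in lborel. (LINT r|lborel. Phi t r \<xi> * cos (\<xi> \<bullet> x)) = k1 * (jj t \<xi> * cos (\<xi> \<bullet> x))"
      using AE_lborel_singleton[of "0::real^'n"] by eventually_elim (rule outer)
  qed simp
  also have "\<dots> = k1 * J t x" by (simp add: J_def)
  finally show ?thesis
    using lborel_pair.integrable_fst[OF int] unfolding inner by (simp add: has_bochner_integral_iff)
qed

lemma EE_heat:
  assumes t: "t > 0" and r: "r > 0"
  shows "(\<integral>\<^sup>+y. ennreal (exp (- r * (norm (x + y))\<^sup>2) * heat \<alpha> t y) \<partial>lborel) = ennreal (EE r t x)"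
    and "(\<integral>\<^sup>+y. ennreal ((1 - exp (- r * (norm (x + y))\<^sup>2)) * heat \<alpha> t y) \<partial>lborel) = ennreal (1 - EE r t x)"
    and "0 \<le> EE r t x" "EE r t x \<le> 1"
proof -
  note hg = heat_gaussian[OF t \<alpha>(1) r, of x, folded EE_def]
  have hi: "integrable lborel (heat \<alpha> t :: real^'n \<Rightarrow> real)" "(LINT y|lborel. heat \<alpha> t (y::real^'n)) = 1"
    using heat_integral[OF t] by (auto simp: has_bochner_integral_iff)
  show "(\<integral>\<^sup>+y. ennreal (exp (- r * (norm (x + y))\<^sup>2) * heat \<alpha> t y) \<partial>lborel) = ennreal (EE r t x)"
    using hg heat_nonneg[OF t] by (subst nn_integral_eq_integral) auto
  have 1: "integrable lborel (\<lambda>y::real^'n. (1 - exp (- r * (norm (x + y))\<^sup>2)) * heat \<alpha> t y)"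
    using Bochner_Integration.integrable_diff[OF hi(1) hg(1)] by (simp add: left_diff_distrib)
  have 2: "(LINT y|lborel. (1 - exp (- r * (norm (x + y))\<^sup>2)) * heat \<alpha> t (y::real^'n)) = 1 - EE r t x"
    using Bochner_Integration.integral_diff[OF hi(1) hg(1)] hi(2) hg(2) by (simp add: left_diff_distrib)
  show "(\<integral>\<^sup>+y. ennreal ((1 - exp (- r * (norm (x + y))\<^sup>2)) * heat \<alpha> t y) \<partial>lborel) = ennreal (1 - EE r t x)"
    unfolding 2[symmetric] using r heat_nonneg[OF t] by (intro nn_integral_eq_integral 1) auto
  show "0 \<le> EE r t x" unfolding hg(2)[symmetric] using heat_nonneg[OF t] by (intro integral_nonneg_AE) auto
  have "0 \<le> 1 - EE r t x" unfolding 2[symmetric] using r heat_nonneg[OF t] by (intro integral_nonneg_AE) auto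
  then show "EE r t x \<le> 1" by simp
qed

text \<open>Equal to - Gamma (- \<delta>/2), as \<open>vk_eq\<close> shows, but written with a
  positive argument of Gamma so that its sign is evident.\<close>

definition cdel :: real where "cdel = Gamma (1 - \<delta> / 2) / (\<delta> / 2)"

lemma cdel_pos: "cdel > 0"
  using \<delta> \<alpha> by (simp add: cdel_def Gamma_real_pos)

lemma norm_sq_powr: "((norm (z::real^'n))\<^sup>2) powr (a / 2) = norm z powr a"
proof (cases "z = 0")
  case False
  then have "(norm z)\<^sup>2 = norm z powr 2" by simp
  then show ?thesis by (simp only: powr_powr) simp
qed simp

text \<open>Represent |z|^\<delta> by the functions 1 - exp (- r |z|^2). Averaging gives 1 - EE,
  whose excess over 1 - exp (- r |x|^2) is the integrand of \<open>delta_transform\<close>.\<close>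

lemma moment_delta:
  assumes t: "t > 0"
  shows "(\<integral>\<^sup>+y. ennreal (cdel * norm (x + y) powr \<delta>) * ennreal (heat \<alpha> t y) \<partial>lborel) = ennreal (cdel * norm x powr \<delta> + k1 * J t x)"
    and "0 \<le> cdel * norm x powr \<delta> + k1 * J t x"
proof -
  have b: "0 < \<delta> / 2" "\<delta> / 2 < 1" using \<delta> \<alpha> by auto
  have rep: "ennreal (cdel * norm z powr \<delta>) = (\<integral>\<^sup>+r. ennreal (indicator {0<..} r * (r powr (- 1 - \<delta> / 2) * (1 - exp (- r * (norm z)\<^sup>2)))) \<partial>lborel)" for z :: "real^'n"
    using nn_integral_one_minus_exp_powr[OF b, of "(norm z)\<^sup>2"] by (simp add: cdel_def norm_sq_powr)
  have i1: "has_bochner_integral lborel (\<lambda>r. indicator {0<..} r * (r powr (- 1 - \<delta> / 2) * (1 - exp (- r * (norm x)\<^sup>2)))) (cdel * norm x powr \<delta>)"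
    using rep[of x] cdel_pos by (intro has_bochner_integral_nn_integral) (auto simp: indicator_def)
  have i2: "has_bochner_integral lborel (\<lambda>r. indicator {0<..} r * (r powr (- 1 - \<delta> / 2) * (1 - EE r t x))) (cdel * norm x powr \<delta> + k1 * J t x)"
    using has_bochner_integral_add[OF i1 delta_transform[OF t, of x]] by (simp add: algebra_simps)
  have nn: "0 \<le> indicator {0<..} r * (r powr (- 1 - \<delta> / 2) * (1 - EE r t x))" for r
    using EE_heat(4)[OF t, of r x] by (auto simp: indicator_def)
  show "0 \<le> cdel * norm x powr \<delta> + k1 * J t x"
    using i2 nn by (rule has_bochner_integral_nonneg)
  have "(\<integral>\<^sup>+y. ennreal (cdel * norm (x + y) powr \<delta>) * ennreal (heat \<alpha> t y) \<partial>lborel) =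
     (\<integral>\<^sup>+y. (\<integral>\<^sup>+r. ennreal (indicator {0<..} r * (r powr (- 1 - \<delta> / 2) * (1 - exp (- r * (norm (x + y))\<^sup>2)))) * ennreal (heat \<alpha> t y) \<partial>lborel) \<partial>lborel)"
    unfolding rep by (intro nn_integral_cong nn_integral_multc[symmetric]) measurable
  also have "\<dots> = (\<integral>\<^sup>+r. (\<integral>\<^sup>+y. ennreal (indicator {0<..} r * (r powr (- 1 - \<delta> / 2) * (1 - exp (- r * (norm (x + y))\<^sup>2)))) * ennreal (heat \<alpha> t y) \<partial>lborel) \<partial>lborel)"
    by (rule lborel_pair.Fubini') measurable
  also have "\<dots> = (\<integral>\<^sup>+r. ennreal (indicator {0<..} r * (r powr (- 1 - \<delta> / 2) * (1 - EE r t x))) \<partial>lborel)"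
  proof (intro nn_integral_cong)
    fix r :: real
    show "(\<integral>\<^sup>+y. ennreal (indicator {0<..} r * (r powr (- 1 - \<delta> / 2) * (1 - exp (- r * (norm (x + y))\<^sup>2)))) * ennreal (heat \<alpha> t y) \<partial>lborel) = ennreal (indicator {0<..} r * (r powr (- 1 - \<delta> / 2) * (1 - EE r t x)))"
    proof (cases "r > 0")
      case r: True
      have "(\<integral>\<^sup>+y. ennreal (indicator {0<..} r * (r powr (- 1 - \<delta> / 2) * (1 - exp (- r * (norm (x + y))\<^sup>2)))) * ennreal (heat \<alpha> t y) \<partial>lborel) =
        (\<integral>\<^sup>+y. ennreal (r powr (- 1 - \<delta> / 2)) * ennreal ((1 - exp (- r * (norm (x + y))\<^sup>2)) * heat \<alpha> t y) \<partial>lborel)"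
        using r heat_nonneg[OF t] by (intro nn_integral_cong) (simp add: ennreal_mult[symmetric] mult.assoc)
      also have "\<dots> = ennreal (r powr (- 1 - \<delta> / 2)) * ennreal (1 - EE r t x)"
        by (subst nn_integral_cmult, measurable) (simp only: EE_heat(2)[OF t r])
      finally show ?thesis using r EE_heat(4)[OF t r, of x] by (simp add: ennreal_mult[symmetric])
    qed simp
  qed
  also have "\<dots> = ennreal (cdel * norm x powr \<delta> + k1 * J t x)"
    using i2 nn by (subst nn_integral_eq_integral) (auto simp: has_bochner_integral_iff)
  finally show "(\<integral>\<^sup>+y. ennreal (cdel * norm (x + y) powr \<delta>) * ennreal (heat \<alpha> t y) \<partial>lborel) = ennreal (cdel * norm x powr \<delta> + k1 * J t x)" .
qed

lemma EE_measurable [measurable]: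
  assumes [measurable]: "f \<in> borel_measurable M" "g \<in> borel_measurable M"
  shows "(\<lambda>w. EE (f w) (g w) x) \<in> borel_measurable M"
proof -
  have "(\<lambda>(r, t). EE r t x) \<in> borel_measurable (borel \<Otimes>\<^sub>M borel)"
    unfolding EE_def by measurable
  from measurable_compose[OF _ this, of "\<lambda>w. (f w, g w)" M] show ?thesis by simp
qed

lemma BB_measurable [measurable]: "(\<lambda>r. BB r t x) \<in> borel_measurable borel"
  unfolding BB_def by measurable

lemma nn_integral_exp_Ioo:
  fixes m t :: real
  assumes "m > 0" "t > 0"
  shows "(\<integral>\<^sup>+s. ennreal (indicator {0<..<t} s * exp (- s * m)) \<partial>lborel) = ennreal ((1 - exp (- t * m)) / m)"
proof -
  have "(\<integral>\<^sup>+s. ennreal (indicator {0<..<t} s * exp (- s * m)) \<partial>lborel) = (\<integral>\<^sup>+s. ennreal (1 / m) * ennreal (indicator {0..t} s * (m * exp (- m * s))) \<partial>lborel)"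
    by (intro nn_integral_cong_AE, use AE_lborel_singleton[of 0] AE_lborel_singleton[of t] in eventually_elim)
       (use assms in \<open>auto simp: indicator_def ennreal_mult[symmetric] mult_ac\<close>)
  also have "\<dots> = ennreal (1 / m) * ennreal (1 - exp (- m * t))"
    using assms one_minus_exp_integral[of m t] by (subst nn_integral_cmult) auto
  finally show ?thesis using assms by (simp add: ennreal_mult[symmetric] mult_ac)
qed

text \<open>Integrating exp (- s |\<xi>|^\<alpha>) over 0 < s < t produces the last factor of
  \<open>BB\<close>. The sign of \<open>BB\<close>, hidden by the cosine in its definition, is
  inherited from \<open>EE\<close>.\<close>

lemma time_integral_EE:
  assumes t: "t > 0" and r: "r > 0"
  shows "(\<integral>\<^sup>+s. indicator {0<..<t} s * ennreal (EE r s x) \<partial>lborel) = ennreal (BB r t x)" and "0 \<le> BB r t x"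
proof -
  define Q where "Q s \<xi> = indicator {0<..<t} s * exp (- s * norm \<xi> powr \<alpha>) * gauss r \<xi>" for s :: real and \<xi> :: "real^'n"
  have [measurable]: "(\<lambda>(s, \<xi>). Q s \<xi>) \<in> borel_measurable (borel \<Otimes>\<^sub>M borel)"
    "(\<lambda>(\<xi>, s). Q s \<xi>) \<in> borel_measurable (borel \<Otimes>\<^sub>M borel)" unfolding Q_def by measurable
  have Q0: "0 \<le> Q s \<xi>" for s \<xi> by (simp add: Q_def gauss_nonneg)
  have "(\<integral>\<^sup>+s. \<integral>\<^sup>+\<xi>. ennreal (Q s \<xi>) \<partial>lborel \<partial>lborel) \<le> (\<integral>\<^sup>+s. indicator {0<..<t} s \<partial>lborel)"
  proof (intro nn_integral_mono)
    fix s :: real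
    have "(\<integral>\<^sup>+\<xi>. ennreal (Q s \<xi>) \<partial>lborel) \<le> (\<integral>\<^sup>+\<xi>. indicator {0<..<t} s * ennreal (gauss r (\<xi>::real^'n)) \<partial>lborel)"
      by (intro nn_integral_mono) (auto simp: Q_def indicator_def gauss_nonneg intro!: ennreal_leI mult_right_mono mult_left_le_one_le)
    also have "\<dots> = indicator {0<..<t} s"
      using gauss_integral[OF r, where 'a="real^'n"]
      by (subst nn_integral_cmult, simp, subst nn_integral_eq_integral) (auto simp: has_bochner_integral_iff gauss_nonneg)
    finally show "(\<integral>\<^sup>+\<xi>. ennreal (Q s \<xi>) \<partial>lborel) \<le> indicator {0<..<t} s" .
  qed
  also have "\<dots> < \<infinity>" using t by simp
  finally have int: "integrable (lborel \<Otimes>\<^sub>M lborel) (\<lambda>(s, \<xi>). Q s \<xi> * cos (\<xi> \<bullet> x))"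
    by (intro integrable_pair_cos Q0) auto
  have inner: "(LINT \<xi>|lborel. Q s \<xi> * cos (\<xi> \<bullet> x)) = indicator {0<..<t} s * EE r s x" for s
    unfolding Q_def EE_def by (subst integral_mult_right_zero[symmetric]) (auto intro!: Bochner_Integration.integral_cong simp: mult_ac)
  have outer: "(LINT s|lborel. Q s \<xi> * cos (\<xi> \<bullet> x)) = gauss r \<xi> * cos (\<xi> \<bullet> x) * ((1 - exp (- t * norm \<xi> powr \<alpha>)) * norm \<xi> powr (- \<alpha>))" if "\<xi> \<noteq> 0" for \<xi>
  proof -
    have m: "norm \<xi> powr \<alpha> > 0" using that by simp
    have "has_bochner_integral lborel (\<lambda>s. indicator {0<..<t} s * exp (- s * norm \<xi> powr \<alpha>)) ((1 - exp (- t * norm \<xi> powr \<alpha>)) / norm \<xi> powr \<alpha>)"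
      using nn_integral_exp_Ioo[OF m t] m t by (intro has_bochner_integral_nn_integral) auto
    then show ?thesis
      unfolding Q_def by (simp add: has_bochner_integral_iff mult.assoc powr_minus divide_inverse mult_ac)
  qed
  have "(LINT s|lborel. LINT \<xi>|lborel. Q s \<xi> * cos (\<xi> \<bullet> x)) = (LINT \<xi>|lborel. LINT s|lborel. Q s \<xi> * cos (\<xi> \<bullet> x))"
    by (rule lborel_pair.Fubini_integral[OF int, symmetric])
  also have "\<dots> = BB r t x"
    unfolding BB_def
  proof (rule integral_cong_AE)
    show "(\<lambda>\<xi>. LINT s|lborel. Q s \<xi> * cos (\<xi> \<bullet> x)) \<in> borel_measurable lborel" by measurable
    show "(\<lambda>\<xi>. gauss r \<xi> * cos (\<xi> \<bullet> x) * ((1 - exp (- t * norm \<xi> powr \<alpha>)) * norm \<xi> powr (- \<alpha>))) \<in> borel_measurable lborel" by measurable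
    show "AE \<xi> in lborel. (LINT s|lborel. Q s \<xi> * cos (\<xi> \<bullet> x)) = gauss r \<xi> * cos (\<xi> \<bullet> x) * ((1 - exp (- t * norm \<xi> powr \<alpha>)) * norm \<xi> powr (- \<alpha>))"
      using AE_lborel_singleton[of "0::real^'n"] by eventually_elim (rule outer)
  qed
  finally have hb: "has_bochner_integral lborel (\<lambda>s. indicator {0<..<t} s * EE r s x) (BB r t x)"
    using lborel_pair.integrable_fst[OF int] unfolding inner by (simp add: has_bochner_integral_iff)
  have nn: "0 \<le> indicator {0<..<t} s * EE r s x" for s
    using EE_heat(3)[of s r x] r by (auto simp: indicator_def)
  show "0 \<le> BB r t x" using hb nn by (rule has_bochner_integral_nonneg)
  have "(\<integral>\<^sup>+s. indicator {0<..<t} s * ennreal (EE r s x) \<partial>lborel) = (\<integral>\<^sup>+s. ennreal (indicator {0<..<t} s * EE r s x) \<partial>lborel)"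
    by (intro nn_integral_cong) (auto simp: indicator_def)
  also have "\<dots> = ennreal (BB r t x)"
    using hb nn by (subst nn_integral_eq_integral) (auto simp: has_bochner_integral_iff)
  finally show "(\<integral>\<^sup>+s. indicator {0<..<t} s * ennreal (EE r s x) \<partial>lborel) = ennreal (BB r t x)" .
qed

definition Psi :: "real \<Rightarrow> real \<Rightarrow> real^'n \<Rightarrow> real" where
  "Psi t r \<xi> = indicator {0<..} r * (r powr ((\<alpha> - \<delta>) / 2 - 1) * gauss r \<xi>) * ((1 - exp (- t * norm \<xi> powr \<alpha>)) * norm \<xi> powr (- \<alpha>))"

lemma Psi_nonneg: "t > 0 \<Longrightarrow> 0 \<le> Psi t r \<xi>"
  by (auto simp: Psi_def gauss_nonneg indicator_def)

lemma Psi_measurable [measurable (raw)]: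
  assumes [measurable]: "f \<in> borel_measurable M" "g \<in> borel_measurable M"
  shows "(\<lambda>w. Psi t (f w) (g w)) \<in> borel_measurable M"
  unfolding Psi_def by measurable

lemma Psi_integral_r:
  assumes t: "t > 0" and \<xi>: "\<xi> \<noteq> 0"
  shows "(\<integral>\<^sup>+r. ennreal (Psi t r \<xi>) \<partial>lborel) = ennreal (k2 * jj t \<xi>)"
proof -
  have p: "(real CARD('n) + \<delta> - \<alpha>) / 2 > 0" using dim \<alpha> \<delta> by simp
  have e1: "real CARD('n) / 2 - 1 - (real CARD('n) + \<delta> - \<alpha>) / 2 = (\<alpha> - \<delta>) / 2 - 1" by (simp add: field_simps)
  have e2: "- 2 * ((real CARD('n) + \<delta> - \<alpha>) / 2) = \<alpha> - real CARD('n) - \<delta>" by simp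
  have "(\<integral>\<^sup>+r. ennreal (Psi t r \<xi>) \<partial>lborel) = (\<integral>\<^sup>+r. ennreal (indicator {0<..} r * (r powr ((\<alpha> - \<delta>) / 2 - 1) * gauss r \<xi>)) * ennreal ((1 - exp (- t * norm \<xi> powr \<alpha>)) * norm \<xi> powr (- \<alpha>)) \<partial>lborel)"
    unfolding Psi_def using t by (intro nn_integral_cong ennreal_mult) (auto simp: gauss_nonneg)
  also have "\<dots> = ennreal (k2 * norm \<xi> powr (\<alpha> - real CARD('n) - \<delta>)) * ennreal ((1 - exp (- t * norm \<xi> powr \<alpha>)) * norm \<xi> powr (- \<alpha>))"
    using nn_integral_gauss_powr[OF p \<xi>] unfolding DIM_cart DIM_real mult_1_right e1 e2
    by (subst nn_integral_multc) (auto simp: k2_def mult_ac)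
  also have "\<dots> = ennreal (k2 * ((norm \<xi> powr (\<alpha> - real CARD('n) - \<delta>) * norm \<xi> powr (- \<alpha>)) * (1 - exp (- t * norm \<xi> powr \<alpha>))))"
    using k2_pos t by (subst ennreal_mult[symmetric]) (auto simp: mult_ac)
  also have "norm \<xi> powr (\<alpha> - real CARD('n) - \<delta>) * norm \<xi> powr (- \<alpha>) = norm \<xi> powr (- real CARD('n) - \<delta>)"
    by (simp add: powr_add[symmetric])
  finally show ?thesis by (simp add: jj_def)
qed

text \<open>Finiteness takes no new estimate: integrated over r, \<open>Psi\<close> is a multiple of
  the same \<open>jj\<close> as \<open>Phi\<close>. The sign of \<open>J\<close> follows from that
  of \<open>BB\<close>.\<close>

lemma nn_integral_BB:
  assumes t: "t > 0"
  shows "(\<integral>\<^sup>+r. ennreal (indicator {0<..} r * (r powr ((\<alpha> - \<delta>) / 2 - 1) * BB r t x)) \<partial>lborel) = ennreal (k2 * J t x)" and "0 \<le> J t x"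
proof -
  have "(\<integral>\<^sup>+r. \<integral>\<^sup>+\<xi>. ennreal (Psi t r \<xi>) \<partial>lborel \<partial>lborel) = (\<integral>\<^sup>+\<xi>. \<integral>\<^sup>+r. ennreal (Psi t r \<xi>) \<partial>lborel \<partial>lborel)"
    by (rule lborel_pair.Fubini') measurable
  also have "\<dots> = (\<integral>\<^sup>+\<xi>. ennreal (k2 * jj t \<xi>) \<partial>lborel)"
    by (intro nn_integral_cong_AE, use AE_lborel_singleton[of "0::real^'n"] in eventually_elim) (simp add: Psi_integral_r[OF t])
  also have "\<dots> < \<infinity>"
    using jj_integrable[OF t] jj_nonneg[OF t] k2_pos by (subst nn_integral_eq_integral) auto
  finally have int: "integrable (lborel \<Otimes>\<^sub>M lborel) (\<lambda>(r, \<xi>). Psi t r \<xi> * cos (\<xi> \<bullet> x))"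
    using Psi_nonneg[OF t] by (intro integrable_pair_cos) auto
  have inner: "(LINT \<xi>|lborel. Psi t r \<xi> * cos (\<xi> \<bullet> x)) = indicator {0<..} r * (r powr ((\<alpha> - \<delta>) / 2 - 1) * BB r t x)" for r
    unfolding Psi_def BB_def integral_mult_right_zero[symmetric] by (auto intro!: Bochner_Integration.integral_cong simp: mult_ac)
  have outer: "(LINT r|lborel. Psi t r \<xi> * cos (\<xi> \<bullet> x)) = k2 * (jj t \<xi> * cos (\<xi> \<bullet> x))" if "\<xi> \<noteq> 0" for \<xi>
  proof -
    have "has_bochner_integral lborel (\<lambda>r. Psi t r \<xi>) (k2 * jj t \<xi>)"
      using Psi_integral_r[OF t that] Psi_nonneg[OF t] k2_pos jj_nonneg[OF t]
      by (intro has_bochner_integral_nn_integral) auto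
    then show ?thesis by (simp add: has_bochner_integral_iff)
  qed
  have "(LINT r|lborel. LINT \<xi>|lborel. Psi t r \<xi> * cos (\<xi> \<bullet> x)) = (LINT \<xi>|lborel. LINT r|lborel. Psi t r \<xi> * cos (\<xi> \<bullet> x))"
    by (rule lborel_pair.Fubini_integral[OF int, symmetric])
  also have "\<dots> = (LINT \<xi>|lborel. k2 * (jj t \<xi> * cos (\<xi> \<bullet> x)))"
  proof (rule integral_cong_AE)
    show "(\<lambda>\<xi>. LINT r|lborel. Psi t r \<xi> * cos (\<xi> \<bullet> x)) \<in> borel_measurable lborel" by measurable
    show "AE \<xi> in lborel. (LINT r|lborel. Psi t r \<xi> * cos (\<xi> \<bullet> x)) = k2 * (jj t \<xi> * cos (\<xi> \<bullet> x))"
      using AE_lborel_singleton[of "0::real^'n"] by eventually_elim (rule outer)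
  qed simp
  also have "\<dots> = k2 * J t x" by (simp add: J_def)
  finally have hb: "has_bochner_integral lborel (\<lambda>r. indicator {0<..} r * (r powr ((\<alpha> - \<delta>) / 2 - 1) * BB r t x)) (k2 * J t x)"
    using lborel_pair.integrable_fst[OF int] unfolding inner by (simp add: has_bochner_integral_iff)
  have nn: "0 \<le> indicator {0<..} r * (r powr ((\<alpha> - \<delta>) / 2 - 1) * BB r t x)" for r
    using time_integral_EE(2)[OF t, of r x] by (auto simp: indicator_def)
  have "0 \<le> k2 * J t x" using hb nn by (rule has_bochner_integral_nonneg)
  then show "0 \<le> J t x" using k2_pos by (simp add: zero_le_mult_iff)
  show "(\<integral>\<^sup>+r. ennreal (indicator {0<..} r * (r powr ((\<alpha> - \<delta>) / 2 - 1) * BB r t x)) \<partial>lborel) = ennreal (k2 * J t x)"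
    using hb nn by (subst nn_integral_eq_integral) (auto simp: has_bochner_integral_iff)
qed

text \<open>The exponent is negative, so undamped Gaussian mixtures represent the power. Averaging
  gives \<open>EE\<close>, the time integral gives \<open>BB\<close>, and
  \<open>nn_integral_BB\<close> leads to the same \<open>J\<close> as in
  \<open>moment_delta\<close>.\<close>

lemma moment_delta_alpha:
  assumes t: "t > 0"
  shows "(\<integral>\<^sup>+s. indicator {0<..<t} s * (\<integral>\<^sup>+y. ennreal (Gamma ((\<alpha> - \<delta>) / 2) * norm (x + y) powr (\<delta> - \<alpha>)) * ennreal (heat \<alpha> s y) \<partial>lborel) \<partial>lborel) = ennreal (k2 * J t x)"
proof -
  define b where "b = (\<alpha> - \<delta>) / 2"
  have b: "b > 0" using \<delta> by (simp add: b_def)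
  have rep: "ennreal (Gamma b * norm z powr (\<delta> - \<alpha>)) = (\<integral>\<^sup>+r. ennreal (indicator {0<..} r * (r powr (b - 1) * exp (- r * (norm z)\<^sup>2))) \<partial>lborel)" if "z \<noteq> 0" for z :: "real^'n"
  proof -
    have "((norm z)\<^sup>2) powr (- b) = norm z powr (\<delta> - \<alpha>)"
    proof -
      have "- b = (\<delta> - \<alpha>) / 2" by (simp add: b_def field_simps)
      then show ?thesis using norm_sq_powr[of z "\<delta> - \<alpha>"] by (simp only:)
    qed
    then show ?thesis using nn_integral_Gamma_scaled[OF b, of "(norm z)\<^sup>2"] that by simp
  qed
  have inner: "(\<integral>\<^sup>+y. ennreal (Gamma b * norm (x + y) powr (\<delta> - \<alpha>)) * ennreal (heat \<alpha> s y) \<partial>lborel) = (\<integral>\<^sup>+r. ennreal (indicator {0<..} r * r powr (b - 1)) * ennreal (EE r s x) \<partial>lborel)"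
    if s: "s > 0" for s
  proof -
    have "(\<integral>\<^sup>+y. ennreal (Gamma b * norm (x + y) powr (\<delta> - \<alpha>)) * ennreal (heat \<alpha> s y) \<partial>lborel) =
       (\<integral>\<^sup>+y. (\<integral>\<^sup>+r. ennreal (indicator {0<..} r * (r powr (b - 1) * exp (- r * (norm (x + y))\<^sup>2))) * ennreal (heat \<alpha> s y) \<partial>lborel) \<partial>lborel)"
    \<comment> \<open>The representation of the negative power fails only at x + y = 0, a null set
      of y.\<close>
    proof (intro nn_integral_cong_AE, use AE_lborel_singleton[of "- x"] in eventually_elim)
      fix y assume "y \<noteq> - x"
      then have "x + y \<noteq> 0" by (metis add.commute add_eq_0_iff2)
      then show "ennreal (Gamma b * norm (x + y) powr (\<delta> - \<alpha>)) * ennreal (heat \<alpha> s y) = (\<integral>\<^sup>+r. ennreal (indicator {0<..} r * (r powr (b - 1) * exp (- r * (norm (x + y))\<^sup>2))) * ennreal (heat \<alpha> s y) \<partial>lborel)"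
        by (subst nn_integral_multc) (auto simp: rep)
    qed
    also have "\<dots> = (\<integral>\<^sup>+r. (\<integral>\<^sup>+y. ennreal (indicator {0<..} r * (r powr (b - 1) * exp (- r * (norm (x + y))\<^sup>2))) * ennreal (heat \<alpha> s y) \<partial>lborel) \<partial>lborel)"
      by (rule lborel_pair.Fubini') measurable
    also have "\<dots> = (\<integral>\<^sup>+r. ennreal (indicator {0<..} r * r powr (b - 1)) * ennreal (EE r s x) \<partial>lborel)"
    proof (intro nn_integral_cong)
      fix r :: real
      show "(\<integral>\<^sup>+y. ennreal (indicator {0<..} r * (r powr (b - 1) * exp (- r * (norm (x + y))\<^sup>2))) * ennreal (heat \<alpha> s y) \<partial>lborel) = ennreal (indicator {0<..} r * r powr (b - 1)) * ennreal (EE r s x)"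
      proof (cases "r > 0")
        case r: True
        have "(\<integral>\<^sup>+y. ennreal (indicator {0<..} r * (r powr (b - 1) * exp (- r * (norm (x + y))\<^sup>2))) * ennreal (heat \<alpha> s y) \<partial>lborel) =
          (\<integral>\<^sup>+y. ennreal (r powr (b - 1)) * ennreal (exp (- r * (norm (x + y))\<^sup>2) * heat \<alpha> s y) \<partial>lborel)"
          using r heat_nonneg[OF s] by (intro nn_integral_cong) (simp add: ennreal_mult[symmetric] mult.assoc)
        also have "\<dots> = ennreal (r powr (b - 1)) * ennreal (EE r s x)"
          by (subst nn_integral_cmult, measurable) (simp only: EE_heat(1)[OF s r])
        finally show ?thesis using r by simp
      qed simp
    qed
    finally show ?thesis .
  qed
  have "(\<integral>\<^sup>+s. indicator {0<..<t} s * (\<integral>\<^sup>+y. ennreal (Gamma b * norm (x + y) powr (\<delta> - \<alpha>)) * ennreal (heat \<alpha> s y) \<partial>lborel) \<partial>lborel) =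
     (\<integral>\<^sup>+s. (\<integral>\<^sup>+r. ennreal (indicator {0<..} r * r powr (b - 1)) * (indicator {0<..<t} s * ennreal (EE r s x)) \<partial>lborel) \<partial>lborel)"
  proof (intro nn_integral_cong)
    fix s :: real
    show "indicator {0<..<t} s * (\<integral>\<^sup>+y. ennreal (Gamma b * norm (x + y) powr (\<delta> - \<alpha>)) * ennreal (heat \<alpha> s y) \<partial>lborel) = (\<integral>\<^sup>+r. ennreal (indicator {0<..} r * r powr (b - 1)) * (indicator {0<..<t} s * ennreal (EE r s x)) \<partial>lborel)"
      by (cases "s \<in> {0<..<t}") (simp_all add: inner)
  qed
  also have "\<dots> = (\<integral>\<^sup>+r. (\<integral>\<^sup>+s. ennreal (indicator {0<..} r * r powr (b - 1)) * (indicator {0<..<t} s * ennreal (EE r s x)) \<partial>lborel) \<partial>lborel)"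
    by (rule lborel_pair.Fubini') measurable
  also have "\<dots> = (\<integral>\<^sup>+r. ennreal (indicator {0<..} r * (r powr (b - 1) * BB r t x)) \<partial>lborel)"
  proof (intro nn_integral_cong)
    fix r :: real
    show "(\<integral>\<^sup>+s. ennreal (indicator {0<..} r * r powr (b - 1)) * (indicator {0<..<t} s * ennreal (EE r s x)) \<partial>lborel) = ennreal (indicator {0<..} r * (r powr (b - 1) * BB r t x))"
    proof (cases "r > 0")
      case r: True
      have "(\<integral>\<^sup>+s. ennreal (r powr (b - 1)) * (indicator {0<..<t} s * ennreal (EE r s x)) \<partial>lborel) = ennreal (r powr (b - 1)) * ennreal (BB r t x)"
        by (subst nn_integral_cmult, measurable) (simp only: time_integral_EE(1)[OF t r])
      then show ?thesis using r time_integral_EE(2)[OF t r, of x] by (simp add: ennreal_mult)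
    qed simp
  qed
  also have "\<dots> = ennreal (k2 * J t x)" unfolding b_def by (rule nn_integral_BB(1)[OF t])
  finally show ?thesis unfolding b_def .
qed

definition vk :: real where "vk = - kappa (real CARD('n)) \<alpha> \<delta>"

text \<open>The point at which the value of \<kappa>\<delta> enters. The functional equation of
  Gamma turns \<open>cdel\<close> into - Gamma (- \<delta>/2), and the ratio of the powers of 4 in
  \<open>k1\<close> and \<open>k2\<close> is 2^\<alpha>.\<close>

lemma vk_eq: "vk * cdel * k2 = k1 * Gamma ((\<alpha> - \<delta>) / 2)"
proof -
  have nz: "- \<delta> / 2 \<noteq> 0" "- \<delta> / 2 \<notin> \<int>\<^sub>\<le>\<^sub>0"
  proof -
    show "- \<delta> / 2 \<notin> \<int>\<^sub>\<le>\<^sub>0"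
    proof
      assume "- \<delta> / 2 \<in> \<int>\<^sub>\<le>\<^sub>0"
      then obtain n :: int where n: "- \<delta> / 2 = of_int n" by (auto elim!: nonpos_Ints_cases)
      then have "of_int (- 1) < (of_int n :: real)" "(of_int n :: real) < of_int 0" using \<delta> \<alpha> by auto
      then show False unfolding of_int_less_iff by linarith
    qed
  qed (use \<delta> in auto)
  have "Gamma (- \<delta> / 2 + 1) = (- \<delta> / 2) * Gamma (- \<delta> / 2)"
    by (rule Gamma_plus1[OF nz(2)])
  then have G: "Gamma (1 - \<delta> / 2) = (- \<delta> / 2) * Gamma (- \<delta> / 2)" by (simp add: add.commute)
  have c: "cdel = - Gamma (- \<delta> / 2)" unfolding cdel_def G using \<delta> by simp
  have Gn: "Gamma (- \<delta> / 2) \<noteq> 0" using c cdel_pos by auto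
  have G2: "Gamma ((real CARD('n) + \<delta> - \<alpha>) / 2) > 0" using dim \<delta> by (simp add: Gamma_real_pos)
  have p4: "4 powr ((real CARD('n) + \<delta>) / 2) = 2 powr \<alpha> * 4 powr ((real CARD('n) + \<delta> - \<alpha>) / 2)"
  proof -
    have "(4::real) = 2 powr 2" by simp
    then have "4 powr (a / 2) = 2 powr a" for a :: real by (metis (no_types) powr_powr nonzero_mult_div_cancel_left times_divide_eq_right zero_neq_numeral)
    then show ?thesis by (simp add: powr_add[symmetric])
  qed
  show ?thesis
    unfolding vk_def kappa_def c k1_def k2_def p4 using Gn G2 by (simp add: field_simps)
qed

lemma vk_pos: "vk > 0"
proof -
  have "vk * (cdel * k2) > 0" using vk_eq k1_pos Gamma_real_pos[of "(\<alpha> - \<delta>) / 2"] \<delta> by (simp add: mult.assoc)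
  then show ?thesis using cdel_pos k2_pos by (rule zero_less_mult_pos2[OF _ mult_pos_pos])
qed

section \<open>The stable semigroup and its action on the power function\<close>

definition P :: "real \<Rightarrow> (real^'n \<Rightarrow> ennreal) \<Rightarrow> real^'n \<Rightarrow> ennreal" where
  "P t f x = (\<integral>\<^sup>+y. f (x + y) * ennreal (heat \<alpha> t y) \<partial>lborel)"

text \<open>Eliminates \<open>J\<close> between \<open>moment_delta\<close> and
  \<open>moment_delta_alpha\<close>; by \<open>vk_eq\<close> the factors k1 / cdel and vk k2 / Gamma
  ((\<alpha> - \<delta>)/2) coincide.\<close>

lemma P_powr_delta:
  assumes t: "t > 0"
  shows "P t (\<lambda>z. ennreal (norm z powr \<delta>)) x = ennreal (norm x powr \<delta>) +
      (\<integral>\<^sup>+s. indicator {0<..<t} s * P s (\<lambda>z. ennreal (vk * norm z powr (\<delta> - \<alpha>))) x \<partial>lborel)"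
    and "P t (\<lambda>z. ennreal (norm z powr \<delta>)) x < \<infinity>"
proof -
  define g where "g = Gamma ((\<alpha> - \<delta>) / 2)"
  have g: "g > 0" using \<delta> by (simp add: g_def Gamma_real_pos)
  have J0: "0 \<le> J t x" by (rule nn_integral_BB(2)[OF t])
  have "P t (\<lambda>z. ennreal (norm z powr \<delta>)) x = (\<integral>\<^sup>+y. ennreal (1 / cdel) * (ennreal (cdel * norm (x + y) powr \<delta>) * ennreal (heat \<alpha> t y)) \<partial>lborel)"
    unfolding P_def using cdel_pos heat_nonneg[OF t] by (intro nn_integral_cong) (simp add: ennreal_mult[symmetric])
  also have "\<dots> = ennreal (1 / cdel) * ennreal (cdel * norm x powr \<delta> + k1 * J t x)"
    by (subst nn_integral_cmult, measurable) (simp only: moment_delta(1)[OF t])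
  also have "\<dots> = ennreal (norm x powr \<delta> + k1 * J t x / cdel)"
    using cdel_pos moment_delta(2)[OF t, of x] by (subst ennreal_mult[symmetric]) (auto simp: field_simps)
  also have "\<dots> = ennreal (norm x powr \<delta>) + ennreal (k1 * J t x / cdel)"
    using cdel_pos J0 k1_pos by (intro ennreal_plus) auto
  finally have 1: "P t (\<lambda>z. ennreal (norm z powr \<delta>)) x = ennreal (norm x powr \<delta>) + ennreal (k1 * J t x / cdel)" .
  have "(\<integral>\<^sup>+s. indicator {0<..<t} s * P s (\<lambda>z. ennreal (vk * norm z powr (\<delta> - \<alpha>))) x \<partial>lborel) =
     (\<integral>\<^sup>+s. ennreal (vk / g) * (indicator {0<..<t} s * (\<integral>\<^sup>+y. ennreal (g * norm (x + y) powr (\<delta> - \<alpha>)) * ennreal (heat \<alpha> s y) \<partial>lborel)) \<partial>lborel)"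
  proof (intro nn_integral_cong)
    fix s :: real
    have "P s (\<lambda>z. ennreal (vk * norm z powr (\<delta> - \<alpha>))) x = (\<integral>\<^sup>+y. ennreal (vk / g) * (ennreal (g * norm (x + y) powr (\<delta> - \<alpha>)) * ennreal (heat \<alpha> s y)) \<partial>lborel)"
      unfolding P_def using vk_pos g by (intro nn_integral_cong) (simp add: ennreal_mult[symmetric] mult.assoc[symmetric])
    also have "\<dots> = ennreal (vk / g) * (\<integral>\<^sup>+y. ennreal (g * norm (x + y) powr (\<delta> - \<alpha>)) * ennreal (heat \<alpha> s y) \<partial>lborel)"
      by (rule nn_integral_cmult) measurable
    finally show "indicator {0<..<t} s * P s (\<lambda>z. ennreal (vk * norm z powr (\<delta> - \<alpha>))) x = ennreal (vk / g) * (indicator {0<..<t} s * (\<integral>\<^sup>+y. ennreal (g * norm (x + y) powr (\<delta> - \<alpha>)) * ennreal (heat \<alpha> s y) \<partial>lborel))"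
      by (simp add: mult.left_commute)
  qed
  also have "\<dots> = ennreal (vk / g) * ennreal (k2 * J t x)"
    unfolding g_def by (subst nn_integral_cmult, measurable) (simp only: moment_delta_alpha[OF t])
  also have "\<dots> = ennreal (vk * k2 / g * J t x)"
    using vk_pos g k2_pos J0 by (subst ennreal_mult[symmetric]) auto
  also have "vk * k2 / g = k1 / cdel"
    using vk_eq cdel_pos g unfolding g_def[symmetric] by (simp add: field_simps)
  finally show "P t (\<lambda>z. ennreal (norm z powr \<delta>)) x = ennreal (norm x powr \<delta>) +
      (\<integral>\<^sup>+s. indicator {0<..<t} s * P s (\<lambda>z. ennreal (vk * norm z powr (\<delta> - \<alpha>))) x \<partial>lborel)"
    using 1 by simp
  show "P t (\<lambda>z. ennreal (norm z powr \<delta>)) x < \<infinity>" unfolding 1 by simp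
qed

end

section \<open>The Markov property\<close>

text \<open>\<open>stable_process\<close> speaks of strictly increasing partitions beginning at 0,
  so s = 0 takes a partition with one step and s > 0 one with two.\<close>

lemma stable_process_increment:
  assumes SP: "stable_process \<alpha> M X x" and sr: "0 \<le> s" "s < r"
  shows "distributed M lborel (\<lambda>\<omega>. X r \<omega> - X s \<omega>) (\<lambda>y. ennreal (heat \<alpha> (r - s) y))"
proof (cases "s = 0")
  case True
  define f where "f i = (if i = 0 then 0 else r)" for i :: nat
  have "f 0 = 0 \<and> (\<forall>i<1. f i < f (Suc i))" using sr True by (auto simp: f_def)
  then have "\<forall>i<1. distributed M lborel (\<lambda>\<omega>. X (f (Suc i)) \<omega> - X (f i) \<omega>) (\<lambda>y. ennreal (heat \<alpha> (f (Suc i) - f i) y))"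
    using SP unfolding stable_process_def by blast
  then show ?thesis using True by (simp add: f_def)
next
  case False
  define f where "f i = (if i = 0 then 0 else if i = 1 then s else r)" for i :: nat
  have "f 0 = 0 \<and> (\<forall>i<2. f i < f (Suc i))" using sr False by (auto simp: f_def less_2_cases_iff)
  then have "\<forall>i<2. distributed M lborel (\<lambda>\<omega>. X (f (Suc i)) \<omega> - X (f i) \<omega>) (\<lambda>y. ennreal (heat \<alpha> (f (Suc i) - f i) y))"
    using SP unfolding stable_process_def by blast
  then show ?thesis by (auto dest: spec[of _ 1] simp: f_def)
qed

text \<open>The kernel is the density of X t - X 0 under a probability measure.\<close>

lemma stable_process_mass:
  fixes X :: "real \<Rightarrow> 'a \<Rightarrow> real^'n"
  assumes SP: "stable_process \<alpha> M X x" and t: "t > 0"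
  shows "nn_integral lborel (\<lambda>y::real^'n. ennreal (heat \<alpha> t y)) = 1"
proof -
  interpret prob_space M using SP by (simp add: stable_process_def)
  have d: "distributed M lborel (\<lambda>\<omega>. X t \<omega> - X 0 \<omega>) (\<lambda>y. ennreal (heat \<alpha> (t - 0) y))"
    by (rule stable_process_increment[OF SP]) (use t in auto)
  have "emeasure M ((\<lambda>\<omega>. X t \<omega> - X 0 \<omega>) -` UNIV \<inter> space M) = (\<integral>\<^sup>+y. ennreal (heat \<alpha> (t - 0) (y::real^'n)) * indicator UNIV y \<partial>lborel)"
    using distributed_emeasure[OF d, of UNIV] by simp
  then show ?thesis by (simp add: emeasure_space_1)
qed

text \<open>Brings a finite set of past times into the strictly increasing form that
  \<open>stable_process\<close> demands, with the step from s to r as the last one.\<close>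

lemma strict_enumeration:
  fixes S :: "real set"
  assumes fin: "finite S" and S: "0 \<in> S" "s \<in> S" "\<And>u. u \<in> S \<Longrightarrow> 0 \<le> u \<and> u \<le> s" and r: "s < r"
  obtains n :: nat and f where "f 0 = 0" "\<And>i. i < Suc n \<Longrightarrow> f i < f (Suc i)" "f n = s" "f (Suc n) = r" "f ` {..n} = S"
proof -
  define T where "T = sorted_list_of_set S"
  have T: "set T = S" "sorted T" "distinct T" using fin by (auto simp: T_def)
  have len: "length T > 0" using S T by auto
  define n where "n = length T - 1"
  define f where "f i = (if i < length T then T ! i else r)" for i
  have ln: "length T = Suc n" using len by (simp add: n_def)
  have img: "f ` {..n} = S"
    using T(1) by (auto simp: f_def ln in_set_conv_nth image_iff less_Suc_eq_le)
  have "f 0 = 0"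
  proof -
    obtain k where k: "k < length T" "T ! k = 0" using S(1) T(1) by (metis in_set_conv_nth)
    then have "T ! 0 \<le> 0" using sorted_nth_mono[OF T(2), of 0 k] by simp
    moreover have "T ! 0 \<in> S" using T(1) len by (metis nth_mem)
    ultimately show ?thesis using S(3)[of "T ! 0"] len by (simp add: f_def)
  qed
  moreover have fn: "f n = s"
  proof -
    obtain k where k: "k < length T" "T ! k = s" using S(2) T(1) by (metis in_set_conv_nth)
    then have "s \<le> T ! n" using sorted_nth_mono[OF T(2), of k n] ln by simp
    moreover have "T ! n \<in> S" using T(1) ln by (metis nth_mem lessI)
    ultimately show ?thesis using S(3)[of "T ! n"] ln by (simp add: f_def)
  qed
  moreover have "f (Suc n) = r" by (simp add: f_def ln)
  moreover have "f i < f (Suc i)" if i: "i < Suc n" for i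
  proof (cases "i = n")
    case True
    then show ?thesis using fn r by (simp add: f_def ln)
  next
    case False
    then have "Suc i < length T" using i ln by simp
    then have "T ! i < T ! Suc i"
      using T(2,3) by (metis Suc_lessD lessI nth_eq_iff_index_eq order_le_less sorted_nth_mono less_imp_le n_not_Suc_n)
    then show ?thesis using \<open>Suc i < length T\<close> by (simp add: f_def)
  qed
  ultimately show ?thesis using that img by blast
qed

locale hardy_process = hardy \<alpha> N \<delta> + prob_space M
  for \<alpha> :: real and N :: "'n::finite itself" and \<delta> and M :: "'a measure" +
  fixes X :: "real \<Rightarrow> 'a \<Rightarrow> real^'n" and x0 :: "real^'n"
  assumes SP: "stable_process \<alpha> M X x0"
begin

lemma X_pair_measurable [measurable]: "(\<lambda>(t, \<omega>). X t \<omega>) \<in> borel_measurable (borel \<Otimes>\<^sub>M M)"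
  using SP by (simp add: stable_process_def)

lemma X_measurable_comp [measurable (raw)]:
  assumes [measurable]: "f \<in> borel_measurable K" "g \<in> measurable K M"
  shows "(\<lambda>w. X (f w) (g w)) \<in> borel_measurable K"
  using measurable_compose[OF _ X_pair_measurable, of "\<lambda>w. (f w, g w)" K] by simp

lemma X0: "AE \<omega> in M. X 0 \<omega> = x0"
  using SP by (simp add: stable_process_def)

definition F :: "real \<Rightarrow> 'a measure" where
  "F s = sigma (space M) {X u -` B \<inter> space M |u B. 0 \<le> u \<and> u \<le> s \<and> B \<in> sets borel}"

lemma space_F [simp]: "space (F s) = space M"
  unfolding F_def by (rule space_measure_of) auto

lemma sets_F: "sets (F s) = sigma_sets (space M) {X u -` B \<inter> space M |u B. 0 \<le> u \<and> u \<le> s \<and> B \<in> sets borel}"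
  unfolding F_def by (rule sets_measure_of) auto

lemma X_measurable_F: "0 \<le> u \<Longrightarrow> u \<le> s \<Longrightarrow> X u \<in> borel_measurable (F s)"
  by (rule measurableI) (auto simp: sets_F intro!: sigma_sets.Basic)

lemma F_subset: "sets (F s) \<subseteq> sets M"
  unfolding sets_F by (rule sets.sigma_sets_subset) auto

lemma F_mono: "s \<le> r \<Longrightarrow> sets (F s) \<subseteq> sets (F r)"
  unfolding sets_F by (rule sigma_sets_mono') (blast intro: order_trans)

lemma measurable_F_mono: "f \<in> borel_measurable (F s) \<Longrightarrow> s \<le> r \<Longrightarrow> f \<in> borel_measurable (F r)"
  using F_mono[of s r] by (auto simp: measurable_def)

lemma measurable_F_M: "f \<in> borel_measurable (F s) \<Longrightarrow> f \<in> borel_measurable M"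
  using F_subset[of s] by (auto simp: measurable_def)

text \<open>After 0 and s are added to U, the positions at the times in U are x0 plus sums of the
  first n increments, hence independent of the last increment.\<close>

lemma cylinder_indep:
  assumes sr: "0 \<le> s" "s < r" and U: "finite U" "\<And>u. u \<in> U \<Longrightarrow> 0 \<le> u \<and> u \<le> s"
    and B: "\<And>u. B u \<in> sets borel" and C: "C \<in> sets borel"
  shows "prob ({\<omega> \<in> space M. \<forall>u\<in>U. X u \<omega> \<in> B u} \<inter> ((\<lambda>\<omega>. X r \<omega> - X s \<omega>) -` C \<inter> space M)) =
     prob {\<omega> \<in> space M. \<forall>u\<in>U. X u \<omega> \<in> B u} * prob ((\<lambda>\<omega>. X r \<omega> - X s \<omega>) -` C \<inter> space M)"
proof -
  obtain n :: nat and f where f: "f 0 = 0" "\<And>i. i < Suc n \<Longrightarrow> f i < f (Suc i)" "f n = s" "f (Suc n) = r" "f ` {..n} = insert 0 (insert s U)"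
    by (rule strict_enumeration[of "insert 0 (insert s U)" s r]) (use U sr in auto)
  define Y where "Y i \<omega> = X (f (Suc i)) \<omega> - X (f i) \<omega>" for i \<omega>
  have "indep_vars (\<lambda>_. borel) (\<lambda>i \<omega>. X (f (Suc i)) \<omega> - X (f i) \<omega>) {..<Suc n}"
    using SP f(1,2) unfolding stable_process_def by blast
  then have ind: "indep_vars (\<lambda>_. borel) Y {..<Suc n}" unfolding Y_def .
  have iv: "indep_var (PiM {..<n} (\<lambda>_. borel)) (\<lambda>\<omega>. restrict (\<lambda>i. Y i \<omega>) {..<n}) (PiM {n} (\<lambda>_. borel)) (\<lambda>\<omega>. restrict (\<lambda>i. Y i \<omega>) {n})"
    by (rule indep_var_restrict[OF ind]) auto
  \<comment> \<open>The cylinder event, expressed through the increments alone.\<close>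
  define A where "A = {g \<in> space (PiM {..<n} (\<lambda>_. borel :: (real^'n) measure)). \<forall>i\<in>{..n}. f i \<in> U \<longrightarrow> x0 + (\<Sum>j<i. g j) \<in> B (f i)}"
  have [measurable]: "B u \<in> sets borel" for u by (rule B)
  have A: "A \<in> sets (PiM {..<n} (\<lambda>_. borel))"
    unfolding A_def
  proof (rule sets.sets_Collect_finite_All')
    fix i assume "i \<in> {..n}"
    then have m: "(\<lambda>g. x0 + (\<Sum>j<i. g j)) \<in> borel_measurable (PiM {..<n} (\<lambda>_. borel :: (real^'n) measure))"
      by (intro borel_measurable_add borel_measurable_sum measurable_component_singleton) auto
    have "{g \<in> space (PiM {..<n} (\<lambda>_. borel)). f i \<in> U \<longrightarrow> x0 + (\<Sum>j<i. g j) \<in> B (f i)} =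
       (if f i \<in> U then (\<lambda>g. x0 + (\<Sum>j<i. g j)) -` B (f i) \<inter> space (PiM {..<n} (\<lambda>_. borel :: (real^'n) measure)) else space (PiM {..<n} (\<lambda>_. borel)))"
      by auto
    also have "\<dots> \<in> sets (PiM {..<n} (\<lambda>_. borel))"
      using measurable_sets[OF m B[of "f i"]] by auto
    finally show "{g \<in> space (PiM {..<n} (\<lambda>_. borel :: (real^'n) measure)). f i \<in> U \<longrightarrow> x0 + (\<Sum>j<i. g j) \<in> B (f i)} \<in> sets (PiM {..<n} (\<lambda>_. borel))" .
  qed auto
  define D where "D = {g \<in> space (PiM {n} (\<lambda>_. borel :: (real^'n) measure)). g n \<in> C}"
  have D: "D \<in> sets (PiM {n} (\<lambda>_. borel))"
  proof -
    have "(\<lambda>g. g n) \<in> borel_measurable (PiM {n} (\<lambda>_. borel :: (real^'n) measure))"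
      by (rule measurable_component_singleton) auto
    from measurable_sets[OF this C] show ?thesis unfolding D_def by (simp add: vimage_def Int_def conj_commute)
  qed
  let ?RA = "\<lambda>\<omega>. restrict (\<lambda>i. Y i \<omega>) {..<n}" and ?RD = "\<lambda>\<omega>. restrict (\<lambda>i. Y i \<omega>) {n}"
  define EA where "EA = ?RA -` A \<inter> space M"
  define ED where "ED = ?RD -` D \<inter> space M"
  have EAm: "EA \<in> events" unfolding EA_def using indep_var_rv1[OF iv] A by (rule measurable_sets)
  have EDm: "ED \<in> events" unfolding ED_def using indep_var_rv2[OF iv] D by (rule measurable_sets)
  have "prob ((\<lambda>\<omega>. (?RA \<omega>, ?RD \<omega>)) -` (A \<times> D) \<inter> space M) = prob (?RA -` A \<inter> space M) * prob (?RD -` D \<inter> space M)"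
    by (rule indep_varD[OF iv A D])
  also have "(\<lambda>\<omega>. (?RA \<omega>, ?RD \<omega>)) -` (A \<times> D) \<inter> space M = EA \<inter> ED"
    by (auto simp: EA_def ED_def)
  finally have pr: "prob (EA \<inter> ED) = prob EA * prob ED" unfolding EA_def ED_def .
  have ED: "ED = (\<lambda>\<omega>. X r \<omega> - X s \<omega>) -` C \<inter> space M"
    unfolding ED_def D_def using f(3,4) by (auto simp: Y_def space_PiM)
  let ?E = "{\<omega> \<in> space M. \<forall>u\<in>U. X u \<omega> \<in> B u}"
  have EA: "EA = {\<omega> \<in> space M. \<forall>i\<in>{..n}. f i \<in> U \<longrightarrow> x0 + (\<Sum>j<i. Y j \<omega>) \<in> B (f i)}"
  proof -
    have "(\<Sum>j<i. restrict (\<lambda>i. Y i \<omega>) {..<n} j) = (\<Sum>j<i. Y j \<omega>)" if "i \<le> n" for i \<omega>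
      using that by (intro sum.cong) auto
    then show ?thesis unfolding EA_def A_def by (auto simp: space_PiM)
  qed
  \<comment> \<open>The two descriptions agree only almost surely, since X 0 = x0 is an almost sure
    statement.\<close>
  have ae: "AE \<omega> in M. \<omega> \<in> ?E \<longleftrightarrow> \<omega> \<in> EA"
    using X0
  proof eventually_elim
    case (elim \<omega>)
    have tel: "x0 + (\<Sum>j<i. Y j \<omega>) = X (f i) \<omega>" for i
      unfolding Y_def using sum_lessThan_telescope[of "\<lambda>j. X (f j) \<omega>" i] f(1) elim by simp
    have "(\<forall>u\<in>U. X u \<omega> \<in> B u) \<longleftrightarrow> (\<forall>i\<in>{..n}. f i \<in> U \<longrightarrow> X (f i) \<omega> \<in> B (f i))"
    proof
      assume R: "\<forall>i\<in>{..n}. f i \<in> U \<longrightarrow> X (f i) \<omega> \<in> B (f i)"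
      show "\<forall>u\<in>U. X u \<omega> \<in> B u"
      proof
        fix u assume u: "u \<in> U"
        then have "u \<in> f ` {..n}" using f(5) by simp
        then obtain i where "i \<in> {..n}" "u = f i" by blast
        then show "X u \<omega> \<in> B u" using R u by blast
      qed
    qed auto
    then show ?case unfolding EA by (simp add: tel)
  qed
  have Em: "?E \<in> events" using U(1) by measurable
  have "prob (?E \<inter> ED) = prob (EA \<inter> ED)"
    by (rule finite_measure_eq_AE) (use ae Em EAm EDm in auto)
  moreover have "prob ?E = prob EA"
    by (rule finite_measure_eq_AE) (use ae Em EAm in auto)
  ultimately show ?thesis using pr unfolding ED by simp
qed

text \<open>Finite cylinders and increment events are both stable under intersection, so
  independence passes to the generated sigma-algebras; single-time events are cylinders, whence all
  of \<open>F s\<close> is covered.\<close>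

lemma F_indep_increment:
  assumes sr: "0 \<le> s" "s < r" and A: "A \<in> sets (F s)" and C: "C \<in> sets borel"
  shows "prob (A \<inter> ((\<lambda>\<omega>. X r \<omega> - X s \<omega>) -` C \<inter> space M)) = prob A * prob ((\<lambda>\<omega>. X r \<omega> - X s \<omega>) -` C \<inter> space M)"
proof -
  define G where "G = {{\<omega> \<in> space M. \<forall>u\<in>U. X u \<omega> \<in> B u} |U B. finite U \<and> (\<forall>u\<in>U. 0 \<le> u \<and> u \<le> s) \<and> (\<forall>u. B u \<in> sets borel)}"
  define I where "I = {(\<lambda>\<omega>. X r \<omega> - X s \<omega>) -` C \<inter> space M |C. C \<in> sets borel}"
  have Gm: "G \<subseteq> events"
  proof
    fix E assume "E \<in> G"
    then obtain U B where E: "E = {\<omega> \<in> space M. \<forall>u\<in>U. X u \<omega> \<in> B u}" "finite U" and B[measurable]: "\<And>u. B u \<in> sets borel" by (auto simp: G_def)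
    show "E \<in> events" unfolding E using E(2) by measurable
  qed
  have Im: "I \<subseteq> events" unfolding I_def by auto
  have 1: "indep_set G I"
    unfolding indep_sets2_eq
  proof (intro conjI Gm Im ballI)
    fix a b assume "a \<in> G" "b \<in> I"
    then obtain U B C where a: "a = {\<omega> \<in> space M. \<forall>u\<in>U. X u \<omega> \<in> B u}" "finite U" "\<And>u. u \<in> U \<Longrightarrow> 0 \<le> u \<and> u \<le> s" "\<And>u. B u \<in> sets borel"
      and b: "b = (\<lambda>\<omega>. X r \<omega> - X s \<omega>) -` C \<inter> space M" "C \<in> sets borel" by (auto simp: G_def I_def)
    show "prob (a \<inter> b) = prob a * prob b"
      unfolding a(1) b(1) by (rule cylinder_indep[OF sr a(2-4) b(2)])
  qed
  have IG: "Int_stable G"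
  proof (rule Int_stableI)
    fix a b assume "a \<in> G" "b \<in> G"
    then obtain U B U' B' where a: "a = {\<omega> \<in> space M. \<forall>u\<in>U. X u \<omega> \<in> B u}" "finite U" "\<forall>u\<in>U. 0 \<le> u \<and> u \<le> s" "\<forall>u. B u \<in> sets borel"
      and b: "b = {\<omega> \<in> space M. \<forall>u\<in>U'. X u \<omega> \<in> B' u}" "finite U'" "\<forall>u\<in>U'. 0 \<le> u \<and> u \<le> s" "\<forall>u. B' u \<in> sets borel" by (auto simp: G_def)
    define B'' where "B'' u = (if u \<in> U then B u else UNIV) \<inter> (if u \<in> U' then B' u else UNIV)" for u
    have "a \<inter> b = {\<omega> \<in> space M. \<forall>u\<in>U \<union> U'. X u \<omega> \<in> B'' u}"
      unfolding a(1) b(1) B''_def by auto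
    moreover have "finite (U \<union> U')" "\<forall>u\<in>U \<union> U'. 0 \<le> u \<and> u \<le> s" "\<forall>u. B'' u \<in> sets borel"
      using a b by (auto simp: B''_def)
    ultimately show "a \<inter> b \<in> G" unfolding G_def by blast
  qed
  have II: "Int_stable I"
  proof (rule Int_stableI)
    fix a b assume "a \<in> I" "b \<in> I"
    then obtain C C' where "a = (\<lambda>\<omega>. X r \<omega> - X s \<omega>) -` C \<inter> space M" "C \<in> sets borel" "b = (\<lambda>\<omega>. X r \<omega> - X s \<omega>) -` C' \<inter> space M" "C' \<in> sets borel" by (auto simp: I_def)
    then have "a \<inter> b = (\<lambda>\<omega>. X r \<omega> - X s \<omega>) -` (C \<inter> C') \<inter> space M \<and> C \<inter> C' \<in> sets borel" by auto
    then show "a \<inter> b \<in> I" unfolding I_def by blast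
  qed
  have 2: "indep_set (sigma_sets (space M) G) (sigma_sets (space M) I)"
    by (rule indep_set_sigma_sets[OF 1 IG II])
  have FG: "sets (F s) \<subseteq> sigma_sets (space M) G"
    unfolding sets_F
  proof (rule sigma_sets_mono', rule subsetI)
    fix E assume "E \<in> {X u -` B \<inter> space M |u B. 0 \<le> u \<and> u \<le> s \<and> B \<in> sets borel}"
    then obtain u B where "E = X u -` B \<inter> space M" "0 \<le> u" "u \<le> s" "B \<in> sets borel" by auto
    then have "E = {\<omega> \<in> space M. \<forall>v\<in>{u}. X v \<omega> \<in> (\<lambda>_. B) v}" "finite {u}" "\<forall>v\<in>{u}. 0 \<le> v \<and> v \<le> s" "\<forall>v. (\<lambda>_. B) v \<in> sets borel" by auto
    then show "E \<in> G" unfolding G_def mem_Collect_eq by (intro exI[of _ "{u}"] exI[of _ "\<lambda>_. B"] conjI)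
  qed
  have "A \<in> sigma_sets (space M) G" using A FG by blast
  moreover have "(\<lambda>\<omega>. X r \<omega> - X s \<omega>) -` C \<inter> space M \<in> sigma_sets (space M) I"
    using C by (intro sigma_sets.Basic) (auto simp: I_def)
  ultimately show ?thesis using 2 unfolding indep_sets2_eq by blast
qed

lemma id_measurable_F: "(\<lambda>\<omega>. \<omega>) \<in> measurable M (F s)"
proof (rule measurableI)
  fix A assume "A \<in> sets (F s)"
  then show "(\<lambda>\<omega>. \<omega>) -` A \<inter> space M \<in> events"
    using F_subset[of s] by (auto simp: vimage_def Int_def dest: sets.sets_into_space)
qed simp

text \<open>Independence as a product law for the pair of path and increment, the form in which
  Tonelli can integrate functions of both.\<close>

lemma F_increment_product:
  assumes sr: "0 \<le> s" "s < r"
  shows "distr M (F s) (\<lambda>\<omega>. \<omega>) \<Otimes>\<^sub>M distr M borel (\<lambda>\<omega>. X r \<omega> - X s \<omega>) = distr M (F s \<Otimes>\<^sub>M borel) (\<lambda>\<omega>. (\<omega>, X r \<omega> - X s \<omega>))"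
proof (rule pair_measure_eqI)
  have Dm[measurable]: "(\<lambda>\<omega>. X r \<omega> - X s \<omega>) \<in> borel_measurable M" by measurable
  note id_measurable_F[measurable]
  interpret D: prob_space "distr M borel (\<lambda>\<omega>. X r \<omega> - X s \<omega>)" by (rule prob_space_distr[OF Dm])
  interpret I: prob_space "distr M (F s) (\<lambda>\<omega>. \<omega>)" by (rule prob_space_distr[OF id_measurable_F])
  show "sigma_finite_measure (distr M (F s) (\<lambda>\<omega>. \<omega>))" "sigma_finite_measure (distr M borel (\<lambda>\<omega>. X r \<omega> - X s \<omega>))" by unfold_locales
  show "sets (distr M (F s) (\<lambda>\<omega>. \<omega>) \<Otimes>\<^sub>M distr M borel (\<lambda>\<omega>. X r \<omega> - X s \<omega>)) = sets (distr M (F s \<Otimes>\<^sub>M borel) (\<lambda>\<omega>. (\<omega>, X r \<omega> - X s \<omega>)))"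
    by (simp cong: sets_pair_measure_cong)
  fix A B assume "A \<in> sets (distr M (F s) (\<lambda>\<omega>. \<omega>))" "B \<in> sets (distr M borel (\<lambda>\<omega>. X r \<omega> - X s \<omega>))"
  then have A: "A \<in> sets (F s)" and B: "B \<in> sets borel" by auto
  have AM: "A \<in> events" using A F_subset by blast
  have Asp: "A \<inter> space M = A" using AM sets.sets_into_space by blast
  have "emeasure (distr M (F s \<Otimes>\<^sub>M borel) (\<lambda>\<omega>. (\<omega>, X r \<omega> - X s \<omega>))) (A \<times> B) = emeasure M ((\<lambda>\<omega>. (\<omega>, X r \<omega> - X s \<omega>)) -` (A \<times> B) \<inter> space M)"
    using A B by (intro emeasure_distr) auto
  also have "(\<lambda>\<omega>. (\<omega>, X r \<omega> - X s \<omega>)) -` (A \<times> B) \<inter> space M = A \<inter> ((\<lambda>\<omega>. X r \<omega> - X s \<omega>) -` B \<inter> space M)"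
    using Asp by auto
  also have "emeasure M \<dots> = emeasure M A * emeasure M ((\<lambda>\<omega>. X r \<omega> - X s \<omega>) -` B \<inter> space M)"
    unfolding emeasure_eq_measure F_indep_increment[OF sr A B] by (rule ennreal_mult) auto
  also have "emeasure M A = emeasure (distr M (F s) (\<lambda>\<omega>. \<omega>)) A"
    using A Asp by (subst emeasure_distr) auto
  also have "emeasure M ((\<lambda>\<omega>. X r \<omega> - X s \<omega>) -` B \<inter> space M) = emeasure (distr M borel (\<lambda>\<omega>. X r \<omega> - X s \<omega>)) B"
    using B by (subst emeasure_distr) auto
  finally show "emeasure (distr M (F s) (\<lambda>\<omega>. \<omega>)) A * emeasure (distr M borel (\<lambda>\<omega>. X r \<omega> - X s \<omega>)) B = emeasure (distr M (F s \<Otimes>\<^sub>M borel) (\<lambda>\<omega>. (\<omega>, X r \<omega> - X s \<omega>))) (A \<times> B)" ..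
qed

lemma P_measurable [measurable (raw)]:
  assumes [measurable]: "(\<lambda>(w, z). f w z) \<in> borel_measurable (K \<Otimes>\<^sub>M borel)" "a \<in> borel_measurable K" "b \<in> borel_measurable K"
  shows "(\<lambda>w. P (a w) (f w) (b w)) \<in> borel_measurable K"
  unfolding P_def by measurable

text \<open>X r is X s plus an increment independent of the past. Integrating over the increment
  first turns h into \<open>P (r - s) h\<close> evaluated at X s.\<close>

lemma markov:
  assumes sr: "0 \<le> s" "s < r" and g: "g \<in> borel_measurable (F s)" and h[measurable]: "h \<in> borel_measurable borel"
  shows "(\<integral>\<^sup>+\<omega>. g \<omega> * h (X r \<omega>) \<partial>M) = (\<integral>\<^sup>+\<omega>. g \<omega> * P (r - s) h (X s \<omega>) \<partial>M)"
proof -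
  let ?D = "\<lambda>\<omega>. X r \<omega> - X s \<omega>"
  note idm = id_measurable_F[of s]
  have Dm: "?D \<in> borel_measurable M" by measurable
  have Xs[measurable]: "X s \<in> borel_measurable (F s)" using sr by (intro X_measurable_F) auto
  note g[measurable]
  have km: "(\<lambda>(\<omega>, y). g \<omega> * h (X s \<omega> + y)) \<in> borel_measurable (F s \<Otimes>\<^sub>M borel)" by measurable
  interpret D: prob_space "distr M borel ?D" by (rule prob_space_distr[OF Dm])
  have dd: "distr M borel ?D = density lborel (\<lambda>y. ennreal (heat \<alpha> (r - s) y))"
  proof -
    have "distr M lborel ?D = density lborel (\<lambda>y. ennreal (heat \<alpha> (r - s) y))"
      using stable_process_increment[OF SP sr] by (simp add: distributed_def)
    moreover have "distr M borel ?D = distr M lborel ?D" by (rule distr_cong) auto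
    ultimately show ?thesis by simp
  qed
  have "(\<integral>\<^sup>+\<omega>. g \<omega> * h (X r \<omega>) \<partial>M) = (\<integral>\<^sup>+\<omega>. (\<lambda>(\<omega>, y). g \<omega> * h (X s \<omega> + y)) (\<omega>, ?D \<omega>) \<partial>M)"
    by simp
  also have "\<dots> = (\<integral>\<^sup>+p. (\<lambda>(\<omega>, y). g \<omega> * h (X s \<omega> + y)) p \<partial>distr M (F s \<Otimes>\<^sub>M borel) (\<lambda>\<omega>. (\<omega>, ?D \<omega>)))"
    using km idm Dm by (subst nn_integral_distr) auto
  also have "distr M (F s \<Otimes>\<^sub>M borel) (\<lambda>\<omega>. (\<omega>, ?D \<omega>)) = distr M (F s) (\<lambda>\<omega>. \<omega>) \<Otimes>\<^sub>M distr M borel ?D"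
    by (rule F_increment_product[OF sr, symmetric])
  also have "(\<integral>\<^sup>+p. (\<lambda>(\<omega>, y). g \<omega> * h (X s \<omega> + y)) p \<partial>(distr M (F s) (\<lambda>\<omega>. \<omega>) \<Otimes>\<^sub>M distr M borel ?D)) =
     (\<integral>\<^sup>+\<omega>. (\<integral>\<^sup>+y. g \<omega> * h (X s \<omega> + y) \<partial>distr M borel ?D) \<partial>distr M (F s) (\<lambda>\<omega>. \<omega>))"
    by (subst D.nn_integral_fst[symmetric]) (use km in \<open>auto simp: measurable_cong_sets[OF sets_pair_measure_cong[OF sets_distr sets_distr] refl]\<close>)
  also have "\<dots> = (\<integral>\<^sup>+\<omega>. g \<omega> * P (r - s) h (X s \<omega>) \<partial>distr M (F s) (\<lambda>\<omega>. \<omega>))"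
  proof (intro nn_integral_cong)
    fix \<omega>
    show "(\<integral>\<^sup>+y. g \<omega> * h (X s \<omega> + y) \<partial>distr M borel ?D) = g \<omega> * P (r - s) h (X s \<omega>)"
      unfolding dd P_def
      by (subst nn_integral_density, measurable, subst nn_integral_cmult[symmetric], measurable) (simp add: mult_ac)
  qed
  also have "\<dots> = (\<integral>\<^sup>+\<omega>. g \<omega> * P (r - s) h (X s \<omega>) \<partial>M)"
    by (subst nn_integral_distr[OF idm]) measurable
  finally show ?thesis .
qed

lemma P_expectation:
  assumes t: "t > 0" and [measurable]: "h \<in> borel_measurable borel"
  shows "(\<integral>\<^sup>+\<omega>. h (X t \<omega>) \<partial>M) = P t h x0"
proof -
  have "(\<integral>\<^sup>+\<omega>. 1 * h (X t \<omega>) \<partial>M) = (\<integral>\<^sup>+\<omega>. 1 * P (t - 0) h (X 0 \<omega>) \<partial>M)"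
    by (rule markov) (use t in auto)
  also have "\<dots> = (\<integral>\<^sup>+\<omega>. P t h x0 \<partial>M)"
    by (intro nn_integral_cong_AE, use X0 in eventually_elim) simp
  finally show ?thesis by (simp add: emeasure_space_1)
qed

text \<open>The Markov property at time s, compared with the direct expectation at time s + r. The
  identity is obtained at the starting point, which is arbitrary once a process is given for each
  start.\<close>

lemma P_semigroup_start:
  assumes s: "s > 0" and r: "r > 0" and [measurable]: "h \<in> borel_measurable borel"
  shows "P s (P r h) x0 = P (s + r) h x0"
proof -
  have "P (s + r) h x0 = (\<integral>\<^sup>+\<omega>. 1 * h (X (s + r) \<omega>) \<partial>M)"
    using P_expectation[of "s + r" h] s r by simp
  also have "\<dots> = (\<integral>\<^sup>+\<omega>. 1 * P (s + r - s) h (X s \<omega>) \<partial>M)"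
    by (rule markov) (use s r in auto)
  also have "\<dots> = P s (P r h) x0"
    using P_expectation[OF s, of "P r h"] by simp
  finally show ?thesis ..
qed

end

section \<open>Superharmonicity of the power function\<close>

definition tint :: "(real \<Rightarrow> ennreal) \<Rightarrow> real \<Rightarrow> real \<Rightarrow> ennreal" where
  "tint w s t = (\<integral>\<^sup>+r. indicator {s<..<t} r * w r \<partial>lborel)"

lemma indicator_Ioo_measurable [measurable (raw)]:
  fixes a b c :: "'a \<Rightarrow> real"
  assumes [measurable]: "a \<in> borel_measurable M" "b \<in> borel_measurable M" "c \<in> borel_measurable M"
  shows "(\<lambda>w. indicator {a w<..<b w} (c w) :: ennreal) \<in> borel_measurable M"
proof -
  have "(\<lambda>w. indicator {a w<..<b w} (c w) :: ennreal) = (\<lambda>w. if a w < c w \<and> c w < b w then 1 else 0)"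
    by (auto simp: fun_eq_iff indicator_def)
  also have "\<dots> \<in> borel_measurable M" by measurable
  finally show ?thesis .
qed

lemma tint_measurable [measurable (raw)]:
  assumes [measurable]: "(\<lambda>(x, r). w x r) \<in> borel_measurable (M \<Otimes>\<^sub>M borel)" "a \<in> borel_measurable M" "b \<in> borel_measurable M"
  shows "(\<lambda>x. tint (w x) (a x) (b x)) \<in> borel_measurable M"
  unfolding tint_def by measurable

lemma tint_split:
  assumes [measurable]: "w \<in> borel_measurable borel" and v: "s < v" "v < t"
  shows "tint w s v + tint w v t = tint w s t"
proof -
  have "tint w s v + tint w v t = (\<integral>\<^sup>+r. indicator {s<..<v} r * w r + indicator {v<..<t} r * w r \<partial>lborel)"
    unfolding tint_def by (rule nn_integral_add[symmetric]) measurable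
  also have "\<dots> = tint w s t"
    unfolding tint_def
    by (intro nn_integral_cong_AE, use AE_lborel_singleton[of v] in eventually_elim) (use v in \<open>auto simp: indicator_def\<close>)
  finally show ?thesis .
qed

text \<open>Tonelli's theorem replaces integration by parts, which is not available for measurable \<open>w\<close>:
  with \<open>L\<close> the integral for \<open>k + 1\<close>, the additivity of \<open>tint\<close> gives \<open>L + (k + 1) L = (tint w s t)\<^sup>k\<^sup>+\<^sup>2\<close>.\<close>
lemma tint_power:
  assumes [measurable]: "w \<in> borel_measurable borel"
  shows "of_nat (Suc k) * (\<integral>\<^sup>+r. indicator {s<..<t} r * (w r * tint w r t ^ k) \<partial>lborel) = tint w s t ^ Suc k"
proof (induction k arbitrary: s)
  case 0
  then show ?case by (simp add: tint_def)
next
  case (Suc k)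
  define L where "L = (\<integral>\<^sup>+r. indicator {s<..<t} r * (w r * tint w r t ^ Suc k) \<partial>lborel)"
  let ?n = "of_nat (Suc k) :: ennreal"
  have "L = (\<integral>\<^sup>+r. \<integral>\<^sup>+v. ?n * (indicator {s<..<t} v * (w v * tint w v t ^ k)) * (indicator {s<..<v} r * w r) \<partial>lborel \<partial>lborel)"
    unfolding L_def
  proof (intro nn_integral_cong)
    fix r
    have "indicator {s<..<t} r * (w r * tint w r t ^ Suc k) = indicator {s<..<t} r * w r * (?n * (\<integral>\<^sup>+v. indicator {r<..<t} v * (w v * tint w v t ^ k) \<partial>lborel))"
      by (subst Suc.IH) (simp add: mult.assoc)
    also have "\<dots> = (\<integral>\<^sup>+v. indicator {s<..<t} r * w r * (?n * (indicator {r<..<t} v * (w v * tint w v t ^ k))) \<partial>lborel)"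
      by (simp add: nn_integral_cmult del: of_nat_Suc)
    also have "\<dots> = (\<integral>\<^sup>+v. ?n * (indicator {s<..<t} v * (w v * tint w v t ^ k)) * (indicator {s<..<v} r * w r) \<partial>lborel)"
      by (intro nn_integral_cong) (auto simp: indicator_def mult_ac)
    finally show "indicator {s<..<t} r * (w r * tint w r t ^ Suc k) = (\<integral>\<^sup>+v. ?n * (indicator {s<..<t} v * (w v * tint w v t ^ k)) * (indicator {s<..<v} r * w r) \<partial>lborel)" .
  qed
  also have "\<dots> = (\<integral>\<^sup>+v. \<integral>\<^sup>+r. ?n * (indicator {s<..<t} v * (w v * tint w v t ^ k)) * (indicator {s<..<v} r * w r) \<partial>lborel \<partial>lborel)"
    by (rule lborel_pair.Fubini') measurable
  also have "\<dots> = (\<integral>\<^sup>+v. ?n * (indicator {s<..<t} v * (w v * tint w v t ^ k)) * tint w s v \<partial>lborel)"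
    by (intro nn_integral_cong, subst nn_integral_cmult) (auto simp: tint_def)
  finally have L1: "L = (\<integral>\<^sup>+v. ?n * (indicator {s<..<t} v * (w v * tint w v t ^ k)) * tint w s v \<partial>lborel)" .
  have L2: "?n * L = (\<integral>\<^sup>+v. ?n * (indicator {s<..<t} v * (w v * tint w v t ^ k)) * tint w v t \<partial>lborel)"
    unfolding L_def by (subst nn_integral_cmult[symmetric], measurable) (simp add: mult_ac)
  have "of_nat (Suc (Suc k)) * L = L + ?n * L" by (simp add: distrib_right)
  also have "\<dots> = (\<integral>\<^sup>+v. ?n * (indicator {s<..<t} v * (w v * tint w v t ^ k)) * tint w s v + ?n * (indicator {s<..<t} v * (w v * tint w v t ^ k)) * tint w v t \<partial>lborel)"
    unfolding L2 by (subst (1) L1, rule nn_integral_add[symmetric]) measurable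
  also have "\<dots> = (\<integral>\<^sup>+v. tint w s t * (?n * (indicator {s<..<t} v * (w v * tint w v t ^ k))) \<partial>lborel)"
  proof (intro nn_integral_cong)
    fix v
    show "?n * (indicator {s<..<t} v * (w v * tint w v t ^ k)) * tint w s v + ?n * (indicator {s<..<t} v * (w v * tint w v t ^ k)) * tint w v t = tint w s t * (?n * (indicator {s<..<t} v * (w v * tint w v t ^ k)))"
    proof (cases "v \<in> {s<..<t}")
      case True
      then have "tint w s t = tint w s v + tint w v t" by (intro tint_split[symmetric]) auto
      then show ?thesis by (simp only: distrib_right distrib_left mult_ac)
    qed simp
  qed
  also have "\<dots> = tint w s t * tint w s t ^ Suc k"
    unfolding Suc.IH[symmetric]
    by (subst nn_integral_cmult, measurable, subst nn_integral_cmult, measurable)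
  finally show ?case unfolding L_def by simp
qed

section \<open>Truncated exponentials of additive functionals\<close>

definition expN :: "nat \<Rightarrow> ennreal \<Rightarrow> ennreal" where
  "expN n v = (\<Sum>k\<le>n. ennreal (1 / fact k) * v ^ k)"

lemma expN_measurable [measurable]: "expN n \<in> borel_measurable borel"
  unfolding expN_def by measurable

text \<open>A Volterra equation, obtained from \<open>tint_power\<close> term by term: degree n + 1
  on (s, t) is expressed by degree n on the shorter intervals (r, t). It drives the induction in
  \<open>perturbation_bound\<close>.\<close>

lemma expN_Suc_tint:
  assumes [measurable]: "w \<in> borel_measurable borel"
  shows "expN (Suc n) (tint w s t) = 1 + (\<integral>\<^sup>+r. indicator {s<..<t} r * (w r * expN n (tint w r t)) \<partial>lborel)"
proof -
  have "expN (Suc n) (tint w s t) = 1 + (\<Sum>k\<le>n. ennreal (1 / fact (Suc k)) * tint w s t ^ Suc k)"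
    unfolding expN_def by (subst sum.atMost_Suc_shift) simp
  also have "(\<Sum>k\<le>n. ennreal (1 / fact (Suc k)) * tint w s t ^ Suc k) = (\<Sum>k\<le>n. (\<integral>\<^sup>+r. ennreal (1 / fact k) * (indicator {s<..<t} r * (w r * tint w r t ^ k)) \<partial>lborel))"
  proof (intro sum.cong refl)
    fix k
    have c: "ennreal (1 / fact (Suc k)) * of_nat (Suc k) = ennreal (1 / fact k)"
      by (subst ennreal_of_nat_eq_real_of_nat, subst ennreal_mult[symmetric]) (auto simp del: of_nat_Suc)
    have "ennreal (1 / fact (Suc k)) * tint w s t ^ Suc k = ennreal (1 / fact k) * (\<integral>\<^sup>+r. indicator {s<..<t} r * (w r * tint w r t ^ k) \<partial>lborel)"
      unfolding tint_power[OF assms, symmetric] c[symmetric] by (simp only: mult.assoc)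
    also have "\<dots> = (\<integral>\<^sup>+r. ennreal (1 / fact k) * (indicator {s<..<t} r * (w r * tint w r t ^ k)) \<partial>lborel)"
      by (rule nn_integral_cmult[symmetric]) measurable
    finally show "ennreal (1 / fact (Suc k)) * tint w s t ^ Suc k = (\<integral>\<^sup>+r. ennreal (1 / fact k) * (indicator {s<..<t} r * (w r * tint w r t ^ k)) \<partial>lborel)" .
  qed
  also have "\<dots> = (\<integral>\<^sup>+r. (\<Sum>k\<le>n. ennreal (1 / fact k) * (indicator {s<..<t} r * (w r * tint w r t ^ k))) \<partial>lborel)"
    by (rule nn_integral_sum[symmetric]) measurable
  also have "\<dots> = (\<integral>\<^sup>+r. indicator {s<..<t} r * (w r * expN n (tint w r t)) \<partial>lborel)"
    unfolding expN_def sum_distrib_left by (intro nn_integral_cong sum.cong refl) (simp only: mult_ac)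
  finally show ?thesis .
qed

lemma expN_mono: "m \<le> n \<Longrightarrow> expN m v \<le> expN n v"
  unfolding expN_def by (intro sum_mono2) auto

lemma SUP_expN:
  assumes a: "a \<ge> 0"
  shows "(SUP n. expN n (ennreal a)) = ennreal (exp a)"
proof (rule LIMSEQ_unique)
  show "(\<lambda>n. expN n (ennreal a)) \<longlonglongrightarrow> (SUP n. expN n (ennreal a))"
    by (intro LIMSEQ_SUP incseq_SucI expN_mono) auto
  have "expN n (ennreal a) = ennreal (\<Sum>k\<le>n. a ^ k /\<^sub>R fact k)" for n
  proof -
    have "expN n (ennreal a) = (\<Sum>k\<le>n. ennreal (a ^ k /\<^sub>R fact k))"
      unfolding expN_def using a by (intro sum.cong) (auto simp: ennreal_power ennreal_mult[symmetric] divide_inverse)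
    then show ?thesis using a by (simp add: sum_ennreal)
  qed
  moreover have "(\<lambda>n. \<Sum>k\<le>n. a ^ k /\<^sub>R fact k) \<longlonglongrightarrow> exp a"
    using exp_converges[of a] by (simp only: sums_def_le)
  ultimately show "(\<lambda>n. expN n (ennreal a)) \<longlonglongrightarrow> ennreal (exp a)"
    using a by simp
qed

lemma nn_integral_exp_reversed:
  fixes c \<tau> r :: real
  assumes c: "c > 0" and r: "r \<le> \<tau>"
  shows "(\<integral>\<^sup>+s. indicator {r<..<\<tau>} s * ennreal (c * exp (c * (\<tau> - s))) \<partial>lborel) = ennreal (exp (c * (\<tau> - r)) - 1)"
proof -
  have "(\<integral>\<^sup>+s. indicator {r<..<\<tau>} s * ennreal (c * exp (c * (\<tau> - s))) \<partial>lborel) = (\<integral>\<^sup>+s. ennreal (c * exp (c * (\<tau> - s))) * indicator {r..\<tau>} s \<partial>lborel)"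
    by (intro nn_integral_cong_AE, use AE_lborel_singleton[of r] AE_lborel_singleton[of \<tau>] in eventually_elim) (auto simp: indicator_def)
  also have "\<dots> = ennreal ((- exp (c * (\<tau> - \<tau>))) - (- exp (c * (\<tau> - r))))"
    by (rule nn_integral_FTC_Icc) (use c r in \<open>auto intro!: derivative_eq_intros\<close>)
  finally show ?thesis by simp
qed

text \<open>\<open>semigroup\<close> is required at every point z, whereas M and X realise the
  process from x0 only; it is supplied by \<open>P_semigroup_start\<close> for the process started
  at z.\<close>

locale hardy_semigroup = hardy_process \<alpha> N \<delta> M X x0
  for \<alpha> :: real and N :: "'n::finite itself" and \<delta> and M :: "'a measure" and X :: "real \<Rightarrow> 'a \<Rightarrow> real^'n" and x0 +
  assumes semigroup: "\<And>s r f z. s > 0 \<Longrightarrow> r > 0 \<Longrightarrow> f \<in> borel_measurable borel \<Longrightarrow> P s (P r f) z = P (s + r) f z"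
begin

text \<open>Formally \<open>G\<close> solves \<open>\<partial>\<^sub>\<tau> G = \<Delta>\<^sup>\<alpha>\<^sup>/\<^sup>2 G - V\<^sub>c u\<close> and \<open>G \<ge> u\<close>, so \<open>H\<close> is a supersolution of the equation with
  the potential \<open>c - V\<^sub>c\<close>. This potential is nonnegative, which keeps the perturbation series monotone.\<close>
definition V :: "real^'n \<Rightarrow> real" where "V z = vk * norm z powr (- \<alpha>)"
definition u :: "real^'n \<Rightarrow> real" where "u z = norm z powr \<delta>"
definition Vc :: "real \<Rightarrow> real^'n \<Rightarrow> real" where "Vc c z = min (V z) c"
definition G :: "real \<Rightarrow> real \<Rightarrow> real^'n \<Rightarrow> ennreal" where
  "G c \<tau> z = ennreal (u z) + (\<integral>\<^sup>+s. indicator {0<..<\<tau>} s * P s (\<lambda>z. ennreal ((V z - Vc c z) * u z)) z \<partial>lborel)"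
definition H :: "real \<Rightarrow> real \<Rightarrow> real^'n \<Rightarrow> ennreal" where
  "H c \<tau> z = ennreal (exp (c * \<tau>)) * G c \<tau> z"

lemma V_measurable [measurable]: "V \<in> borel_measurable borel" unfolding V_def by measurable
lemma u_measurable [measurable]: "u \<in> borel_measurable borel" unfolding u_def by measurable
lemma Vc_measurable [measurable]: "Vc c \<in> borel_measurable borel" unfolding Vc_def by measurable

lemma G_measurable [measurable (raw)]:
  assumes [measurable]: "f \<in> borel_measurable K" "g \<in> borel_measurable K"
  shows "(\<lambda>w. G c (f w) (g w)) \<in> borel_measurable K"
  unfolding G_def by measurable

lemma H_measurable [measurable (raw)]:
  assumes [measurable]: "f \<in> borel_measurable K" "g \<in> borel_measurable K"
  shows "(\<lambda>w. H c (f w) (g w)) \<in> borel_measurable K"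
  unfolding H_def by measurable

lemma V_nonneg: "0 \<le> V z" using vk_pos by (simp add: V_def)
lemma u_nonneg: "0 \<le> u z" by (simp add: u_def)
lemma Vc_bounds: "c \<ge> 0 \<Longrightarrow> 0 \<le> Vc c z" "Vc c z \<le> V z" "Vc c z \<le> c"
  using V_nonneg[of z] by (auto simp: Vc_def)

lemma Vu: "V z * u z = vk * norm z powr (\<delta> - \<alpha>)"
  unfolding V_def u_def by (simp add: powr_add[symmetric] add.commute)

section \<open>A supersolution for the truncated potential\<close>

lemma P_add:
  assumes [measurable]: "f \<in> borel_measurable borel" "g \<in> borel_measurable borel"
  shows "P s (\<lambda>z. f z + g z) x = P s f x + P s g x"
  unfolding P_def distrib_right by (rule nn_integral_add) measurable

lemma P_cmult:
  assumes [measurable]: "f \<in> borel_measurable borel"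
  shows "P s (\<lambda>z. c * f z) x = c * P s f x"
  unfolding P_def mult.assoc by (rule nn_integral_cmult) measurable

lemma P_mono: "(\<And>z. f z \<le> g z) \<Longrightarrow> P s f x \<le> P s g x"
  unfolding P_def by (intro nn_integral_mono mult_right_mono) auto

text \<open>\<open>P_powr_delta\<close> with V u split into (V - Vc) u, which enters
  \<open>G\<close>, and Vc u, which stays as a source term. Finiteness of the \<delta>-moment on the
  left makes both integrals finite.\<close>

lemma P_u:
  assumes c: "c \<ge> 0" and t: "\<tau> > 0"
  shows "P \<tau> (\<lambda>z. ennreal (u z)) x = G c \<tau> x + (\<integral>\<^sup>+s. indicator {0<..<\<tau>} s * P s (\<lambda>z. ennreal (Vc c z * u z)) x \<partial>lborel)"
    and "(\<integral>\<^sup>+s. indicator {0<..<\<tau>} s * P s (\<lambda>z. ennreal (Vc c z * u z)) x \<partial>lborel) < \<infinity>"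
    and "(\<integral>\<^sup>+s. indicator {0<..<\<tau>} s * P s (\<lambda>z. ennreal (V z * u z)) x \<partial>lborel) < \<infinity>"
proof -
  have *: "P s (\<lambda>z. ennreal (vk * norm z powr (\<delta> - \<alpha>))) x = P s (\<lambda>z. ennreal ((V z - Vc c z) * u z)) x + P s (\<lambda>z. ennreal (Vc c z * u z)) x" for s
  proof -
    have "P s (\<lambda>z. ennreal (vk * norm z powr (\<delta> - \<alpha>))) x = P s (\<lambda>z. ennreal ((V z - Vc c z) * u z) + ennreal (Vc c z * u z)) x"
      unfolding Vu[symmetric] using Vc_bounds(1)[OF c] Vc_bounds(2,3) u_nonneg
      by (intro arg_cong2[where f="P s"] ext refl) (subst ennreal_plus[symmetric], auto simp: algebra_simps mult_mono intro!: mult_right_mono)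
    then show ?thesis by (subst (asm) P_add) auto
  qed
  have eq: "P \<tau> (\<lambda>z. ennreal (u z)) x = ennreal (u x) + (\<integral>\<^sup>+s. indicator {0<..<\<tau>} s * P s (\<lambda>z. ennreal (vk * norm z powr (\<delta> - \<alpha>))) x \<partial>lborel)"
    unfolding u_def by (rule P_powr_delta(1)[OF t])
  also have "(\<integral>\<^sup>+s. indicator {0<..<\<tau>} s * P s (\<lambda>z. ennreal (vk * norm z powr (\<delta> - \<alpha>))) x \<partial>lborel) =
     (\<integral>\<^sup>+s. indicator {0<..<\<tau>} s * P s (\<lambda>z. ennreal ((V z - Vc c z) * u z)) x \<partial>lborel) + (\<integral>\<^sup>+s. indicator {0<..<\<tau>} s * P s (\<lambda>z. ennreal (Vc c z * u z)) x \<partial>lborel)"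
    unfolding * distrib_left by (rule nn_integral_add) measurable
  finally show 1: "P \<tau> (\<lambda>z. ennreal (u z)) x = G c \<tau> x + (\<integral>\<^sup>+s. indicator {0<..<\<tau>} s * P s (\<lambda>z. ennreal (Vc c z * u z)) x \<partial>lborel)"
    unfolding G_def by (simp only: add.assoc)
  have fin: "P \<tau> (\<lambda>z. ennreal (u z)) x < \<infinity>" unfolding u_def by (rule P_powr_delta(2)[OF t])
  show "(\<integral>\<^sup>+s. indicator {0<..<\<tau>} s * P s (\<lambda>z. ennreal (Vc c z * u z)) x \<partial>lborel) < \<infinity>"
    using fin unfolding 1 by simp
  show "(\<integral>\<^sup>+s. indicator {0<..<\<tau>} s * P s (\<lambda>z. ennreal (V z * u z)) x \<partial>lborel) < \<infinity>"
    using fin unfolding eq Vu by simp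
qed

lemma G_ge: "ennreal (u z) \<le> G c \<tau> z"
  unfolding G_def by simp

text \<open>The semigroup law shifts the time integral inside G to (s, \<tau>), while
  \<open>P_u\<close> applied to u restores the part over (0, s). The surplus is the source term with
  Vc u.\<close>

lemma P_G:
  assumes c: "c \<ge> 0" and s: "0 < s" "s < \<tau>"
  shows "P s (G c (\<tau> - s)) z = G c \<tau> z + (\<integral>\<^sup>+r. indicator {0<..<s} r * P r (\<lambda>z. ennreal (Vc c z * u z)) z \<partial>lborel)"
proof -
  define g where "g z = ennreal ((V z - Vc c z) * u z)" for z
  have [measurable]: "g \<in> borel_measurable borel" unfolding g_def by measurable
  have G: "G c \<tau> z = ennreal (u z) + tint (\<lambda>s. P s g z) 0 \<tau>" for \<tau> z
    unfolding G_def tint_def g_def ..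
  have "P s (G c (\<tau> - s)) z = P s (\<lambda>z. ennreal (u z) + tint (\<lambda>r. P r g z) 0 (\<tau> - s)) z"
    unfolding G[abs_def] ..
  also have "\<dots> = P s (\<lambda>z. ennreal (u z)) z + P s (\<lambda>z. tint (\<lambda>r. P r g z) 0 (\<tau> - s)) z"
    by (rule P_add) measurable
  also have "P s (\<lambda>z. tint (\<lambda>r. P r g z) 0 (\<tau> - s)) z = (\<integral>\<^sup>+y. \<integral>\<^sup>+r. indicator {0<..<\<tau> - s} r * (P r g (z + y) * ennreal (heat \<alpha> s y)) \<partial>lborel \<partial>lborel)"
    unfolding P_def[of s] tint_def
    by (intro nn_integral_cong, subst nn_integral_multc[symmetric]) (auto simp: mult.assoc)
  also have "\<dots> = (\<integral>\<^sup>+r. \<integral>\<^sup>+y. indicator {0<..<\<tau> - s} r * (P r g (z + y) * ennreal (heat \<alpha> s y)) \<partial>lborel \<partial>lborel)"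
    by (rule lborel_pair.Fubini') measurable
  also have "\<dots> = (\<integral>\<^sup>+r. indicator {0<..<\<tau> - s} r * P s (P r g) z \<partial>lborel)"
    unfolding P_def[of s] by (intro nn_integral_cong nn_integral_cmult) measurable
  also have "\<dots> = (\<integral>\<^sup>+r. indicator {s<..<\<tau>} (s + r) * P (s + r) g z \<partial>lborel)"
    using s by (intro nn_integral_cong) (auto simp: indicator_def semigroup)
  also have "\<dots> = tint (\<lambda>r. P r g z) s \<tau>"
    unfolding tint_def by (rule nn_integral_translation) measurable
  also have "P s (\<lambda>z. ennreal (u z)) z = G c s z + (\<integral>\<^sup>+r. indicator {0<..<s} r * P r (\<lambda>z. ennreal (Vc c z * u z)) z \<partial>lborel)"
    by (rule P_u(1)[OF c s(1)])
  also have "G c s z = ennreal (u z) + tint (\<lambda>r. P r g z) 0 s" by (rule G)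
  also have "ennreal (u z) + tint (\<lambda>r. P r g z) 0 s + (\<integral>\<^sup>+r. indicator {0<..<s} r * P r (\<lambda>z. ennreal (Vc c z * u z)) z \<partial>lborel) + tint (\<lambda>r. P r g z) s \<tau>
      = ennreal (u z) + (tint (\<lambda>r. P r g z) 0 s + tint (\<lambda>r. P r g z) s \<tau>) + (\<integral>\<^sup>+r. indicator {0<..<s} r * P r (\<lambda>z. ennreal (Vc c z * u z)) z \<partial>lborel)"
    by (simp only: add_ac)
  also have "tint (\<lambda>r. P r g z) 0 s + tint (\<lambda>r. P r g z) s \<tau> = tint (\<lambda>r. P r g z) 0 \<tau>"
    by (rule tint_split) (use s in measurable)
  finally show ?thesis unfolding G .
qed

text \<open>From u <= G and 0 <= Vc <= c follows (c - Vc) G + Vc u <= c G pointwise. After applying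
  \<open>P_G\<close>, only time integrals of c exp (c (\<tau> - s)) have to be evaluated.\<close>

lemma supersolution:
  assumes c: "c > 0" and \<tau>: "\<tau> > 0"
  shows "P \<tau> (\<lambda>z. ennreal (u z)) x + (\<integral>\<^sup>+s. indicator {0<..<\<tau>} s * P s (\<lambda>z. ennreal (c - Vc c z) * H c (\<tau> - s) z) x \<partial>lborel) \<le> H c \<tau> x"
proof -
  define vu where "vu s = P s (\<lambda>z. ennreal (Vc c z * u z)) x" for s
  have [measurable]: "vu \<in> borel_measurable borel" unfolding vu_def by measurable
  have c0: "c \<ge> 0" using c by simp
  define a where "a = (\<integral>\<^sup>+s. indicator {0<..<\<tau>} s * P s (\<lambda>z. ennreal (c - Vc c z) * H c (\<tau> - s) z) x \<partial>lborel)"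
  \<comment> \<open>The source term weighted by exp (c (\<tau> - s)). It is carried along on both
    sides because subtraction is unsafe for extended values; \<open>bfin\<close> allows its
    cancellation at the end.\<close>
  define b where "b = (\<integral>\<^sup>+s. indicator {0<..<\<tau>} s * (ennreal (exp (c * (\<tau> - s))) * vu s) \<partial>lborel)"
  have tvu: "tint vu 0 \<tau> < \<infinity>" using P_u(2)[OF c0 \<tau>] by (simp add: tint_def vu_def)
  have bfin: "b < \<infinity>"
  proof -
    have "b \<le> (\<integral>\<^sup>+s. ennreal (exp (c * \<tau>)) * (indicator {0<..<\<tau>} s * vu s) \<partial>lborel)"
      unfolding b_def using c by (intro nn_integral_mono) (auto simp: indicator_def intro!: mult_right_mono ennreal_leI)
    also have "\<dots> = ennreal (exp (c * \<tau>)) * tint vu 0 \<tau>"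
      unfolding tint_def by (rule nn_integral_cmult) measurable
    also have "\<dots> < \<infinity>" using tvu by (simp add: ennreal_mult_less_top)
    finally show ?thesis .
  qed
  have pt: "ennreal (c - Vc c z) * H c (\<tau> - s) z + ennreal (exp (c * (\<tau> - s))) * ennreal (Vc c z * u z) \<le> ennreal (c * exp (c * (\<tau> - s))) * G c (\<tau> - s) z" for s z
  proof -
    have "ennreal (c - Vc c z) * G c (\<tau> - s) z + ennreal (Vc c z * u z) \<le> ennreal (c - Vc c z) * G c (\<tau> - s) z + ennreal (Vc c z) * G c (\<tau> - s) z"
      using Vc_bounds(1)[OF c0] Vc_bounds(2,3) u_nonneg by (intro add_mono order_refl, subst ennreal_mult) (auto intro!: mult_left_mono G_ge)
    also have "\<dots> = ennreal c * G c (\<tau> - s) z"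
      using Vc_bounds(1)[OF c0, of z] Vc_bounds(2,3)[of c z] by (subst distrib_right[symmetric], subst ennreal_plus[symmetric]) auto
    finally have "ennreal (exp (c * (\<tau> - s))) * (ennreal (c - Vc c z) * G c (\<tau> - s) z + ennreal (Vc c z * u z)) \<le> ennreal (exp (c * (\<tau> - s))) * (ennreal c * G c (\<tau> - s) z)"
      by (intro mult_left_mono) auto
    then show ?thesis unfolding H_def using c by (simp add: distrib_left ennreal_mult mult_ac)
  qed
  have ab: "P s (\<lambda>z. ennreal (c - Vc c z) * H c (\<tau> - s) z) x + ennreal (exp (c * (\<tau> - s))) * vu s \<le> ennreal (c * exp (c * (\<tau> - s))) * (G c \<tau> x + tint vu 0 s)"
    if s: "0 < s" "s < \<tau>" for s
  proof -
    have "P s (\<lambda>z. ennreal (c - Vc c z) * H c (\<tau> - s) z) x + ennreal (exp (c * (\<tau> - s))) * vu s =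
       P s (\<lambda>z. ennreal (c - Vc c z) * H c (\<tau> - s) z + ennreal (exp (c * (\<tau> - s))) * ennreal (Vc c z * u z)) x"
      unfolding vu_def by (subst P_add, measurable, subst P_cmult, measurable)
    also have "\<dots> \<le> P s (\<lambda>z. ennreal (c * exp (c * (\<tau> - s))) * G c (\<tau> - s) z) x"
      by (intro P_mono pt)
    also have "\<dots> = ennreal (c * exp (c * (\<tau> - s))) * P s (G c (\<tau> - s)) x"
      by (rule P_cmult) measurable
    also have "P s (G c (\<tau> - s)) x = G c \<tau> x + tint vu 0 s"
      unfolding P_G[OF c0 s] tint_def vu_def ..
    finally show ?thesis .
  qed
  have "a + b = (\<integral>\<^sup>+s. indicator {0<..<\<tau>} s * P s (\<lambda>z. ennreal (c - Vc c z) * H c (\<tau> - s) z) x + indicator {0<..<\<tau>} s * (ennreal (exp (c * (\<tau> - s))) * vu s) \<partial>lborel)"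
    unfolding a_def b_def by (rule nn_integral_add[symmetric]) measurable
  also have "\<dots> \<le> (\<integral>\<^sup>+s. indicator {0<..<\<tau>} s * ennreal (c * exp (c * (\<tau> - s))) * G c \<tau> x + indicator {0<..<\<tau>} s * ennreal (c * exp (c * (\<tau> - s))) * tint vu 0 s \<partial>lborel)"
    using ab by (intro nn_integral_mono) (auto simp: indicator_def distrib_left)
  also have "\<dots> = (\<integral>\<^sup>+s. indicator {0<..<\<tau>} s * ennreal (c * exp (c * (\<tau> - s))) * G c \<tau> x \<partial>lborel) + (\<integral>\<^sup>+s. indicator {0<..<\<tau>} s * ennreal (c * exp (c * (\<tau> - s))) * tint vu 0 s \<partial>lborel)"
    by (rule nn_integral_add) measurable
  also have "(\<integral>\<^sup>+s. indicator {0<..<\<tau>} s * ennreal (c * exp (c * (\<tau> - s))) * G c \<tau> x \<partial>lborel) = ennreal (exp (c * (\<tau> - 0)) - 1) * G c \<tau> x"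
    using \<tau> by (subst nn_integral_multc, measurable, subst nn_integral_exp_reversed[OF c]) auto
  \<comment> \<open>Tonelli over the triangle r < s < \<tau> again takes the place of an integration
    by parts.\<close>
  also have "(\<integral>\<^sup>+s. indicator {0<..<\<tau>} s * ennreal (c * exp (c * (\<tau> - s))) * tint vu 0 s \<partial>lborel) = 
      (\<integral>\<^sup>+s. \<integral>\<^sup>+r. (indicator {0<..<\<tau>} r * vu r) * (indicator {r<..<\<tau>} s * ennreal (c * exp (c * (\<tau> - s)))) \<partial>lborel \<partial>lborel)"
  proof (intro nn_integral_cong)
    fix s
    have "indicator {0<..<\<tau>} s * ennreal (c * exp (c * (\<tau> - s))) * tint vu 0 s = (\<integral>\<^sup>+r. indicator {0<..<\<tau>} s * ennreal (c * exp (c * (\<tau> - s))) * (indicator {0<..<s} r * vu r) \<partial>lborel)"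
      unfolding tint_def by (rule nn_integral_cmult[symmetric]) measurable
    also have "\<dots> = (\<integral>\<^sup>+r. (indicator {0<..<\<tau>} r * vu r) * (indicator {r<..<\<tau>} s * ennreal (c * exp (c * (\<tau> - s)))) \<partial>lborel)"
      by (intro nn_integral_cong) (auto simp: indicator_def mult_ac)
    finally show "indicator {0<..<\<tau>} s * ennreal (c * exp (c * (\<tau> - s))) * tint vu 0 s = (\<integral>\<^sup>+r. (indicator {0<..<\<tau>} r * vu r) * (indicator {r<..<\<tau>} s * ennreal (c * exp (c * (\<tau> - s)))) \<partial>lborel)" .
  qed
  also have "\<dots> = (\<integral>\<^sup>+r. \<integral>\<^sup>+s. (indicator {0<..<\<tau>} r * vu r) * (indicator {r<..<\<tau>} s * ennreal (c * exp (c * (\<tau> - s)))) \<partial>lborel \<partial>lborel)"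
    by (rule lborel_pair.Fubini') measurable
  also have "\<dots> = (\<integral>\<^sup>+r. indicator {0<..<\<tau>} r * (ennreal (exp (c * (\<tau> - r)) - 1) * vu r) \<partial>lborel)"
  proof (intro nn_integral_cong)
    fix r
    show "(\<integral>\<^sup>+s. (indicator {0<..<\<tau>} r * vu r) * (indicator {r<..<\<tau>} s * ennreal (c * exp (c * (\<tau> - s)))) \<partial>lborel) = indicator {0<..<\<tau>} r * (ennreal (exp (c * (\<tau> - r)) - 1) * vu r)"
    proof (cases "r \<in> {0<..<\<tau>}")
      case True
      then have "r \<le> \<tau>" by simp
      show ?thesis
        by (subst nn_integral_cmult, measurable, subst nn_integral_exp_reversed[OF c \<open>r \<le> \<tau>\<close>]) (simp add: mult_ac)
    qed simp
  qed
  finally have ab2: "a + b \<le> ennreal (exp (c * (\<tau> - 0)) - 1) * G c \<tau> x + (\<integral>\<^sup>+r. indicator {0<..<\<tau>} r * (ennreal (exp (c * (\<tau> - r)) - 1) * vu r) \<partial>lborel)" .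
  have Pu: "P \<tau> (\<lambda>z. ennreal (u z)) x = G c \<tau> x + tint vu 0 \<tau>"
    unfolding P_u(1)[OF c0 \<tau>] tint_def vu_def ..
  have "(P \<tau> (\<lambda>z. ennreal (u z)) x + a) + b \<le> (G c \<tau> x + tint vu 0 \<tau>) + (ennreal (exp (c * (\<tau> - 0)) - 1) * G c \<tau> x + (\<integral>\<^sup>+r. indicator {0<..<\<tau>} r * (ennreal (exp (c * (\<tau> - r)) - 1) * vu r) \<partial>lborel))"
    unfolding Pu add.assoc[of "G c \<tau> x + tint vu 0 \<tau>"] by (intro add_left_mono ab2)
  also have "\<dots> = (G c \<tau> x + ennreal (exp (c * (\<tau> - 0)) - 1) * G c \<tau> x) + (tint vu 0 \<tau> + (\<integral>\<^sup>+r. indicator {0<..<\<tau>} r * (ennreal (exp (c * (\<tau> - r)) - 1) * vu r) \<partial>lborel))"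
    by (simp only: add_ac)
  also have "G c \<tau> x + ennreal (exp (c * (\<tau> - 0)) - 1) * G c \<tau> x = H c \<tau> x"
  proof -
    have "G c \<tau> x + ennreal (exp (c * \<tau>) - 1) * G c \<tau> x = (ennreal 1 + ennreal (exp (c * \<tau>) - 1)) * G c \<tau> x"
      by (simp add: distrib_right)
    also have "ennreal 1 + ennreal (exp (c * \<tau>) - 1) = ennreal (exp (c * \<tau>))"
      using c \<tau> by (subst ennreal_plus[symmetric]) auto
    finally show ?thesis by (simp add: H_def)
  qed
  also have "tint vu 0 \<tau> + (\<integral>\<^sup>+r. indicator {0<..<\<tau>} r * (ennreal (exp (c * (\<tau> - r)) - 1) * vu r) \<partial>lborel) = b"
  proof -
    have "tint vu 0 \<tau> + (\<integral>\<^sup>+r. indicator {0<..<\<tau>} r * (ennreal (exp (c * (\<tau> - r)) - 1) * vu r) \<partial>lborel) = 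
       (\<integral>\<^sup>+r. indicator {0<..<\<tau>} r * vu r + indicator {0<..<\<tau>} r * (ennreal (exp (c * (\<tau> - r)) - 1) * vu r) \<partial>lborel)"
      unfolding tint_def by (rule nn_integral_add[symmetric]) measurable
    also have "\<dots> = b"
      unfolding b_def
    proof (intro nn_integral_cong)
      fix r
      show "indicator {0<..<\<tau>} r * vu r + indicator {0<..<\<tau>} r * (ennreal (exp (c * (\<tau> - r)) - 1) * vu r) = indicator {0<..<\<tau>} r * (ennreal (exp (c * (\<tau> - r))) * vu r)"
      proof (cases "r \<in> {0<..<\<tau>}")
        case True
        have "vu r + ennreal (exp (c * (\<tau> - r)) - 1) * vu r = (ennreal 1 + ennreal (exp (c * (\<tau> - r)) - 1)) * vu r"
          by (simp add: distrib_right)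
        also have "ennreal 1 + ennreal (exp (c * (\<tau> - r)) - 1) = ennreal (exp (c * (\<tau> - r)))"
          using c True by (subst ennreal_plus[symmetric]) auto
        finally show ?thesis using True by simp
      qed simp
    qed
    finally show ?thesis .
  qed
  finally have "b + (P \<tau> (\<lambda>z. ennreal (u z)) x + a) \<le> b + H c \<tau> x" by (simp only: add.commute)
  then have "P \<tau> (\<lambda>z. ennreal (u z)) x + a \<le> H c \<tau> x" using bfin by (auto simp: ennreal_add_left_cancel_le)
  then show ?thesis unfolding a_def .
qed

section \<open>The Feynman-Kac weight and the passage to the untruncated potential\<close>

definition Wf :: "real \<Rightarrow> real^'n \<Rightarrow> ennreal" where "Wf c z = ennreal (c - Vc c z)"

lemma Wf_measurable [measurable]: "Wf c \<in> borel_measurable borel" unfolding Wf_def by measurable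

abbreviation AA :: "real \<Rightarrow> real \<Rightarrow> real \<Rightarrow> 'a \<Rightarrow> ennreal" where
  "AA c s t \<omega> \<equiv> tint (\<lambda>r. Wf c (X r \<omega>)) s t"

lemma path_measurable: "\<omega> \<in> space M \<Longrightarrow> (\<lambda>r. X r \<omega>) \<in> borel_measurable borel"
  by measurable

text \<open>The paths are only jointly measurable, so the additive functional need not be adapted to \<open>F\<close>.
  Expanding its exponential reduces the claim to the Markov property at finitely many times.\<close>
lemma perturbation_bound:
  assumes c: "c > 0" and st: "0 \<le> s" "s < t" and g: "g \<in> borel_measurable (F s)"
  shows "(\<integral>\<^sup>+\<omega>. g \<omega> * (ennreal (u (X t \<omega>)) * expN n (AA c s t \<omega>)) \<partial>M) \<le> (\<integral>\<^sup>+\<omega>. g \<omega> * H c (t - s) (X s \<omega>) \<partial>M)"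
  using st g
proof (induction n arbitrary: s g)
  case 0
  have "(\<integral>\<^sup>+\<omega>. g \<omega> * (ennreal (u (X t \<omega>)) * expN 0 (AA c s t \<omega>)) \<partial>M) = (\<integral>\<^sup>+\<omega>. g \<omega> * ennreal (u (X t \<omega>)) \<partial>M)"
    by (simp add: expN_def)
  also have "\<dots> = (\<integral>\<^sup>+\<omega>. g \<omega> * P (t - s) (\<lambda>z. ennreal (u z)) (X s \<omega>) \<partial>M)"
    by (rule markov) (use 0 in auto)
  also have "\<dots> \<le> (\<integral>\<^sup>+\<omega>. g \<omega> * H c (t - s) (X s \<omega>) \<partial>M)"
    using 0 order_trans[OF _ supersolution[OF c, of "t - s"]] by (intro nn_integral_mono mult_left_mono) auto
  finally show ?case .
next
  case (Suc n)
  interpret PM: pair_sigma_finite M "lborel :: real measure" by unfold_locales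
  note gM[measurable] = measurable_F_M[OF Suc.prems(3)]
  have "(\<integral>\<^sup>+\<omega>. g \<omega> * (ennreal (u (X t \<omega>)) * expN (Suc n) (AA c s t \<omega>)) \<partial>M) =
     (\<integral>\<^sup>+\<omega>. g \<omega> * ennreal (u (X t \<omega>)) + (\<integral>\<^sup>+r. indicator {s<..<t} r * (g \<omega> * Wf c (X r \<omega>) * (ennreal (u (X t \<omega>)) * expN n (AA c r t \<omega>))) \<partial>lborel) \<partial>M)"
  proof (rule nn_integral_cong)
    fix \<omega> assume "\<omega> \<in> space M"
    then have [measurable]: "(\<lambda>r. X r \<omega>) \<in> borel_measurable borel" by (rule path_measurable)
    have "g \<omega> * (ennreal (u (X t \<omega>)) * expN (Suc n) (AA c s t \<omega>)) = g \<omega> * ennreal (u (X t \<omega>)) + g \<omega> * ennreal (u (X t \<omega>)) * (\<integral>\<^sup>+r. indicator {s<..<t} r * (Wf c (X r \<omega>) * expN n (AA c r t \<omega>)) \<partial>lborel)"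
      by (subst expN_Suc_tint) (simp_all add: distrib_left mult.assoc)
    also have "g \<omega> * ennreal (u (X t \<omega>)) * (\<integral>\<^sup>+r. indicator {s<..<t} r * (Wf c (X r \<omega>) * expN n (AA c r t \<omega>)) \<partial>lborel) = (\<integral>\<^sup>+r. g \<omega> * ennreal (u (X t \<omega>)) * (indicator {s<..<t} r * (Wf c (X r \<omega>) * expN n (AA c r t \<omega>))) \<partial>lborel)"
      by (rule nn_integral_cmult[symmetric]) measurable
    also have "\<dots> = (\<integral>\<^sup>+r. indicator {s<..<t} r * (g \<omega> * Wf c (X r \<omega>) * (ennreal (u (X t \<omega>)) * expN n (AA c r t \<omega>))) \<partial>lborel)"
      by (intro nn_integral_cong) (simp only: mult_ac)
    finally show "g \<omega> * (ennreal (u (X t \<omega>)) * expN (Suc n) (AA c s t \<omega>)) = g \<omega> * ennreal (u (X t \<omega>)) + (\<integral>\<^sup>+r. indicator {s<..<t} r * (g \<omega> * Wf c (X r \<omega>) * (ennreal (u (X t \<omega>)) * expN n (AA c r t \<omega>))) \<partial>lborel)" .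
  qed
  also have "\<dots> = (\<integral>\<^sup>+\<omega>. g \<omega> * ennreal (u (X t \<omega>)) \<partial>M) + (\<integral>\<^sup>+\<omega>. \<integral>\<^sup>+r. indicator {s<..<t} r * (g \<omega> * Wf c (X r \<omega>) * (ennreal (u (X t \<omega>)) * expN n (AA c r t \<omega>))) \<partial>lborel \<partial>M)"
    by (rule nn_integral_add) measurable
  finally have e1: "(\<integral>\<^sup>+\<omega>. g \<omega> * (ennreal (u (X t \<omega>)) * expN (Suc n) (AA c s t \<omega>)) \<partial>M) = (\<integral>\<^sup>+\<omega>. g \<omega> * ennreal (u (X t \<omega>)) \<partial>M) + (\<integral>\<^sup>+\<omega>. \<integral>\<^sup>+r. indicator {s<..<t} r * (g \<omega> * Wf c (X r \<omega>) * (ennreal (u (X t \<omega>)) * expN n (AA c r t \<omega>))) \<partial>lborel \<partial>M)" .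
  have "(\<integral>\<^sup>+\<omega>. \<integral>\<^sup>+r. indicator {s<..<t} r * (g \<omega> * Wf c (X r \<omega>) * (ennreal (u (X t \<omega>)) * expN n (AA c r t \<omega>))) \<partial>lborel \<partial>M) =
      (\<integral>\<^sup>+r. \<integral>\<^sup>+\<omega>. indicator {s<..<t} r * (g \<omega> * Wf c (X r \<omega>) * (ennreal (u (X t \<omega>)) * expN n (AA c r t \<omega>))) \<partial>M \<partial>lborel)"
    by (rule PM.Fubini'[symmetric]) measurable
  also have "\<dots> \<le> (\<integral>\<^sup>+r. \<integral>\<^sup>+\<omega>. indicator {s<..<t} r * (g \<omega> * P (r - s) (\<lambda>z. Wf c z * H c (t - r) z) (X s \<omega>)) \<partial>M \<partial>lborel)"
  proof (rule nn_integral_mono)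
    fix r :: real
    show "(\<integral>\<^sup>+\<omega>. indicator {s<..<t} r * (g \<omega> * Wf c (X r \<omega>) * (ennreal (u (X t \<omega>)) * expN n (AA c r t \<omega>))) \<partial>M) \<le> (\<integral>\<^sup>+\<omega>. indicator {s<..<t} r * (g \<omega> * P (r - s) (\<lambda>z. Wf c z * H c (t - r) z) (X s \<omega>)) \<partial>M)"
    proof (cases "r \<in> {s<..<t}")
      case r: True
      have Xr: "X r \<in> borel_measurable (F r)" using r Suc.prems by (intro X_measurable_F) auto
      have gr: "g \<in> borel_measurable (F r)" using r by (intro measurable_F_mono[OF Suc.prems(3)]) auto
      \<comment> \<open>The induction hypothesis is used from time r on, with the weight g enlarged
        by the potential at X r; this is why g ranges over all functions measurable for the
        past.\<close>
      have gW: "(\<lambda>\<omega>. g \<omega> * Wf c (X r \<omega>)) \<in> borel_measurable (F r)"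
        using gr Xr by measurable
      have "(\<integral>\<^sup>+\<omega>. g \<omega> * Wf c (X r \<omega>) * (ennreal (u (X t \<omega>)) * expN n (AA c r t \<omega>)) \<partial>M) \<le> (\<integral>\<^sup>+\<omega>. g \<omega> * Wf c (X r \<omega>) * H c (t - r) (X r \<omega>) \<partial>M)"
        by (rule Suc.IH) (use r Suc.prems gW in auto)
      also have "\<dots> = (\<integral>\<^sup>+\<omega>. g \<omega> * (\<lambda>z. Wf c z * H c (t - r) z) (X r \<omega>) \<partial>M)" by (simp add: mult.assoc)
      also have "\<dots> = (\<integral>\<^sup>+\<omega>. g \<omega> * P (r - s) (\<lambda>z. Wf c z * H c (t - r) z) (X s \<omega>) \<partial>M)"
        by (rule markov) (use r Suc.prems in auto)
      finally show ?thesis using r by simp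
    qed simp
  qed
  also have "(\<integral>\<^sup>+r. \<integral>\<^sup>+\<omega>. indicator {s<..<t} r * (g \<omega> * P (r - s) (\<lambda>z. Wf c z * H c (t - r) z) (X s \<omega>)) \<partial>M \<partial>lborel) =
     (\<integral>\<^sup>+\<omega>. \<integral>\<^sup>+r. indicator {s<..<t} r * (g \<omega> * P (r - s) (\<lambda>z. Wf c z * H c (t - r) z) (X s \<omega>)) \<partial>lborel \<partial>M)"
    by (rule PM.Fubini') measurable
  also have "\<dots> = (\<integral>\<^sup>+\<omega>. g \<omega> * (\<integral>\<^sup>+r. indicator {0<..<t - s} r * P r (\<lambda>z. Wf c z * H c (t - s - r) z) (X s \<omega>) \<partial>lborel) \<partial>M)"
  proof (rule nn_integral_cong)
    fix \<omega>
    have "(\<integral>\<^sup>+r. indicator {s<..<t} r * (g \<omega> * P (r - s) (\<lambda>z. Wf c z * H c (t - r) z) (X s \<omega>)) \<partial>lborel) = (\<integral>\<^sup>+r. indicator {s<..<t} (s + r) * (g \<omega> * P ((s + r) - s) (\<lambda>z. Wf c z * H c (t - (s + r)) z) (X s \<omega>)) \<partial>lborel)"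
      by (rule nn_integral_translation[symmetric]) measurable
    also have "\<dots> = (\<integral>\<^sup>+r. g \<omega> * (indicator {0<..<t - s} r * P r (\<lambda>z. Wf c z * H c (t - s - r) z) (X s \<omega>)) \<partial>lborel)"
      by (intro nn_integral_cong) (auto simp: indicator_def diff_diff_eq)
    also have "\<dots> = g \<omega> * (\<integral>\<^sup>+r. indicator {0<..<t - s} r * P r (\<lambda>z. Wf c z * H c (t - s - r) z) (X s \<omega>) \<partial>lborel)"
      by (rule nn_integral_cmult) measurable
    finally show "(\<integral>\<^sup>+r. indicator {s<..<t} r * (g \<omega> * P (r - s) (\<lambda>z. Wf c z * H c (t - r) z) (X s \<omega>)) \<partial>lborel) = g \<omega> * (\<integral>\<^sup>+r. indicator {0<..<t - s} r * P r (\<lambda>z. Wf c z * H c (t - s - r) z) (X s \<omega>) \<partial>lborel)" .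
  qed
  finally have e2: "(\<integral>\<^sup>+\<omega>. \<integral>\<^sup>+r. indicator {s<..<t} r * (g \<omega> * Wf c (X r \<omega>) * (ennreal (u (X t \<omega>)) * expN n (AA c r t \<omega>))) \<partial>lborel \<partial>M) \<le> (\<integral>\<^sup>+\<omega>. g \<omega> * (\<integral>\<^sup>+r. indicator {0<..<t - s} r * P r (\<lambda>z. Wf c z * H c (t - s - r) z) (X s \<omega>) \<partial>lborel) \<partial>M)" .
  have e3: "(\<integral>\<^sup>+\<omega>. g \<omega> * ennreal (u (X t \<omega>)) \<partial>M) = (\<integral>\<^sup>+\<omega>. g \<omega> * P (t - s) (\<lambda>z. ennreal (u z)) (X s \<omega>) \<partial>M)"
    by (rule markov) (use Suc.prems in auto)
  have "(\<integral>\<^sup>+\<omega>. g \<omega> * (ennreal (u (X t \<omega>)) * expN (Suc n) (AA c s t \<omega>)) \<partial>M) \<le> (\<integral>\<^sup>+\<omega>. g \<omega> * P (t - s) (\<lambda>z. ennreal (u z)) (X s \<omega>) \<partial>M) + (\<integral>\<^sup>+\<omega>. g \<omega> * (\<integral>\<^sup>+r. indicator {0<..<t - s} r * P r (\<lambda>z. Wf c z * H c (t - s - r) z) (X s \<omega>) \<partial>lborel) \<partial>M)"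
    unfolding e1 e3[symmetric] by (intro add_left_mono e2)
  also have "(\<integral>\<^sup>+\<omega>. g \<omega> * P (t - s) (\<lambda>z. ennreal (u z)) (X s \<omega>) \<partial>M) + (\<integral>\<^sup>+\<omega>. g \<omega> * (\<integral>\<^sup>+r. indicator {0<..<t - s} r * P r (\<lambda>z. Wf c z * H c (t - s - r) z) (X s \<omega>) \<partial>lborel) \<partial>M) =
    (\<integral>\<^sup>+\<omega>. g \<omega> * P (t - s) (\<lambda>z. ennreal (u z)) (X s \<omega>) + g \<omega> * (\<integral>\<^sup>+r. indicator {0<..<t - s} r * P r (\<lambda>z. Wf c z * H c (t - s - r) z) (X s \<omega>) \<partial>lborel) \<partial>M)"
    by (rule nn_integral_add[symmetric]) measurable
  also have "\<dots> \<le> (\<integral>\<^sup>+\<omega>. g \<omega> * H c (t - s) (X s \<omega>) \<partial>M)"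
    using Suc.prems supersolution[OF c, of "t - s"]
    by (intro nn_integral_mono) (auto simp: distrib_left[symmetric] Wf_def intro!: mult_left_mono)
  finally show ?case .
qed

text \<open>Lowering V to Vc can only raise the weight. The integrals of Vc and of c - Vc add up to
  c t, so exp (- integral of Vc) is exp (- c t) times the exponential of the nonnegative functional
  \<open>AA\<close>.\<close>

lemma fk_weight_le:
  assumes c: "c > 0" and t: "t > 0" and \<omega>: "\<omega> \<in> space M"
  shows "ennreal (fk_weight \<alpha> \<delta> X t \<omega>) \<le> ennreal (exp (- (c * t))) * (SUP n. expN n (AA c 0 t \<omega>))"
proof -
  have [measurable]: "(\<lambda>r. X r \<omega>) \<in> borel_measurable borel" using \<omega> by (rule path_measurable)
  define A where "A = (\<integral>\<^sup>+s. indicator {0..t} s * ennreal (- pot \<alpha> \<delta> (X s \<omega>)) \<partial>lborel)"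
  define B where "B = tint (\<lambda>s. ennreal (Vc c (X s \<omega>))) 0 t"
  have c0: "c \<ge> 0" using c by simp
  have V: "- pot \<alpha> \<delta> z = V z" for z by (simp add: pot_def V_def vk_def)
  have BA: "B \<le> A"
    unfolding A_def B_def tint_def V using Vc_bounds(2)
    by (intro nn_integral_mono mult_mono) (auto simp: indicator_def ennreal_leI)
  have "AA c 0 t \<omega> + B = (\<integral>\<^sup>+r. indicator {0<..<t} r * Wf c (X r \<omega>) + indicator {0<..<t} r * ennreal (Vc c (X r \<omega>)) \<partial>lborel)"
    unfolding B_def tint_def by (rule nn_integral_add[symmetric]) measurable
  also have "\<dots> = (\<integral>\<^sup>+r. ennreal c * indicator {0<..<t} r \<partial>lborel)"
  proof (intro nn_integral_cong)
    fix r
    have "Wf c (X r \<omega>) + ennreal (Vc c (X r \<omega>)) = ennreal c"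
      unfolding Wf_def using Vc_bounds(1)[OF c0, of "X r \<omega>"] Vc_bounds(3)[of c "X r \<omega>"] by (subst ennreal_plus[symmetric]) auto
    then show "indicator {0<..<t} r * Wf c (X r \<omega>) + indicator {0<..<t} r * ennreal (Vc c (X r \<omega>)) = ennreal c * indicator {0<..<t} r"
      by (simp add: distrib_left[symmetric] mult.commute)
  qed
  also have "\<dots> = ennreal (c * t)"
    using t c by (subst nn_integral_cmult_indicator) (auto simp: ennreal_mult)
  finally have sum: "AA c 0 t \<omega> + B = ennreal (c * t)" .
  have "AA c 0 t \<omega> \<noteq> \<infinity>" "B \<noteq> \<infinity>" using sum by auto
  then obtain p b where pb: "AA c 0 t \<omega> = ennreal p" "p \<ge> 0" "B = ennreal b" "b \<ge> 0"
    by (metis ennreal_cases infinity_ennreal_def)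
  have "ennreal (p + b) = ennreal (c * t)" using sum pb by simp
  then have pbc: "p + b = c * t" using pb c t by (subst (asm) ennreal_inj) auto
  have S: "(SUP n. expN n (AA c 0 t \<omega>)) = ennreal (exp p)" unfolding pb(1) by (rule SUP_expN[OF pb(2)])
  show ?thesis
  proof (cases "A = \<infinity>")
    case True
    then show ?thesis by (simp add: fk_weight_def A_def[symmetric])
  next
    case False
    then obtain a where a: "A = ennreal a" "a \<ge> 0" by (metis ennreal_cases infinity_ennreal_def)
    have "b \<le> a" using BA unfolding a pb using a(2) by (simp add: ennreal_le_iff)
    have "fk_weight \<alpha> \<delta> X t \<omega> = exp (- a)"
      unfolding fk_weight_def A_def[symmetric] Let_def using False a by simp
    also have "\<dots> \<le> exp (- b)" using \<open>b \<le> a\<close> by simp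
    also have "\<dots> = exp (- (c * t)) * exp p" unfolding pbc[symmetric] by (simp add: exp_add[symmetric])
    finally show ?thesis unfolding S by (simp add: ennreal_mult[symmetric] ennreal_leI)
  qed
qed

text \<open>The factor exp (- c t) from the weight cancels exp (c t) in \<open>H\<close>, which
  leaves \<open>G\<close>.\<close>

lemma fk_bound_cut:
  assumes c: "c > 0" and t: "t > 0"
  shows "(\<integral>\<^sup>+\<omega>. ennreal (u (X t \<omega>)) * ennreal (fk_weight \<alpha> \<delta> X t \<omega>) \<partial>M) \<le> G c t x0"
proof -
  have "(\<integral>\<^sup>+\<omega>. ennreal (u (X t \<omega>)) * ennreal (fk_weight \<alpha> \<delta> X t \<omega>) \<partial>M) \<le>
     (\<integral>\<^sup>+\<omega>. ennreal (exp (- (c * t))) * (SUP n. ennreal (u (X t \<omega>)) * expN n (AA c 0 t \<omega>)) \<partial>M)"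
  proof (rule nn_integral_mono)
    fix \<omega> assume \<omega>: "\<omega> \<in> space M"
    have "ennreal (u (X t \<omega>)) * ennreal (fk_weight \<alpha> \<delta> X t \<omega>) \<le> ennreal (u (X t \<omega>)) * (ennreal (exp (- (c * t))) * (SUP n. expN n (AA c 0 t \<omega>)))"
      by (intro mult_left_mono fk_weight_le c t \<omega>) auto
    also have "\<dots> = ennreal (exp (- (c * t))) * (SUP n. ennreal (u (X t \<omega>)) * expN n (AA c 0 t \<omega>))"
      by (simp add: SUP_mult_left_ennreal mult.left_commute)
    finally show "ennreal (u (X t \<omega>)) * ennreal (fk_weight \<alpha> \<delta> X t \<omega>) \<le> ennreal (exp (- (c * t))) * (SUP n. ennreal (u (X t \<omega>)) * expN n (AA c 0 t \<omega>))" .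
  qed
  also have "\<dots> = ennreal (exp (- (c * t))) * (\<integral>\<^sup>+\<omega>. (SUP n. ennreal (u (X t \<omega>)) * expN n (AA c 0 t \<omega>)) \<partial>M)"
    by (rule nn_integral_cmult) measurable
  also have "(\<integral>\<^sup>+\<omega>. (SUP n. ennreal (u (X t \<omega>)) * expN n (AA c 0 t \<omega>)) \<partial>M) = (SUP n. (\<integral>\<^sup>+\<omega>. ennreal (u (X t \<omega>)) * expN n (AA c 0 t \<omega>) \<partial>M))"
  proof (rule nn_integral_monotone_convergence_SUP)
    show "incseq (\<lambda>n \<omega>. ennreal (u (X t \<omega>)) * expN n (AA c 0 t \<omega>))"
      by (intro incseq_SucI le_funI mult_left_mono expN_mono) auto
  qed measurable
  also have "(SUP n. (\<integral>\<^sup>+\<omega>. ennreal (u (X t \<omega>)) * expN n (AA c 0 t \<omega>) \<partial>M)) \<le> H c t x0"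
  proof (rule SUP_least)
    fix n
    have "(\<integral>\<^sup>+\<omega>. 1 * (ennreal (u (X t \<omega>)) * expN n (AA c 0 t \<omega>)) \<partial>M) \<le> (\<integral>\<^sup>+\<omega>. 1 * H c (t - 0) (X 0 \<omega>) \<partial>M)"
      by (rule perturbation_bound) (use c t in auto)
    also have "\<dots> = (\<integral>\<^sup>+\<omega>. H c t x0 \<partial>M)"
      by (intro nn_integral_cong_AE, use X0 in eventually_elim) simp
    finally show "(\<integral>\<^sup>+\<omega>. ennreal (u (X t \<omega>)) * expN n (AA c 0 t \<omega>) \<partial>M) \<le> H c t x0" by (simp add: emeasure_space_1)
  qed
  finally have "(\<integral>\<^sup>+\<omega>. ennreal (u (X t \<omega>)) * ennreal (fk_weight \<alpha> \<delta> X t \<omega>) \<partial>M) \<le> ennreal (exp (- (c * t))) * H c t x0"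
    by (simp add: mult_left_mono)
  also have "\<dots> = G c t x0"
    unfolding H_def mult.assoc[symmetric] by (simp add: ennreal_mult[symmetric] exp_add[symmetric])
  finally show ?thesis .
qed

text \<open>The surplus (V - Vc) u vanishes at each point once n exceeds V there, and it is
  dominated by V u, whose space-time integral is finite by \<open>P_u\<close>.\<close>

lemma G_limit:
  assumes t: "t > 0"
  shows "(\<lambda>n. G (real n) t x) \<longlonglongrightarrow> ennreal (u x)"
proof -
  define f where "f n p = indicator {0<..<t} (fst p) * (ennreal ((V (x + snd p) - Vc (real n) (x + snd p)) * u (x + snd p)) * ennreal (heat \<alpha> (fst p) (snd p)))" for n :: nat and p :: "real \<times> (real^'n)"
  define w where "w p = indicator {0<..<t} (fst p) * (ennreal (V (x + snd p) * u (x + snd p)) * ennreal (heat \<alpha> (fst p) (snd p)))" for p :: "real \<times> (real^'n)"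
  have fm[measurable]: "f n \<in> borel_measurable (lborel \<Otimes>\<^sub>M lborel)" for n unfolding f_def by measurable
  have wm[measurable]: "w \<in> borel_measurable (lborel \<Otimes>\<^sub>M lborel)" unfolding w_def by measurable
  have "(\<lambda>n. \<integral>\<^sup>+p. f n p \<partial>(lborel \<Otimes>\<^sub>M lborel)) \<longlonglongrightarrow> (\<integral>\<^sup>+p. 0 \<partial>(lborel \<Otimes>\<^sub>M (lborel :: (real^'n) measure) :: (real \<times> (real^'n)) measure))"
  proof (rule nn_integral_dominated_convergence[where w = w])
    have "(\<integral>\<^sup>+p. w p \<partial>(lborel \<Otimes>\<^sub>M lborel)) = (\<integral>\<^sup>+s. \<integral>\<^sup>+y. w (s, y) \<partial>lborel \<partial>lborel)"
      by (rule lborel.nn_integral_fst[symmetric]) measurable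
    also have "\<dots> = (\<integral>\<^sup>+s. indicator {0<..<t} s * P s (\<lambda>z. ennreal (V z * u z)) x \<partial>lborel)"
      unfolding w_def P_def fst_conv snd_conv by (intro nn_integral_cong nn_integral_cmult) measurable
    also have "\<dots> < \<infinity>" by (rule P_u(3)[OF order_refl t])
    finally show "(\<integral>\<^sup>+p. w p \<partial>(lborel \<Otimes>\<^sub>M lborel)) < \<infinity>" .
    show "AE p in lborel \<Otimes>\<^sub>M lborel. f n p \<le> w p" for n
    proof (rule AE_I2)
      fix p :: "real \<times> (real^'n)"
      have "(V z - Vc (real n) z) * u z \<le> V z * u z" for z
        using Vc_bounds(1)[of "real n" z] u_nonneg[of z] by (intro mult_right_mono) auto
      then show "f n p \<le> w p" unfolding f_def w_def by (intro mult_left_mono[OF mult_right_mono[OF ennreal_leI]]) auto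
    qed
    show "AE p in lborel \<Otimes>\<^sub>M lborel. (\<lambda>n. f n p) \<longlonglongrightarrow> 0"
    proof (rule AE_I2)
      fix p :: "real \<times> (real^'n)"
      \<comment> \<open>V has a finite value even at the origin, where
        \<open>0 powr (- \<alpha>)\<close> is 0.\<close>
      obtain m :: nat where m: "V (x + snd p) \<le> real m" using real_arch_simple by blast
      have "f n p = 0" if "n \<ge> m" for n
      proof -
        have "V (x + snd p) \<le> real n" using m that by linarith
        then have "Vc (real n) (x + snd p) = V (x + snd p)" by (simp add: Vc_def)
        then show ?thesis by (simp add: f_def)
      qed
      then have "eventually (\<lambda>n. f n p = 0) sequentially" by (auto simp: eventually_sequentially)
      then show "(\<lambda>n. f n p) \<longlonglongrightarrow> 0" by (rule tendsto_eventually)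
    qed
  qed measurable
  then have "(\<lambda>n. ennreal (u x) + (\<integral>\<^sup>+p. f n p \<partial>(lborel \<Otimes>\<^sub>M lborel))) \<longlonglongrightarrow> ennreal (u x) + 0"
    by (intro tendsto_add tendsto_const) simp
  moreover have "G (real n) t x = ennreal (u x) + (\<integral>\<^sup>+p. f n p \<partial>(lborel \<Otimes>\<^sub>M lborel))" for n
  proof -
    have "(\<integral>\<^sup>+p. f n p \<partial>(lborel \<Otimes>\<^sub>M lborel)) = (\<integral>\<^sup>+s. \<integral>\<^sup>+y. f n (s, y) \<partial>lborel \<partial>lborel)"
      by (rule lborel.nn_integral_fst[symmetric]) measurable
    also have "\<dots> = (\<integral>\<^sup>+s. indicator {0<..<t} s * P s (\<lambda>z. ennreal ((V z - Vc (real n) z) * u z)) x \<partial>lborel)"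
      unfolding f_def P_def fst_conv snd_conv by (intro nn_integral_cong nn_integral_cmult) measurable
    finally show ?thesis by (simp add: G_def)
  qed
  ultimately show ?thesis by simp
qed

lemma fk_bound:
  assumes t: "t > 0"
  shows "(\<integral>\<^sup>+\<omega>. ennreal (norm (X t \<omega>) powr \<delta>) * ennreal (fk_weight \<alpha> \<delta> X t \<omega>) \<partial>M) \<le> ennreal (norm x0 powr \<delta>)"
proof -
  have "(\<integral>\<^sup>+\<omega>. ennreal (u (X t \<omega>)) * ennreal (fk_weight \<alpha> \<delta> X t \<omega>) \<partial>M) \<le> ennreal (u x0)"
    by (rule LIMSEQ_le_const[OF G_limit[OF t]]) (use fk_bound_cut[OF _ t] in \<open>auto intro!: exI[of _ 1]\<close>)
  then show ?thesis by (simp add: u_def)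
qed

end

section \<open>From superharmonicity to the kernel bound\<close>

text \<open>Collects what the remaining analytic part takes from the process.
  \<open>pt_delta\<close> is the superharmonicity of |x|^\<delta>; \<open>pt_heat\<close> holds
  almost everywhere because the kernel is given through integrals over sets.\<close>

locale hardy_kernel = hardy \<alpha> N \<delta> for \<alpha> :: real and N :: "'n::finite itself" and \<delta> +
  fixes pt :: "real \<Rightarrow> real^'n \<Rightarrow> real^'n \<Rightarrow> real"
  assumes pt_nonneg: "\<And>t x y. t > 0 \<Longrightarrow> 0 \<le> pt t x y"
    and pt_sym: "\<And>t x y. t > 0 \<Longrightarrow> pt t x y = pt t y x"
    and pt_meas: "\<And>t x. t > 0 \<Longrightarrow> pt t x \<in> borel_measurable borel"
    and CK: "\<And>t s x y. t > 0 \<Longrightarrow> s > 0 \<Longrightarrow> ennreal (pt (t + s) x y) = (\<integral>\<^sup>+z. ennreal (pt t x z) * ennreal (pt s z y) \<partial>lborel)"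
    and pt_mass: "\<And>t x. t > 0 \<Longrightarrow> (\<integral>\<^sup>+y. ennreal (pt t x y) \<partial>lborel) \<le> 1"
    and pt_delta: "\<And>t x. t > 0 \<Longrightarrow> (\<integral>\<^sup>+y. ennreal (norm y powr \<delta>) * ennreal (pt t x y) \<partial>lborel) \<le> ennreal (norm x powr \<delta>)"
    and pt_heat: "\<And>t x. t > 0 \<Longrightarrow> AE y in lborel. pt t x y \<le> heat \<alpha> t (y - x)"
begin

lemma pt_meas' [measurable (raw)]: "t > 0 \<Longrightarrow> f \<in> borel_measurable K \<Longrightarrow> (\<lambda>w. pt t x (f w)) \<in> borel_measurable K"
  by (rule measurable_compose[OF _ pt_meas])

text \<open>Any intermediate point z has distance at least |x - y|/2 from x or from y. The
  corresponding factor is bounded by the heat kernel at that distance and the other one has mass at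
  most 1. Integrating over z also turns the almost everywhere bound into one for all x and
  y.\<close>

lemma pt_le_heat:
  assumes t: "t > 0"
  shows "pt t x y \<le> 2 * heat \<alpha> (t / 2) ((1 / 2) *\<^sub>R (x - y))"
proof -
  define b where "b = heat \<alpha> (t / 2) ((1 / 2) *\<^sub>R (x - y))"
  have t2: "t / 2 > 0" using t by simp
  have b: "b \<ge> 0" unfolding b_def by (rule heat_nonneg[OF t2])
  have pm: "(\<lambda>z. ennreal (pt (t / 2) w z)) \<in> borel_measurable lborel" for w using pt_meas[OF t2, of w] by simp
  have "ennreal (pt t x y) = (\<integral>\<^sup>+z. ennreal (pt (t / 2) x z) * ennreal (pt (t / 2) z y) \<partial>lborel)"
    using CK[OF t2 t2, of x y] by simp
  also have "\<dots> \<le> (\<integral>\<^sup>+z. ennreal b * ennreal (pt (t / 2) y z) + ennreal b * ennreal (pt (t / 2) x z) \<partial>lborel)"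
  proof (rule nn_integral_mono_AE, use pt_heat[OF t2, of x] pt_heat[OF t2, of y] in eventually_elim)
    fix z assume hx: "pt (t / 2) x z \<le> heat \<alpha> (t / 2) (z - x)" and hy: "pt (t / 2) y z \<le> heat \<alpha> (t / 2) (z - y)"
    have tri: "norm (x - y) \<le> norm (z - x) + norm (z - y)"
      using norm_triangle_ineq4[of "z - y" "z - x"] by (simp add: add.commute)
    show "ennreal (pt (t / 2) x z) * ennreal (pt (t / 2) z y) \<le> ennreal b * ennreal (pt (t / 2) y z) + ennreal b * ennreal (pt (t / 2) x z)"
    proof (cases "norm (x - y) / 2 \<le> norm (z - x)")
      case True
      then have "heat \<alpha> (t / 2) (z - x) \<le> b" unfolding b_def by (intro heat_decr t2) simp
      then have "ennreal (pt (t / 2) x z) * ennreal (pt (t / 2) z y) \<le> ennreal b * ennreal (pt (t / 2) y z)"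
        unfolding pt_sym[OF t2, of z y] using hx by (intro mult_right_mono ennreal_leI) auto
      then show ?thesis by (rule order_trans) simp
    next
      case False
      then have "heat \<alpha> (t / 2) (z - y) \<le> b" unfolding b_def using tri by (intro heat_decr t2) simp
      then have "ennreal (pt (t / 2) z y) * ennreal (pt (t / 2) x z) \<le> ennreal b * ennreal (pt (t / 2) x z)"
        unfolding pt_sym[OF t2, of z y] using hy by (intro mult_right_mono ennreal_leI) auto
      then have "ennreal (pt (t / 2) x z) * ennreal (pt (t / 2) z y) \<le> ennreal b * ennreal (pt (t / 2) x z)" by (simp add: mult.commute)
      then show ?thesis by (rule order_trans) simp
    qed
  qed
  also have "\<dots> = ennreal b * (\<integral>\<^sup>+z. ennreal (pt (t / 2) y z) \<partial>lborel) + ennreal b * (\<integral>\<^sup>+z. ennreal (pt (t / 2) x z) \<partial>lborel)"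
    using pm by (simp add: nn_integral_add nn_integral_cmult)
  also have "\<dots> \<le> ennreal b * 1 + ennreal b * 1"
    by (intro add_mono mult_left_mono pt_mass t2) auto
  also have "\<dots> = ennreal (2 * b)" using b by (simp add: ennreal_plus[symmetric] del: ennreal_plus)
  finally show ?thesis using b unfolding b_def by (subst (asm) ennreal_le_iff) auto
qed

section \<open>Decay of the total mass\<close>

definition m :: "real \<Rightarrow> real^'n \<Rightarrow> real" where
  "m t x = enn2real (\<integral>\<^sup>+y. ennreal (pt t x y) \<partial>lborel)"

lemma ennreal_m: "t > 0 \<Longrightarrow> ennreal (m t x) = (\<integral>\<^sup>+y. ennreal (pt t x y) \<partial>lborel)"
  unfolding m_def using pt_mass[of t x] by (intro ennreal_enn2real) (auto simp: less_top[symmetric] top_unique)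

lemma m_bounds: "0 \<le> m t x" "t > 0 \<Longrightarrow> m t x \<le> 1"
proof -
  show "0 \<le> m t x" by (simp add: m_def)
  show "m t x \<le> 1" if "t > 0" using pt_mass[OF that, of x] unfolding ennreal_m[OF that, symmetric] by simp
qed

lemma CK_le:
  assumes t: "t > 0" and s: "s > 0" and B: "B \<ge> 0" and b: "\<And>z. pt s z y \<le> B"
  shows "pt (t + s) x y \<le> B * m t x"
proof -
  have "ennreal (pt (t + s) x y) \<le> (\<integral>\<^sup>+z. ennreal B * ennreal (pt t x z) \<partial>lborel)"
    unfolding CK[OF t s] mult.commute[of "ennreal B"] by (intro nn_integral_mono mult_left_mono ennreal_leI b) auto
  also have "\<dots> = ennreal (B * m t x)"
    using t B m_bounds(1)[of t x] by (subst nn_integral_cmult) (auto simp: ennreal_m[symmetric] ennreal_mult)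
  finally show ?thesis using B m_bounds(1)[of t x] by (subst (asm) ennreal_le_iff) auto
qed

lemma pt_sup:
  obtains C where "C > 0" "\<And>t x y. t > 0 \<Longrightarrow> pt t x y \<le> C * t powr (- real CARD('n) / \<alpha>)"
proof -
  let ?h = "heat \<alpha> 1 (0::real^'n)"
  define C where "C = 2 * (?h + 1) * 2 powr (real CARD('n) / \<alpha>)"
  have h: "?h \<ge> 0" by (rule heat_nonneg) simp
  then have "C > 0" by (simp add: C_def)
  moreover have "pt t x y \<le> C * t powr (- real CARD('n) / \<alpha>)" if t: "t > 0" for t x y
  proof -
    have "pt t x y \<le> 2 * (?h * (t / 2) powr (- real CARD('n) / \<alpha>))"
      using pt_le_heat[OF t, of x y] heat_sup[of "t / 2" "(1 / 2) *\<^sub>R (x - y)"] t by simp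
    also have "\<dots> \<le> 2 * ((?h + 1) * (t / 2) powr (- real CARD('n) / \<alpha>))"
      by (intro mult_left_mono mult_right_mono) auto
    also have "(t / 2) powr (- real CARD('n) / \<alpha>) = t powr (- real CARD('n) / \<alpha>) * 2 powr (real CARD('n) / \<alpha>)"
      using t by (simp add: powr_divide powr_minus_divide)
    finally show ?thesis by (simp add: C_def algebra_simps)
  qed
  ultimately show ?thesis using that by blast
qed

lemma pt_far:
  obtains C where "C > 0" "\<And>t x y. t > 0 \<Longrightarrow> x \<noteq> y \<Longrightarrow> pt t x y \<le> C * t * norm (x - y) powr (- real CARD('n) - \<alpha>)"
proof -
  obtain C0 where C0: "C0 > 0" "\<And>t x. t > 0 \<Longrightarrow> x \<noteq> 0 \<Longrightarrow> heat \<alpha> t (x::real^'n) \<le> C0 * t * norm x powr (- real CARD('n) - \<alpha>)"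
    using heat_upper by blast
  define C where "C = C0 * (1 / 2) powr (- real CARD('n) - \<alpha>)"
  have "C > 0" using C0 by (simp add: C_def)
  moreover have "pt t x y \<le> C * t * norm (x - y) powr (- real CARD('n) - \<alpha>)" if t: "t > 0" and xy: "x \<noteq> y" for t x y
  proof -
    have "pt t x y \<le> 2 * (C0 * (t / 2) * norm ((1 / 2) *\<^sub>R (x - y)) powr (- real CARD('n) - \<alpha>))"
      using pt_le_heat[OF t, of x y] C0(2)[of "t / 2" "(1 / 2) *\<^sub>R (x - y)"] t xy by simp
    also have "norm ((1 / 2) *\<^sub>R (x - y)) powr (- real CARD('n) - \<alpha>) = (1 / 2) powr (- real CARD('n) - \<alpha>) * norm (x - y) powr (- real CARD('n) - \<alpha>)"
      unfolding norm_scaleR by (subst powr_mult) auto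
    finally show ?thesis by (simp add: C_def mult_ac)
  qed
  ultimately show ?thesis using that by blast
qed

text \<open>Beyond radius \<epsilon> the mass is controlled by \<open>pt_delta\<close> and
  Chebyshev's inequality. In the ball the kernel is at most B m (t/2) x by \<open>CK_le\<close>,
  times the volume.\<close>

lemma m_step:
  assumes t: "t > 0" and e: "\<epsilon> > 0" and B: "B \<ge> 0" "\<And>z y. pt (t / 2) z y \<le> B"
  shows "m t x \<le> \<epsilon> powr (- \<delta>) * norm x powr \<delta> + unit_ball_vol (real CARD('n)) * \<epsilon> ^ CARD('n) * (B * m (t / 2) x)"
proof -
  have t2: "t / 2 > 0" using t by simp
  let ?V = "unit_ball_vol (real CARD('n))"
  have V: "?V \<ge> 0" by simp
  have D: "pt t x y \<le> B * m (t / 2) x" for y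
    using CK_le[OF t2 t2 B(1), of y x] B(2) by simp
  have D0: "0 \<le> B * m (t / 2) x" using B m_bounds by simp
  have [measurable]: "(\<lambda>y. pt t x y) \<in> borel_measurable borel" by (rule pt_meas[OF t])
  have "ennreal (m t x) = (\<integral>\<^sup>+y. ennreal (pt t x y) \<partial>lborel)" by (rule ennreal_m[OF t])
  also have "\<dots> \<le> (\<integral>\<^sup>+y. ennreal (\<epsilon> powr (- \<delta>)) * (ennreal (norm y powr \<delta>) * ennreal (pt t x y)) + ennreal (B * m (t / 2) x) * indicator (cball 0 \<epsilon>) y \<partial>lborel)"
  proof (rule nn_integral_mono)
    fix y :: "real^'n"
    show "ennreal (pt t x y) \<le> ennreal (\<epsilon> powr (- \<delta>)) * (ennreal (norm y powr \<delta>) * ennreal (pt t x y)) + ennreal (B * m (t / 2) x) * indicator (cball 0 \<epsilon>) y"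
    proof (cases "norm y \<le> \<epsilon>")
      case True
      then have "ennreal (pt t x y) \<le> ennreal (B * m (t / 2) x) * indicator (cball 0 \<epsilon>) y"
        using D[of y] by (simp add: ennreal_leI)
      then show ?thesis by (rule order_trans) simp
    next
      case False
      have "\<epsilon> powr (- \<delta>) * \<epsilon> powr \<delta> \<le> \<epsilon> powr (- \<delta>) * norm y powr \<delta>"
        using False e \<delta> by (intro mult_left_mono powr_mono2) auto
      then have "1 \<le> \<epsilon> powr (- \<delta>) * norm y powr \<delta>" using e by (simp add: powr_add[symmetric])
      then have "1 * pt t x y \<le> (\<epsilon> powr (- \<delta>) * norm y powr \<delta>) * pt t x y"
        by (intro mult_right_mono pt_nonneg t)
      then have "ennreal (pt t x y) \<le> ennreal (\<epsilon> powr (- \<delta>)) * (ennreal (norm y powr \<delta>) * ennreal (pt t x y))"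
        using pt_nonneg[OF t, of x y] by (simp add: ennreal_mult[symmetric] mult.assoc ennreal_leI)
      then show ?thesis by (rule order_trans) simp
    qed
  qed
  also have "\<dots> = ennreal (\<epsilon> powr (- \<delta>)) * (\<integral>\<^sup>+y. ennreal (norm y powr \<delta>) * ennreal (pt t x y) \<partial>lborel) + ennreal (B * m (t / 2) x) * emeasure lborel (cball (0::real^'n) \<epsilon>)"
  proof -
    have [measurable]: "cball (0::real^'n) \<epsilon> \<in> sets borel" by simp
    have 1: "(\<lambda>y. ennreal (\<epsilon> powr (- \<delta>)) * (ennreal (norm y powr \<delta>) * ennreal (pt t x y))) \<in> borel_measurable lborel" by measurable
    have 2: "(\<lambda>y. ennreal (B * m (t / 2) x) * indicator (cball (0::real^'n) \<epsilon>) y) \<in> borel_measurable lborel" by measurable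
    show ?thesis
      unfolding nn_integral_add[OF 1 2]
      by (subst nn_integral_cmult, measurable, subst nn_integral_cmult_indicator) auto
  qed
  also have "\<dots> \<le> ennreal (\<epsilon> powr (- \<delta>)) * ennreal (norm x powr \<delta>) + ennreal (B * m (t / 2) x) * ennreal (?V * \<epsilon> ^ CARD('n))"
    using e by (intro add_mono mult_left_mono pt_delta t) (auto simp: emeasure_cball)
  also have "\<dots> = ennreal (\<epsilon> powr (- \<delta>) * norm x powr \<delta> + ?V * \<epsilon> ^ CARD('n) * (B * m (t / 2) x))"
  proof -
    have "ennreal (B * m (t / 2) x) * ennreal (?V * \<epsilon> ^ CARD('n)) = ennreal (?V * \<epsilon> ^ CARD('n) * (B * m (t / 2) x))"
      using D0 e by (subst ennreal_mult[symmetric]) (auto simp: mult_ac)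
    moreover have "0 \<le> ?V * \<epsilon> ^ CARD('n) * (B * m (t / 2) x)" using B(1) m_bounds(1)[of "t / 2" x] e by (intro mult_nonneg_nonneg) auto
    ultimately show ?thesis by (simp add: ennreal_mult[symmetric])
  qed
  finally show ?thesis
    using B(1) m_bounds(1)[of "t / 2" x] e by (subst (asm) ennreal_le_iff) (auto intro!: add_nonneg_nonneg mult_nonneg_nonneg)
qed

lemma m_decay:
  obtains K where "K > 0" "\<And>t x. t > 0 \<Longrightarrow> m t x \<le> K * t powr (- \<delta> / \<alpha>) * norm x powr \<delta>"
proof -
  let ?V = "unit_ball_vol (real CARD('n))"
  have V: "?V > 0" by simp
  obtain C where C: "C > 0" "\<And>t x y. t > 0 \<Longrightarrow> pt t x y \<le> C * t powr (- real CARD('n) / \<alpha>)"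
    using pt_sup by blast
  \<comment> \<open>Half of 2^(-\<delta>/\<alpha>): halving t multiplies t^(-\<delta>/\<alpha>) by 1
    / (2 q), so the main terms of the iteration form a geometric series with ratio 1/2 and sum
    2.\<close>
  define q where "q = 2 powr (- \<delta> / \<alpha>) / 2"
  have q: "0 < q" "q < 1" 
  proof -
    have "2 powr (- \<delta> / \<alpha>) \<le> (2::real) powr 0" using \<delta> \<alpha> by (intro powr_mono) auto
    then show "0 < q" "q < 1" by (auto simp: q_def)
  qed
  \<comment> \<open>Makes the volume of the ball of radius \<eta> t^(1/\<alpha>), times the bound C
    (t/2)^(-d/\<alpha>) on the kernel, exactly q.\<close>
  define \<eta> where "\<eta> = (q / (?V * C * 2 powr (real CARD('n) / \<alpha>))) powr (1 / real CARD('n))"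
  have \<eta>: "\<eta> > 0" using q C(1) less_imp_neq[OF V] by (simp add: \<eta>_def)
  have "\<eta> ^ CARD('n) = q / (?V * C * 2 powr (real CARD('n) / \<alpha>))"
    using q C(1) less_imp_neq[OF V] by (simp add: \<eta>_def powr_powr flip: powr_realpow)
  then have \<eta>q: "?V * \<eta> ^ CARD('n) * C * 2 powr (real CARD('n) / \<alpha>) = q" using less_imp_neq[OF V] C(1) by simp
  have step: "m t x \<le> \<eta> powr (- \<delta>) * norm x powr \<delta> * t powr (- \<delta> / \<alpha>) + q * m (t / 2) x" if t: "t > 0" for t x
  proof -
    define \<epsilon> where "\<epsilon> = \<eta> * t powr (1 / \<alpha>)"
    have e: "\<epsilon> > 0" using \<eta> t by (simp add: \<epsilon>_def)
    have e1: "\<epsilon> powr (- \<delta>) = \<eta> powr (- \<delta>) * t powr (- \<delta> / \<alpha>)"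
      using \<eta> t by (simp add: \<epsilon>_def powr_mult powr_powr)
    have e2: "\<epsilon> ^ CARD('n) = \<eta> ^ CARD('n) * t powr (real CARD('n) / \<alpha>)"
      using \<eta> t by (simp add: \<epsilon>_def power_mult_distrib powr_powr powr_realpow[symmetric])
    have e3: "(t / 2) powr (- real CARD('n) / \<alpha>) = 2 powr (real CARD('n) / \<alpha>) / t powr (real CARD('n) / \<alpha>)"
      using t by (simp add: powr_divide powr_minus_divide)
    have tp: "t powr (real CARD('n) / \<alpha>) > 0" using t by simp
    have "m t x \<le> \<epsilon> powr (- \<delta>) * norm x powr \<delta> + ?V * \<epsilon> ^ CARD('n) * ((C * (t / 2) powr (- real CARD('n) / \<alpha>)) * m (t / 2) x)"
      by (rule m_step[OF t e]) (use C t in auto)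
    also have "?V * \<epsilon> ^ CARD('n) * ((C * (t / 2) powr (- real CARD('n) / \<alpha>)) * m (t / 2) x) = (?V * \<eta> ^ CARD('n) * C * 2 powr (real CARD('n) / \<alpha>)) * m (t / 2) x"
      unfolding e2 e3 using tp by (simp add: field_simps)
    finally show ?thesis unfolding \<eta>q e1 by (simp add: mult_ac)
  qed
  \<comment> \<open>The n-fold iteration ends with the bound m <= 1 at time t / 2^n; the remainder
    q^n tends to 0.\<close>
  have it: "m t x \<le> 2 * (\<eta> powr (- \<delta>) * norm x powr \<delta> * t powr (- \<delta> / \<alpha>)) + q ^ n" if t: "t > 0" for t x n
    using t
  proof (induction n arbitrary: t)
    case 0
    have "0 \<le> 2 * (\<eta> powr (- \<delta>) * norm x powr \<delta> * t powr (- \<delta> / \<alpha>))" by simp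
    then show ?case using m_bounds(2)[OF 0, of x] unfolding power_0 by linarith
  next
    case (Suc n)
    define a where "a = \<eta> powr (- \<delta>) * norm x powr \<delta> * t powr (- \<delta> / \<alpha>)"
    have "(t / 2) powr (- \<delta> / \<alpha>) = t powr (- \<delta> / \<alpha>) / (2 * q)"
      using Suc.prems by (simp add: powr_divide q_def)
    then have IH: "m (t / 2) x \<le> 2 * (a / (2 * q)) + q ^ n"
      using Suc.IH[of "t / 2"] Suc.prems by (simp add: a_def)
    have "m t x \<le> a + q * m (t / 2) x" using step[OF Suc.prems, of x] by (simp add: a_def)
    also have "\<dots> \<le> a + q * (2 * (a / (2 * q)) + q ^ n)" using IH q by (intro add_left_mono mult_left_mono) auto
    also have "\<dots> = 2 * a + q ^ Suc n" using q by (simp add: field_simps)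
    finally show ?case by (simp add: a_def)
  qed
  have "m t x \<le> (2 * \<eta> powr (- \<delta>)) * t powr (- \<delta> / \<alpha>) * norm x powr \<delta>" if t: "t > 0" for t x
  proof -
    have "(\<lambda>n. 2 * (\<eta> powr (- \<delta>) * norm x powr \<delta> * t powr (- \<delta> / \<alpha>)) + q ^ n) \<longlonglongrightarrow> 2 * (\<eta> powr (- \<delta>) * norm x powr \<delta> * t powr (- \<delta> / \<alpha>)) + 0"
      using q by (intro tendsto_add tendsto_const LIMSEQ_realpow_zero) auto
    then have "m t x \<le> 2 * (\<eta> powr (- \<delta>) * norm x powr \<delta> * t powr (- \<delta> / \<alpha>)) + 0"
      by (rule LIMSEQ_le_const) (use it[OF t] in auto)
    then show ?thesis by (simp add: mult_ac)
  qed
  then show ?thesis using that[of "2 * \<eta> powr (- \<delta>)"] \<eta> by simp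
qed

section \<open>Estimates near and away from the diagonal at time 1\<close>

definition phi :: "real^'n \<Rightarrow> real" where "phi x = min 1 (norm x powr \<delta>)"

lemma phi_nonneg: "0 \<le> phi x" by (simp add: phi_def)

text \<open>Time 1 is split as 1/2 + 1/4 + 1/4: one piece gives the mass from x, one the mass from
  y, and the last the uniform bound. Combining \<open>m_decay\<close> with m <= 1 produces the
  minimum in \<open>phi\<close>.\<close>

lemma pt_near:
  obtains C where "C > 0" "\<And>x y. pt 1 x y \<le> C * phi x * phi y"
proof -
  obtain C1 where C1: "C1 > 0" "\<And>t x y. t > 0 \<Longrightarrow> pt t x y \<le> C1 * t powr (- real CARD('n) / \<alpha>)" using pt_sup by blast
  obtain K where K: "K > 0" "\<And>t x. t > 0 \<Longrightarrow> m t x \<le> K * t powr (- \<delta> / \<alpha>) * norm x powr \<delta>" using m_decay by blast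
  define L where "L = max 1 (K * (1/4) powr (- \<delta> / \<alpha>))"
  have L: "L \<ge> 1" by (simp add: L_def)
  have mphi: "m t x \<le> L * phi x" if t: "t \<ge> 1/4" for t x
  proof -
    have "m t x \<le> 1" using t by (intro m_bounds) auto
    then have 1: "m t x \<le> L * 1" using L by simp
    have "m t x \<le> K * t powr (- \<delta> / \<alpha>) * norm x powr \<delta>" using K(2)[of t x] t by simp
    also have "\<dots> \<le> K * (1/4) powr (- \<delta> / \<alpha>) * norm x powr \<delta>"
    proof -
      have "t powr (- \<delta> / \<alpha>) \<le> (1/4) powr (- \<delta> / \<alpha>)"
        using t \<delta> \<alpha> by (intro powr_mono2') auto
      then show ?thesis using K by (intro mult_right_mono mult_left_mono) auto
    qed
    also have "\<dots> \<le> L * norm x powr \<delta>" by (intro mult_right_mono) (auto simp: L_def)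
    finally show ?thesis using 1 by (auto simp: phi_def min_def)
  qed
  define B where "B = C1 * (1/4) powr (- real CARD('n) / \<alpha>)"
  have B: "B > 0" using C1 by (simp add: B_def)
  have "pt 1 x y \<le> (B * L * L) * phi x * phi y" for x y
  proof -
    have "pt (1/4 + 1/4) y z \<le> B * m (1/4) y" for z
      by (rule CK_le) (use C1(2)[of "1/4"] B in \<open>auto simp: B_def\<close>)
    then have "pt (1/2) z y \<le> B * m (1/4) y" for z using pt_sym[of "1/2" z y] by simp
    then have "pt (1/2 + 1/2) x y \<le> B * m (1/4) y * m (1/2) x"
      by (intro CK_le) (use B m_bounds in auto)
    also have "\<dots> \<le> B * (L * phi y) * (L * phi x)"
      using B m_bounds L phi_nonneg by (intro mult_mono mphi mult_left_mono) auto
    finally show ?thesis by (simp add: mult_ac)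
  qed
  moreover have "B * L * L > 0" using B L by simp
  ultimately show ?thesis using that by blast
qed

text \<open>Cut the intermediate point z at radius R'. Inside, z is at least R - R' away from y and
  the other factor has mass m t x; outside, B bounds one factor and the other has mass at most 1. As
  B returns with coefficient 1, the step can be iterated without loss.\<close>

lemma far_step:
  assumes t: "t > 0" and R: "0 \<le> R'" "R' < R" and C: "C > 0" "\<And>t x y. t > 0 \<Longrightarrow> x \<noteq> y \<Longrightarrow> pt t x y \<le> C * t * norm (x - y) powr (- real CARD('n) - \<alpha>)"
    and B: "B \<ge> 0" "\<And>z. norm z \<ge> R' \<Longrightarrow> pt t x z \<le> B" and y: "norm y \<ge> R"
  shows "pt (t + t) x y \<le> C * t * (R - R') powr (- real CARD('n) - \<alpha>) * m t x + B"
proof -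
  define D where "D = C * t * (R - R') powr (- real CARD('n) - \<alpha>)"
  have D: "D \<ge> 0" using C t by (simp add: D_def)
  have [measurable]: "(\<lambda>z. pt t w z) \<in> borel_measurable borel" for w by (rule pt_meas[OF t])
  have "ennreal (pt (t + t) x y) \<le> (\<integral>\<^sup>+z. ennreal D * ennreal (pt t x z) + ennreal B * ennreal (pt t y z) \<partial>lborel)"
    unfolding CK[OF t t]
  proof (rule nn_integral_mono)
    fix z
    show "ennreal (pt t x z) * ennreal (pt t z y) \<le> ennreal D * ennreal (pt t x z) + ennreal B * ennreal (pt t y z)"
    proof (cases "norm z \<ge> R'")
      case True
      then have "ennreal (pt t x z) * ennreal (pt t z y) \<le> ennreal B * ennreal (pt t y z)"
        unfolding pt_sym[OF t, of z y] by (intro mult_right_mono ennreal_leI B) auto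
      then show ?thesis by (rule order_trans) simp
    next
      case False
      have d: "R - R' \<le> norm (z - y)" using False y norm_triangle_ineq2[of y z] by (simp add: norm_minus_commute)
      then have "z \<noteq> y" using R by auto
      have "pt t z y \<le> C * t * norm (z - y) powr (- real CARD('n) - \<alpha>)" by (rule C(2)[OF t \<open>z \<noteq> y\<close>])
      also have "\<dots> \<le> D"
        unfolding D_def using C t d R \<alpha> by (intro mult_left_mono powr_mono2') auto
      finally have "ennreal (pt t z y) * ennreal (pt t x z) \<le> ennreal D * ennreal (pt t x z)"
        by (intro mult_right_mono ennreal_leI) auto
      then have "ennreal (pt t x z) * ennreal (pt t z y) \<le> ennreal D * ennreal (pt t x z)" by (simp add: mult.commute)
      then show ?thesis by (rule order_trans) simp
    qed
  qed
  also have "\<dots> = ennreal D * ennreal (m t x) + ennreal B * ennreal (m t y)"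
    by (simp add: nn_integral_add nn_integral_cmult ennreal_m[OF t])
  also have "\<dots> = ennreal (D * m t x + B * m t y)"
    using D B m_bounds(1) by (simp add: ennreal_mult[symmetric] ennreal_plus[symmetric] del: ennreal_plus)
  finally have "pt (t + t) x y \<le> D * m t x + B * m t y"
    using D B m_bounds(1) by (subst (asm) ennreal_le_iff) auto
  also have "\<dots> \<le> D * m t x + B * 1"
    using B m_bounds(2)[OF t] by (intro add_left_mono mult_left_mono) auto
  finally show ?thesis by (simp add: D_def)
qed

lemma pt_far_decay:
  obtains C where "C > 0" "\<And>x y. norm x \<le> 1 \<Longrightarrow> norm y \<ge> 4 \<Longrightarrow> pt 1 x y \<le> C * norm x powr \<delta> * norm y powr (- real CARD('n) - \<alpha>)"
proof -
  define p where "p = real CARD('n) + \<alpha>"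
  have p: "p > 0" using \<alpha> by (simp add: p_def add_nonneg_pos)
  have pp: "- real CARD('n) - \<alpha> = - p" by (simp add: p_def)
  obtain C where C: "C > 0" "\<And>t x y. t > 0 \<Longrightarrow> x \<noteq> y \<Longrightarrow> pt t x y \<le> C * t * norm (x - y) powr (- real CARD('n) - \<alpha>)"
    using pt_far by blast
  obtain K where K: "K > 0" "\<And>t x. t > 0 \<Longrightarrow> m t x \<le> K * t powr (- \<delta> / \<alpha>) * norm x powr \<delta>" using m_decay by blast
  txt \<open>The radii decrease in steps proportional to \<open>q\<^sup>k\<close>; \<open>q\<close> is so close to 1 that the gain \<open>2\<^sup>-\<^sup>b\<^sup>k\<close> from the
    times \<open>2\<^sup>-\<^sup>k\<close> beats the loss \<open>q\<^sup>-\<^sup>p\<^sup>k = 2\<^sup>b\<^sup>k\<^sup>/\<^sup>2\<close>.\<close>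
  define b where "b = 1 - \<delta> / \<alpha>"
  have b: "b > 0" using \<delta> \<alpha> by (simp add: b_def)
  define q where "q = 2 powr (- (b / (2 * p)))"
  have q: "0 < q" "q < 1" using b p by (auto simp: q_def intro!: powr_less_one)
  define r where "r = 2 powr (- (b / 2))"
  have r: "0 < r" "r < 1" using b by (auto simp: r_def intro!: powr_less_one)
  define c where "c = (1 - q) / 2"
  have c: "c > 0" using q by (simp add: c_def)
  define A where "A = C * K * c powr (- p)"
  have A: "A > 0" using C K c by (simp add: A_def)
  define CC where "CC = A * (1 / (1 - r))"
  have CC: "CC > 0" using A r by (simp add: CC_def)
  have "pt 1 x y \<le> CC * norm x powr \<delta> * norm y powr (- p)" if x: "norm x \<le> 1" and y: "norm y \<ge> 4" for x y
  proof -
    define \<rho> where "\<rho> = norm y"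
    have \<rho>: "\<rho> \<ge> 4" using y by (simp add: \<rho>_def)
    \<comment> \<open>Decreases from |y| towards |y|/2 >= 2, so that all radii stay away from the
      unit ball containing x.\<close>
    define R where "R k = \<rho> * (1 + q ^ k) / 2" for k
    define S where "S = A * norm x powr \<delta> * \<rho> powr (- p)"
    have S: "S \<ge> 0" using A by (simp add: S_def)
    have Rdiff: "R k - R (Suc k) = c * q ^ k * \<rho>" for k by (simp add: R_def c_def field_simps)
    have Rpos: "0 \<le> R k" for k using \<rho> q by (simp add: R_def)
    have Rlt: "R (Suc k) < R k" for k using Rdiff[of k] c q \<rho> by (smt (verit) mult_pos_pos zero_less_power)
    \<comment> \<open>The error of splitting time 2^-k into two halves, whence the exponent k + 1:
      the factor t and the decay of m give 2^(-(k+1) b), the gap between the radii at most 2^(k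
      b/2).\<close>
    have trm: "C * (1/2)^Suc k * (R k - R (Suc k)) powr (- real CARD('n) - \<alpha>) * m ((1/2)^Suc k) x \<le> S * r ^ k" for k
    proof -
      define t where "t = (1/2::real)^Suc k"
      have t: "t > 0" by (simp add: t_def)
      have tp: "t = 2 powr (- real (Suc k))" by (simp add: t_def powr_minus powr_realpow power_divide field_simps del: of_nat_Suc power_Suc)
      have "C * t * (R k - R (Suc k)) powr (- p) * m t x \<le> C * t * (R k - R (Suc k)) powr (- p) * (K * t powr (- \<delta> / \<alpha>) * norm x powr \<delta>)"
        using C t by (intro mult_left_mono K(2)) auto
      also have Rp: "(R k - R (Suc k)) powr (- p) = c powr (- p) * (q ^ k) powr (- p) * \<rho> powr (- p)"
        unfolding Rdiff using c q \<rho> by (simp add: powr_mult)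
      also have "C * t * (c powr (- p) * (q ^ k) powr (- p) * \<rho> powr (- p)) * (K * t powr (- \<delta> / \<alpha>) * norm x powr \<delta>) =
         S * ((t * t powr (- \<delta> / \<alpha>)) * (q ^ k) powr (- p))"
        by (simp add: S_def A_def mult_ac)
      also have "(t * t powr (- \<delta> / \<alpha>)) * (q ^ k) powr (- p) \<le> r ^ k"
      proof -
        have "t * t powr (- \<delta> / \<alpha>) = t powr (1 + (- \<delta> / \<alpha>))"
          unfolding powr_add using t by simp
        also have "1 + (- \<delta> / \<alpha>) = b" by (simp add: b_def)
        also have "t powr b = 2 powr (- real (Suc k) * b)" unfolding tp powr_powr ..
        finally have 1: "t * t powr (- \<delta> / \<alpha>) = 2 powr (- real (Suc k) * b)" .
        have "(q ^ k) powr (- p) = 2 powr (real k * (b / 2))"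
          using q p by (simp add: q_def powr_powr powr_realpow[symmetric] field_simps)
        then have "(t * t powr (- \<delta> / \<alpha>)) * (q ^ k) powr (- p) = 2 powr (- real (Suc k) * b + real k * (b / 2))"
          unfolding 1 powr_add by simp
        also have "\<dots> \<le> 2 powr (real k * (- (b / 2)))" using b by (intro powr_mono) (auto simp: field_simps)
        also have "\<dots> = r ^ k" by (simp add: r_def powr_powr powr_realpow[symmetric] mult.commute)
        finally show ?thesis .
      qed
      finally show ?thesis using S unfolding t_def[symmetric] pp Rp by (simp add: mult_left_mono)
    qed
    \<comment> \<open>Each use of \<open>far_step\<close> doubles the time and moves one radius
      outwards, from a bound B at time 2^-n to one at time 1.\<close>
    have iter: "pt 1 x z \<le> B + (\<Sum>k<n. S * r ^ k)" if B: "B \<ge> 0" "\<And>z. norm z \<ge> R n \<Longrightarrow> pt ((1/2)^n) x z \<le> B" and z: "norm z \<ge> R 0" for n B z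
      using B z
    proof (induction n arbitrary: B)
      case 0
      then show ?case by simp
    next
      case (Suc n)
      have "pt 1 x z \<le> (S * r ^ n + B) + (\<Sum>k<n. S * r ^ k)"
      proof (rule Suc.IH)
        show "0 \<le> S * r ^ n + B" using S r Suc.prems by simp
        fix w :: "real^'n" assume w: "norm w \<ge> R n"
        have "pt ((1/2)^Suc n + (1/2)^Suc n) x w \<le> C * (1/2)^Suc n * (R n - R (Suc n)) powr (- real CARD('n) - \<alpha>) * m ((1/2)^Suc n) x + B"
          by (rule far_step[OF _ Rpos Rlt C]) (use Suc.prems w in auto)
        also have "\<dots> \<le> S * r ^ n + B" by (intro add_right_mono trm)
        finally show "pt ((1/2)^n) x w \<le> S * r ^ n + B" by simp
      qed (use Suc.prems in auto)
      then show ?case by (simp add: algebra_simps)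
    qed
    \<comment> \<open>The crude bound \<open>pt_far\<close> at time 2^-n serves as B. It lacks the
      factor |x|^\<delta>, but its own factor 2^-n removes it in the limit.\<close>
    have fin: "pt 1 x y \<le> C * (1/2)^n * (\<rho> / 4) powr (- p) + S * (1 / (1 - r))" for n
    proof -
      have "pt 1 x y \<le> C * (1/2)^n * (\<rho> / 4) powr (- p) + (\<Sum>k<n. S * r ^ k)"
      proof (rule iter)
        show "0 \<le> C * (1/2)^n * (\<rho> / 4) powr (- p)" using C by simp
        show "R 0 \<le> norm y" by (simp add: R_def \<rho>_def)
        fix z :: "real^'n" assume z: "norm z \<ge> R n"
        have "R n \<ge> \<rho> / 2" using \<rho> q by (simp add: R_def)
        then have "norm z \<ge> \<rho> / 2" using z by simp
        then have d: "norm (x - z) \<ge> \<rho> / 4" using x \<rho> norm_triangle_ineq2[of z x] by (simp add: norm_minus_commute)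
        then have "x \<noteq> z" using \<rho> by auto
        have "pt ((1/2)^n) x z \<le> C * (1/2)^n * norm (x - z) powr (- real CARD('n) - \<alpha>)"
          by (rule C(2)[OF _ \<open>x \<noteq> z\<close>]) simp
        also have "\<dots> \<le> C * (1/2)^n * (\<rho> / 4) powr (- p)"
          unfolding pp using C d \<rho> p by (intro mult_left_mono powr_mono2') auto
        finally show "pt ((1/2)^n) x z \<le> C * (1/2)^n * (\<rho> / 4) powr (- p)" .
      qed
      also have "(\<Sum>k<n. S * r ^ k) \<le> S * (1 / (1 - r))"
      proof -
        have "(\<Sum>k<n. r ^ k) \<le> (\<Sum>k. r ^ k)" using r by (intro sum_le_suminf summable_geometric) auto
        also have "\<dots> = 1 / (1 - r)" using r by (intro suminf_geometric) auto
        finally show ?thesis using S unfolding sum_distrib_left[symmetric] by (intro mult_left_mono)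
      qed
      finally show ?thesis by simp
    qed
    have "(\<lambda>n. C * (1/2)^n * (\<rho> / 4) powr (- p) + S * (1 / (1 - r))) \<longlonglongrightarrow> C * 0 * (\<rho> / 4) powr (- p) + S * (1 / (1 - r))"
      by (intro tendsto_intros LIMSEQ_realpow_zero) auto
    then have "pt 1 x y \<le> C * 0 * (\<rho> / 4) powr (- p) + S * (1 / (1 - r))"
      by (rule LIMSEQ_le_const) (use fin in auto)
    then show ?thesis by (simp add: S_def CC_def \<rho>_def mult_ac)
  qed
  then show ?thesis using that[of CC] CC unfolding pp by blast
qed

theorem pt_bound:
  "\<exists>C>0. \<forall>x y. pt 1 x y \<le> C * min 1 (norm x powr \<delta>) * min 1 (norm y powr \<delta>) * heat \<alpha> 1 (x - y)"
proof -
  define p where "p = real CARD('n) + \<alpha>"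
  have p: "p > 0" using \<alpha> by (simp add: p_def add_nonneg_pos)
  have pp: "- real CARD('n) - \<alpha> = - p" by (simp add: p_def)
  obtain c where c: "c > 0" "\<And>x::real^'n. c * min 1 (norm x powr (- p)) \<le> heat \<alpha> 1 x"
    using heat_lower unfolding pp by blast
  obtain C1 where C1: "C1 > 0" "\<And>x y. pt 1 x y \<le> C1 * phi x * phi y" using pt_near by blast
  obtain C2 where C2: "C2 > 0" "\<And>t x y. t > 0 \<Longrightarrow> x \<noteq> y \<Longrightarrow> pt t x y \<le> C2 * t * norm (x - y) powr (- p)"
    using pt_far unfolding pp by blast
  obtain C3 where C3: "C3 > 0" "\<And>x y. norm x \<le> 1 \<Longrightarrow> norm y \<ge> 4 \<Longrightarrow> pt 1 x y \<le> C3 * norm x powr \<delta> * norm y powr (- p)"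
    using pt_far_decay unfolding pp by blast
  have hn: "0 \<le> heat \<alpha> 1 (z::real^'n)" for z by (rule heat_nonneg) simp
  have hs: "heat \<alpha> 1 (x - y) = heat \<alpha> 1 (y - x)" for x y :: "real^'n"
    by (intro antisym heat_decr) (auto simp: norm_minus_commute)
  define C where "C = C1 * 5 powr p / c + C2 / c + C3 * 2 powr p / c"
  have Cpos: "C1 * 5 powr p / c > 0" "C2 / c > 0" "C3 * 2 powr p / c > 0"
    using C1(1) C2(1) C3(1) c(1) by auto
  have phi1: "phi x = 1" if "norm x \<ge> 1" for x
    using that \<delta> by (simp add: phi_def ge_one_powr_ge_zero min_def)
  have phi2: "phi x = norm x powr \<delta>" if "norm x \<le> 1" for x
    using that \<delta> by (simp add: phi_def powr_le1 min.absorb2)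
  have weaken: "pt 1 x y \<le> C * phi x * phi y * heat \<alpha> 1 (x - y)"
    if "pt 1 x y \<le> D * (phi x * phi y * heat \<alpha> 1 (x - y))" "D \<le> C" for D x y
  proof -
    have "D * (phi x * phi y * heat \<alpha> 1 (x - y)) \<le> C * (phi x * phi y * heat \<alpha> 1 (x - y))"
      using that phi_nonneg hn by (intro mult_right_mono) auto
    then show ?thesis using that by (simp add: mult.assoc)
  qed
  have far: "pt 1 x y \<le> C * phi x * phi y * heat \<alpha> 1 (x - y)" if x: "norm x \<le> 1" and y: "norm y \<ge> 4" for x y
  proof (rule weaken)
    \<comment> \<open>Here 1 <= |x - y| <= 2 |y|, so the lower heat kernel bound is in its power
      regime and a power of |y| may replace one of |x - y|.\<close>
    have "norm (x - y) \<le> 2 * norm y" using x y norm_triangle_ineq4[of x y] by linarith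
    moreover have "norm (x - y) \<ge> 1" using x y norm_triangle_ineq3[of x y] by linarith
    ultimately have "(2 * norm y) powr (- p) \<le> min 1 (norm (x - y) powr (- p))"
    proof -
      assume a: "norm (x - y) \<le> 2 * norm y" "norm (x - y) \<ge> 1"
      have "(2 * norm y) powr (- p) \<le> norm (x - y) powr (- p)" using a p by (intro powr_mono2') auto
      moreover have "norm (x - y) powr (- p) \<le> 1" using a p powr_mono2'[of "- p" 1 "norm (x - y)"] by simp
      ultimately show ?thesis by simp
    qed
    then have "c * (2 * norm y) powr (- p) \<le> c * min 1 (norm (x - y) powr (- p))" using c(1) by (intro mult_left_mono) auto
    also have "\<dots> \<le> heat \<alpha> 1 (x - y)" by (rule c(2))
    finally have "2 powr p / c * (c * (2 * norm y) powr (- p)) \<le> 2 powr p / c * heat \<alpha> 1 (x - y)"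
      using c(1) by (intro mult_left_mono) auto
    moreover have "2 powr p / c * (c * (2 * norm y) powr (- p)) = norm y powr (- p)"
      using c(1) by (simp add: powr_mult powr_minus)
    ultimately have "norm y powr (- p) \<le> 2 powr p / c * heat \<alpha> 1 (x - y)" by simp
    then have "C3 * norm x powr \<delta> * norm y powr (- p) \<le> C3 * norm x powr \<delta> * (2 powr p / c * heat \<alpha> 1 (x - y))"
      using C3(1) by (intro mult_left_mono) auto
    then show "pt 1 x y \<le> C3 * 2 powr p / c * (phi x * phi y * heat \<alpha> 1 (x - y))"
      using C3(2)[OF x y] y by (simp add: phi1 phi2[OF x] mult_ac)
    show "C3 * 2 powr p / c \<le> C" using Cpos by (simp add: C_def)
  qed
  have both: "pt 1 x y \<le> C * phi x * phi y * heat \<alpha> 1 (x - y)" if x: "norm x \<ge> 1" and y: "norm y \<ge> 1" and xy: "norm (x - y) > 5" for x y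
  proof (rule weaken)
    have "norm (x - y) powr (- p) \<le> 1" using xy p powr_mono2'[of "- p" 1 "norm (x - y)"] by simp
    then have e: "min 1 (norm (x - y) powr (- p)) = norm (x - y) powr (- p)" by simp
    have "x \<noteq> y" using xy by auto
    then have "pt 1 x y \<le> C2 * min 1 (norm (x - y) powr (- p))" using C2(2)[of 1 x y] unfolding e by simp
    also have "\<dots> = C2 / c * (c * min 1 (norm (x - y) powr (- p)))" using c(1) by simp
    also have "\<dots> \<le> C2 / c * heat \<alpha> 1 (x - y)"
      using Cpos(2) by (intro mult_left_mono c(2)) auto
    finally show "pt 1 x y \<le> C2 / c * (phi x * phi y * heat \<alpha> 1 (x - y))" by (simp add: phi1 x y)
    show "C2 / c \<le> C" using Cpos by (simp add: C_def)
  qed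
  have near: "pt 1 x y \<le> C * phi x * phi y * heat \<alpha> 1 (x - y)" if xy: "norm (x - y) \<le> 5" for x y
  proof (rule weaken)
    obtain e :: "real^'n" where e: "norm e = 5" using vector_choose_size[of 5] by auto
    have "c * 5 powr (- p) = c * min 1 (norm e powr (- p))"
      using p powr_mono2'[of "- p" 1 5] by (simp add: e min_def)
    also have "\<dots> \<le> heat \<alpha> 1 e" by (rule c(2))
    also have "\<dots> \<le> heat \<alpha> 1 (x - y)" using xy e by (intro heat_decr) auto
    finally have "1 \<le> 5 powr p / c * heat \<alpha> 1 (x - y)" using c(1) by (simp add: powr_minus field_simps)
    then have "C1 * phi x * phi y * 1 \<le> C1 * phi x * phi y * (5 powr p / c * heat \<alpha> 1 (x - y))"
      using C1(1) phi_nonneg by (intro mult_left_mono) auto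
    then show "pt 1 x y \<le> C1 * 5 powr p / c * (phi x * phi y * heat \<alpha> 1 (x - y))"
      using C1(2)[of x y] by (simp add: mult_ac)
    show "C1 * 5 powr p / c \<le> C" using Cpos by (simp add: C_def)
  qed
  have "pt 1 x y \<le> C * phi x * phi y * heat \<alpha> 1 (x - y)" for x y
  proof -
    \<comment> \<open>If |x - y| > 5 and one of the norms is below 1, the other exceeds 4; this ties
      the two thresholds together.\<close>
    have "norm (x - y) \<le> norm x + norm y" by (rule norm_triangle_ineq4)
    then consider "norm x \<le> 1 \<and> norm y \<ge> 4" | "norm y \<le> 1 \<and> norm x \<ge> 4" | "norm x \<ge> 1 \<and> norm y \<ge> 1 \<and> norm (x - y) > 5" | "norm (x - y) \<le> 5"
      by linarith
    then show ?thesis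
    proof cases
      case 2
      then have "pt 1 y x \<le> C * phi y * phi x * heat \<alpha> 1 (y - x)" by (intro far) auto
      then show ?thesis using pt_sym[of 1 x y] hs[of x y] by (simp add: mult_ac)
    qed (use far both near in auto)
  qed
  moreover have "C > 0" using Cpos by (simp add: C_def)
  ultimately show ?thesis unfolding phi_def by blast
qed

end

section \<open>Verifying the kernel hypotheses for the process\<close>

lemma AE_le_if_set_integrals_le:
  fixes f g :: "'a \<Rightarrow> real"
  assumes [measurable]: "f \<in> borel_measurable M" "g \<in> borel_measurable M" and g: "\<And>x. 0 \<le> g x"
    and fin: "(\<integral>\<^sup>+x. ennreal (g x) \<partial>M) < \<infinity>"
    and le: "\<And>B. B \<in> sets M \<Longrightarrow> (\<integral>\<^sup>+x. ennreal (f x) * indicator B x \<partial>M) \<le> (\<integral>\<^sup>+x. ennreal (g x) * indicator B x \<partial>M)"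
  shows "AE x in M. f x \<le> g x"
proof -
  \<comment> \<open>The set on which the claim fails. Since g has finite integral over it, the set
    inequality leaves no mass for f - g there.\<close>
  define B where "B = {x \<in> space M. g x < f x}"
  have [measurable]: "B \<in> sets M" unfolding B_def by measurable
  define b where "b = (\<integral>\<^sup>+x. ennreal (g x) * indicator B x \<partial>M)"
  have "b \<le> (\<integral>\<^sup>+x. ennreal (g x) \<partial>M)" unfolding b_def by (intro nn_integral_mono) (auto simp: indicator_def)
  then have bfin: "b < \<infinity>" using fin by (rule le_less_trans)
  have "b + (\<integral>\<^sup>+x. ennreal (f x - g x) * indicator B x \<partial>M) = (\<integral>\<^sup>+x. ennreal (g x) * indicator B x + ennreal (f x - g x) * indicator B x \<partial>M)"
    unfolding b_def by (rule nn_integral_add[symmetric]) measurable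
  also have "\<dots> = (\<integral>\<^sup>+x. ennreal (f x) * indicator B x \<partial>M)"
    using g by (intro nn_integral_cong) (auto simp: B_def indicator_def ennreal_plus[symmetric] simp del: ennreal_plus)
  also have "\<dots> \<le> b + 0" unfolding b_def using le[of B] by simp
  finally have "(\<integral>\<^sup>+x. ennreal (f x - g x) * indicator B x \<partial>M) \<le> 0"
    using bfin unfolding ennreal_add_left_cancel_le by auto
  then have "(\<integral>\<^sup>+x. ennreal (f x - g x) * indicator B x \<partial>M) = 0" by simp
  then have "AE x in M. ennreal (f x - g x) * indicator B x = 0"
    by (subst (asm) nn_integral_0_iff_AE) auto
  then show ?thesis using AE_space
    by eventually_elim (auto simp: B_def indicator_def ennreal_eq_0_iff split: if_splits)
qed

context hardy_process
begin

lemma fk_weight_measurable [measurable]: "fk_weight \<alpha> \<delta> X t \<in> borel_measurable M"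
  unfolding fk_weight_def[abs_def] Let_def pot_def by measurable

lemma fk_weight_le_1: "ennreal (fk_weight \<alpha> \<delta> X t \<omega>) \<le> 1"
  unfolding fk_weight_def Let_def by auto

text \<open>Equality on all Borel sets says that the measure with density q is the law of X t under
  the weighted probability, so it extends to all nonnegative measurable h.\<close>

lemma fk_kernel_expectation:
  assumes [measurable]: "q \<in> borel_measurable borel" "h \<in> borel_measurable borel"
    and eq: "\<And>B. B \<in> sets borel \<Longrightarrow> (\<integral>\<^sup>+y. ennreal (q y) * indicator B y \<partial>lborel) =
         (\<integral>\<^sup>+\<omega>. indicator B (X t \<omega>) * ennreal (fk_weight \<alpha> \<delta> X t \<omega>) \<partial>M)"
  shows "(\<integral>\<^sup>+y. ennreal (q y) * h y \<partial>lborel) = (\<integral>\<^sup>+\<omega>. h (X t \<omega>) * ennreal (fk_weight \<alpha> \<delta> X t \<omega>) \<partial>M)"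
proof -
  define K where "K = distr (density M (\<lambda>\<omega>. ennreal (fk_weight \<alpha> \<delta> X t \<omega>))) borel (X t)"
  have "density lborel (\<lambda>y. ennreal (q y)) = K"
  proof (rule measure_eqI)
    fix B assume "B \<in> sets (density lborel (\<lambda>y. ennreal (q y)))"
    then have [measurable]: "B \<in> sets borel" by simp
    have "emeasure K B = (\<integral>\<^sup>+\<omega>. ennreal (fk_weight \<alpha> \<delta> X t \<omega>) * indicator (X t -` B \<inter> space M) \<omega> \<partial>M)"
      unfolding K_def by (subst emeasure_distr, simp, simp, subst emeasure_density) auto
    also have "\<dots> = (\<integral>\<^sup>+\<omega>. indicator B (X t \<omega>) * ennreal (fk_weight \<alpha> \<delta> X t \<omega>) \<partial>M)"
      by (intro nn_integral_cong) (auto simp: indicator_def)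
    also have "\<dots> = emeasure (density lborel (\<lambda>y. ennreal (q y))) B"
      by (subst emeasure_density) (auto simp: eq)
    finally show "emeasure (density lborel (\<lambda>y. ennreal (q y))) B = emeasure K B" ..
  qed (simp add: K_def)
  then have "(\<integral>\<^sup>+y. h y \<partial>density lborel (\<lambda>y. ennreal (q y))) = (\<integral>\<^sup>+y. h y \<partial>K)" by simp
  then show ?thesis unfolding K_def
    by (subst (asm) nn_integral_density, measurable, subst (asm) nn_integral_distr, measurable, subst (asm) nn_integral_density) (auto simp: mult.commute)
qed

end

theorem theorem3p5:
  fixes \<alpha> \<delta> :: real
    and M :: "real^'n \<Rightarrow> 'a measure"
    and X :: "real^'n \<Rightarrow> real \<Rightarrow> 'a \<Rightarrow> real^'n"
    and pt :: "real \<Rightarrow> real^'n \<Rightarrow> real^'n \<Rightarrow> real"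
  assumes "0 < \<alpha>" "\<alpha> < real CARD('n)" "\<alpha> < 2" "0 < \<delta>" "\<delta> < \<alpha>"
    and "\<And>x. stable_process \<alpha> (M x) (X x) x"
    and "fk_kernel \<alpha> \<delta> M X pt"
  shows "\<exists>C>0. \<forall>x y. pt 1 x y \<le>
           C * min 1 (norm x powr \<delta>) * min 1 (norm y powr \<delta>) * heat \<alpha> 1 (x - y)"
proof -
  note SP = assms(6)
  interpret hardy \<alpha> "TYPE('n)" \<delta>
    by unfold_locales (use assms(1-5) stable_process_mass[OF SP] in auto)
  have hp: "hardy_process \<alpha> \<delta> (M x) (X x) x" for x
  proof -
    interpret prob_space "M x" using SP[of x] by (simp add: stable_process_def)
    show ?thesis by unfold_locales (rule SP)
  qed
  \<comment> \<open>\<open>P\<close> involves no process, so its semigroup law at z may be taken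
    from the process started at z.\<close>
  have hs: "hardy_semigroup \<alpha> \<delta> (M x) (X x) x" for x
  proof -
    interpret hardy_process \<alpha> "TYPE('n)" \<delta> "M x" "X x" x by (rule hp)
    show ?thesis
    proof unfold_locales
      fix s r :: real and f :: "real^'n \<Rightarrow> ennreal" and z :: "real^'n"
      assume "s > 0" "r > 0" "f \<in> borel_measurable borel"
      then show "P s (P r f) z = P (s + r) f z"
        using hardy_process.P_semigroup_start[OF hp[of z]] by blast
    qed
  qed
  note FK = assms(7)[unfolded fk_kernel_def]
  have K1: "pt t x y \<ge> 0 \<and> pt t x y = pt t y x" if "t > 0" for t x y
    using FK[THEN conjunct1] that by simp
  have K2: "pt t 0 y = 0" if "t > 0" for t y
    using FK[THEN conjunct2, THEN conjunct1] that by simp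
  have K3: "pt t x \<in> borel_measurable borel" if "t > 0" for t x
    using FK[THEN conjunct2, THEN conjunct2, THEN conjunct1] that by simp
  have K4: "ennreal (pt (t + s) x y) = (\<integral>\<^sup>+z. ennreal (pt t x z) * ennreal (pt s z y) \<partial>lborel)" if "t > 0" "s > 0" for t s x y
    using FK[THEN conjunct2, THEN conjunct2, THEN conjunct2, THEN conjunct1] that by simp
  have K5: "(\<integral>\<^sup>+y. ennreal (pt t x y) * indicator B y \<partial>lborel) =
         (\<integral>\<^sup>+\<omega>. indicator B (X x t \<omega>) * ennreal (fk_weight \<alpha> \<delta> (X x) t \<omega>) \<partial>M x)" if "t > 0" "x \<noteq> 0" "B \<in> sets borel" for t x B
    using FK[THEN conjunct2, THEN conjunct2, THEN conjunct2, THEN conjunct2] that by simp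
  interpret hardy_kernel \<alpha> "TYPE('n)" \<delta> pt
  proof unfold_locales
    fix t :: real and x :: "real^'n" assume t: "t > 0"
    interpret S: hardy_semigroup \<alpha> "TYPE('n)" \<delta> "M x" "X x" x by (rule hs)
    note [measurable] = K3[OF t]
    \<comment> \<open>The Feynman-Kac formula is given for x \<noteq> 0; at x = 0 the kernel
      vanishes by convention and the three claims are checked directly.\<close>
    have ex: "(\<integral>\<^sup>+y. ennreal (pt t x y) * h y \<partial>lborel) = (\<integral>\<^sup>+\<omega>. h (X x t \<omega>) * ennreal (fk_weight \<alpha> \<delta> (X x) t \<omega>) \<partial>M x)"
      if "x \<noteq> 0" "h \<in> borel_measurable borel" for h
      by (rule S.fk_kernel_expectation) (use K3 K5 t that in auto)
    have le: "(\<integral>\<^sup>+y. ennreal (pt t x y) * h y \<partial>lborel) \<le> P t h x" if x: "x \<noteq> 0" and h[measurable]: "h \<in> borel_measurable borel" for h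
    proof -
      have "(\<integral>\<^sup>+y. ennreal (pt t x y) * h y \<partial>lborel) \<le> (\<integral>\<^sup>+\<omega>. h (X x t \<omega>) * 1 \<partial>M x)"
        unfolding ex[OF x h] by (intro nn_integral_mono mult_left_mono S.fk_weight_le_1) auto
      then show ?thesis using S.P_expectation[OF t h] by simp
    qed
    show "(\<integral>\<^sup>+y. ennreal (pt t x y) \<partial>lborel) \<le> 1"
    proof (cases "x = 0")
      case False
      then show ?thesis using le[of "\<lambda>_. 1"] mass[OF t] by (simp add: P_def)
    qed (simp add: K2[OF t])
    show "(\<integral>\<^sup>+y. ennreal (norm y powr \<delta>) * ennreal (pt t x y) \<partial>lborel) \<le> ennreal (norm x powr \<delta>)"
    proof (cases "x = 0")
      case False
      then show ?thesis using ex[of "\<lambda>y. ennreal (norm y powr \<delta>)"] S.fk_bound[OF t] by (simp add: mult.commute)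
    qed (simp add: K2[OF t])
    show "AE y in lborel. pt t x y \<le> heat \<alpha> t (y - x)"
    proof (cases "x = 0")
      case False
      show ?thesis
      proof (rule AE_le_if_set_integrals_le)
        have tr: "(\<integral>\<^sup>+y. ennreal (heat \<alpha> t (y - x)) * h y \<partial>lborel) = P t h x" if [measurable]: "h \<in> borel_measurable borel" for h
          using nn_integral_translation[of "\<lambda>y. ennreal (heat \<alpha> t (y - x)) * h y" x] by (simp add: P_def mult.commute)
        show "(\<integral>\<^sup>+y. ennreal (heat \<alpha> t (y - x)) \<partial>lborel) < \<infinity>"
          using tr[of "\<lambda>_. 1"] mass[OF t] by (simp add: P_def)
        fix B :: "(real^'n) set" assume "B \<in> sets lborel"
        then have [measurable]: "B \<in> sets borel" by simp
        show "(\<integral>\<^sup>+y. ennreal (pt t x y) * indicator B y \<partial>lborel) \<le> (\<integral>\<^sup>+y. ennreal (heat \<alpha> t (y - x)) * indicator B y \<partial>lborel)"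
          using le[OF False, of "indicator B"] tr[of "indicator B"] by simp
      qed (auto intro: heat_nonneg[OF t])
    qed (use K2[OF t] heat_nonneg[OF t] in simp)
  qed (use K1 K3 K4 in auto)
  show ?thesis by (rule pt_bound)
qed

end
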